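(* Let $\mathcal{F}$ be a singular holomorphic foliation on $\overline{\mathbb{C}} \times \mathbb{C}P(2)$ given by a polynomial vector field $X$ in affine coordinates $(x,y,z)$ on $\mathbb{C} \times \mathbb{C}^2\hookrightarrow \overline{\mathbb{C}} \times \mathbb{C}P(2)$. If $\mathcal{F}$ is transverse to almost every fiber of the fibre bundle $\eta$ with projection $\pi: \overline{\mathbb{C}} \times \mathbb{C}P(2) \to \overline{\mathbb{C}}$, $\pi(z_1,z_2)=z_1$, then $\mathcal{F}$ is a Riccati foliation and, in the affine coordinates $(x,y,z)\in\mathbb{C}\times\mathbb{C}^2$, $$X(x,y,z)= p(x)\frac{\partial}{\partial x}+ Q(x,y,z)\frac{\partial}{\partial y} + R(x,y,z)\frac{\partial}{\partial z},$$ where $$Q(x,y,z)=A(x)+B(x)y+C(x)z+D(x)yz+E(x)y^2,$$ $$R(x,y,z)=a(x)+b(x)y+c(x)z+E(x)yz+D(x)z^2,$$ and $p, a, b, c, A, B, C, D, E\in \mathbb{C}[x]$.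
   Context: $\overline{\mathbb{C}}=\mathbb{C}\cup\{\infty\}$ is the Riemann sphere, $\mathbb{C}P(2)$ the complex projective plane; $\mathbb{C}\times\mathbb{C}^2\hookrightarrow\overline{\mathbb{C}}\times\mathbb{C}P(2)$ is a standard affine chart. All foliations are holomorphic, possibly singular, and one-dimensional; a foliation given by a polynomial vector field $X$ in an affine chart is the one on the compact manifold whose leaves in that chart are tangent to $X$. Let $\eta=(E,\pi,B,F)$ be a holomorphic fibre bundle with total space $E$, projection $\pi:E\to B$ and fiber $F$. A (nonsingular) holomorphic foliation $\mathcal{F}$ on $E$ is transverse to $\eta$ if: (1) for each $p\in E$ the leaf $L_p$ of $\mathcal{F}$ through $p$ is transverse to the fiber $\pi^{-1}(\pi(p))$; (2) $\dim \mathcal{F}+\dim F=\dim E$; (3) for each leaf $L$ of $\mathcal{F}$, the restriction $\pi|_L:L\to B$ is a covering map (if $F$ is compact, (3) follows from (1) and (2)). A singular holomorphic foliation $\mathcal{F}$ on $E$ is transverse to almost every fiber of $\eta$ if there is a proper analytic subset $\Lambda(\mathcal{F})\subset E$, a union of fibers of $\eta$, such that the restriction $\mathcal{F}_0$ of $\mathcal{F}$ to $E_0=E\smallsetminus\Lambda(\mathcal{F})$ is (nonsingular and) transverse to the subbundle $\eta_0$ of $\eta$ with total space $E_0$. If $\Lambda(\mathcal{F})$ is minimal with this property it is called the exceptional set of $\mathcal{F}$. A Riccati foliation is a foliation transverse to almost every fiber of $\eta$ whose exceptional set $\Lambda(\mathcal{F})$ is $\mathcal{F}$-invariant. Here the total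 space is $\overline{\mathbb{C}}\times\mathbb{C}P(2)$, the base is $\overline{\mathbb{C}}$ and the fiber is $\mathbb{C}P(2)$. *)

theory Defs
  imports "HOL-Analysis.Analysis" "HOL-Computational_Algebra.Polynomial"
begin

section \<open>The Riemann sphere, the projective plane and their product\<close>

text \<open>The Riemann sphere is the type \<open>complex option\<close>, with \<open>None\<close> as the point at infinity. This
  is the carrier of the library's one-point compactification, which supplies its topology.\<close>

abbreviation sphere_top :: "complex option topology" where
  "sphere_top \<equiv> Alexandroff_compactification euclidean"

definition sphere_charts :: "(complex \<Rightarrow> complex option) set" where
  "sphere_charts = {Some, \<lambda>w. if w = 0 then None else Some (inverse w)}"

definition projrel :: "complex^3 \<Rightarrow> complex^3 \<Rightarrow> bool" where
  "projrel v w \<longleftrightarrow> v \<noteq> 0 \<and> w \<noteq> 0 \<and> (\<exists>c. w = c *s v)"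

lemma part_equivp_projrel: "part_equivp projrel"
proof (rule part_equivpI)
  have "projrel (axis 1 1) (axis 1 1)"
    by (auto simp: projrel_def axis_eq_0_iff intro!: exI[of _ 1])
  then show "\<exists>v. projrel v v" ..
  show "symp projrel"
  proof (rule sympI)
    fix v w assume "projrel v w"
    then obtain c where c: "v \<noteq> 0" "w \<noteq> 0" "w = c *s v"
      by (auto simp: projrel_def)
    then have "v = inverse c *s w"
      by (auto simp: vector_smult_assoc)
    with c(1,2) show "projrel w v"
      by (auto simp: projrel_def)
  qed
  show "transp projrel"
    by (rule transpI) (auto simp: projrel_def vector_smult_assoc)
qed

quotient_type cp2 = "complex^3" / partial: projrel
  by (rule part_equivp_projrel)

definition homog :: "complex \<Rightarrow> complex \<Rightarrow> complex \<Rightarrow> cp2" where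
  "homog a b c = abs_cp2 (vector [a, b, c])"

definition cp2_charts :: "(complex \<Rightarrow> complex \<Rightarrow> cp2) set" where
  "cp2_charts = {\<lambda>s t. homog 1 s t, \<lambda>s t. homog s 1 t, \<lambda>s t. homog s t 1}"

type_synonym total = "complex option \<times> cp2"

text \<open>A chart is given by its inverse, a bijection from all of \<open>\<complex>\<^sup>3\<close> onto an open subset. In
  each chart the first coordinate is a coordinate on the base and the other two are coordinates
  on the fibre.\<close>

type_synonym chart = "complex^3 \<Rightarrow> total"

definition total_charts :: "chart set" where
  "total_charts = {\<lambda>v. (\<sigma> (v$1), \<tau> (v$2) (v$3)) | \<sigma> \<tau>. \<sigma> \<in> sphere_charts \<and> \<tau> \<in> cp2_charts}"

definition affine_chart :: chart where
  "affine_chart v = (Some (v$1), homog 1 (v$2) (v$3))"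


section \<open>Holomorphic functions, vector fields and analytic sets\<close>

definition holo_fun :: "(complex^3 \<Rightarrow> complex) \<Rightarrow> (complex^3) set \<Rightarrow> bool" where
  "holo_fun f U \<longleftrightarrow>
     (\<forall>v\<in>U. \<exists>D. (f has_derivative D) (at v) \<and> (\<forall>c h. D (c *s h) = c * D h))"

definition holo_field :: "(complex^3 \<Rightarrow> complex^3) \<Rightarrow> (complex^3) set \<Rightarrow> bool" where
  "holo_field Y U \<longleftrightarrow> (\<forall>i. holo_fun (\<lambda>v. Y v $ i) U)"

definition analytic_subset :: "total set \<Rightarrow> bool" where
  "analytic_subset Z \<longleftrightarrow>
     (\<forall>\<phi>\<in>total_charts. \<forall>v. \<exists>U fs. open U \<and> v \<in> U \<and> finite fs \<and> (\<forall>f\<in>fs. holo_fun f U) \<and>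
        {u\<in>U. \<phi> u \<in> Z} = {u\<in>U. \<forall>f\<in>fs. f u = 0})"

definition poly_fun3 :: "(complex^3 \<Rightarrow> complex) \<Rightarrow> bool" where
  "poly_fun3 f \<longleftrightarrow>
     (\<exists>N c. \<forall>v. f v = (\<Sum>i\<le>N. \<Sum>j\<le>N. \<Sum>k\<le>N. c i j k * (v$1)^i * (v$2)^j * (v$3)^(k::nat)))"

definition poly_field :: "(complex^3 \<Rightarrow> complex^3) \<Rightarrow> bool" where
  "poly_field X \<longleftrightarrow> (\<forall>i. poly_fun3 (\<lambda>v. X v $ i))"


section \<open>Singular one-dimensional holomorphic foliations\<close>

text \<open>A local generator \<open>(\<phi>, U, Y)\<close> is a holomorphic vector field \<open>Y\<close> written in the chart \<open>\<phi>\<close>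
  on the open set \<open>U\<close>. A singular foliation is given by local generators covering the manifold,
  any two of which differ on their overlap by a nowhere vanishing holomorphic factor. Its
  singular points are the zeros of the generators. These zeros are required to be nowhere dense
  only, so foliations with singular set of codimension at least two are a special case.\<close>

type_synonym generator = "chart \<times> (complex^3) set \<times> (complex^3 \<Rightarrow> complex^3)"

fun is_generator :: "generator \<Rightarrow> bool" where
  "is_generator (\<phi>, U, Y) \<longleftrightarrow>
     \<phi> \<in> total_charts \<and> open U \<and> holo_field Y U \<and> interior {v\<in>U. Y v = 0} = {}"

fun compatible :: "generator \<Rightarrow> generator \<Rightarrow> bool" where
  "compatible (\<phi>, U, Y) (\<psi>, V, Z) \<longleftrightarrow>
     (\<exists>g. holo_fun g {u\<in>U. \<phi> u \<in> \<psi> ` V} \<and>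
       (\<forall>u\<in>U. \<phi> u \<in> \<psi> ` V \<longrightarrow>
          g u \<noteq> 0 \<and>
          frechet_derivative (inv \<psi> \<circ> \<phi>) (at u) (Y u) = g u *s Z (inv \<psi> (\<phi> u))))"

definition singular_foliation :: "generator set \<Rightarrow> bool" where
  "singular_foliation F \<longleftrightarrow>
     (\<forall>G\<in>F. is_generator G) \<and>
     (\<Union>(\<phi>, U, Y)\<in>F. \<phi> ` U) = UNIV \<and>
     (\<forall>G\<in>F. \<forall>H\<in>F. compatible G H)"

text \<open>The field \<open>X\<close> generates the foliation in the affine chart. So its zeros there are exactly
  the singular points of the foliation, and elsewhere in the chart it is tangent to the leaves.\<close>

definition given_by :: "generator set \<Rightarrow> (complex^3 \<Rightarrow> complex^3) \<Rightarrow> bool" where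
  "given_by F X \<longleftrightarrow> (\<forall>H\<in>F. compatible (affine_chart, UNIV, X) H)"

definition singular_set :: "generator set \<Rightarrow> total set" where
  "singular_set F = {\<phi> v | \<phi> U Y v. (\<phi>, U, Y) \<in> F \<and> v \<in> U \<and> Y v = 0}"

definition restrict_foliation :: "generator set \<Rightarrow> total set \<Rightarrow> generator set" where
  "restrict_foliation F M = {(\<phi>, {v\<in>U. \<phi> v \<in> M}, Y) | \<phi> U Y. (\<phi>, U, Y) \<in> F}"

text \<open>Integral arcs are images of nonconstant complex-time solutions of \<open>\<gamma>' = Y \<circ> \<gamma>\<close>. They form a
  basis of the leaf topology, which is finer than the topology induced from the manifold. The
  leaf through a point consists of the points joined to it by a chain of integral arcs.\<close>

definition integral_arcs :: "generator set \<Rightarrow> total set set" where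
  "integral_arcs F =
     {\<phi> ` \<gamma> ` D | \<phi> U Y \<gamma> D. (\<phi>, U, Y) \<in> F \<and> open D \<and> connected D \<and> \<gamma> ` D \<subseteq> U \<and>
        (\<forall>t\<in>D. Y (\<gamma> t) \<noteq> 0 \<and> (\<gamma> has_derivative (\<lambda>h. h *s Y (\<gamma> t))) (at (t::complex)))}"

definition leaf :: "generator set \<Rightarrow> total \<Rightarrow> total set" where
  "leaf F p = {q. (\<lambda>a b. \<exists>P\<in>integral_arcs F. a \<in> P \<and> b \<in> P)\<^sup>*\<^sup>* p q}"

definition leaf_top :: "generator set \<Rightarrow> total \<Rightarrow> total topology" where
  "leaf_top F p = subtopology (topology_generated_by (integral_arcs F)) (leaf F p)"

definition invariant_set :: "generator set \<Rightarrow> total set \<Rightarrow> bool" where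
  "invariant_set F \<Lambda> \<longleftrightarrow> (\<forall>p\<in>\<Lambda> - singular_set F. leaf F p \<subseteq> \<Lambda>)"


section \<open>Transversality to the fibration and Riccati foliations\<close>

text \<open>The library's \<open>covering_space\<close> for abstract topologies. It is needed because the leaf
  topology is not a subspace topology.\<close>

definition covering_map :: "'a topology \<Rightarrow> 'b topology \<Rightarrow> ('a \<Rightarrow> 'b) \<Rightarrow> bool" where
  "covering_map S T f \<longleftrightarrow>
     continuous_map S T f \<and> f ` topspace S = topspace T \<and>
     (\<forall>b\<in>topspace T. \<exists>V. b \<in> V \<and> openin T V \<and>
        (\<exists>\<U>. \<Union>\<U> = {x \<in> topspace S. f x \<in> V} \<and> (\<forall>U\<in>\<U>. openin S U) \<and> pairwise disjnt \<U> \<and>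
             (\<forall>U\<in>\<U>. homeomorphic_map (subtopology S U) (subtopology T V) f)))"

text \<open>In every chart the tangent space of the fibre is \<open>{w. w$1 = 0}\<close>, and the tangent space of the
  leaf is the line spanned by a generator. The dimension condition on leaves and fibres reads
  \<open>1 + 2 = 3\<close> here.\<close>

definition transverse_at_points :: "generator set \<Rightarrow> bool" where
  "transverse_at_points F \<longleftrightarrow>
     (\<forall>(\<phi>, U, Y)\<in>F. \<forall>v\<in>U. {c *s Y v + w | c w. w$1 = 0} = UNIV)"

text \<open>For a foliation \<open>F\<close> on the part of the total space lying over the open set \<open>B\<close>.\<close>

definition transverse_to_fibration :: "generator set \<Rightarrow> complex option set \<Rightarrow> bool" where
  "transverse_to_fibration F B \<longleftrightarrow>
     singular_set F = {} \<and> transverse_at_points F \<and>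
     (\<forall>p. fst p \<in> B \<longrightarrow> covering_map (leaf_top F p) (subtopology sphere_top B) fst)"

definition transverse_off :: "generator set \<Rightarrow> total set \<Rightarrow> bool" where
  "transverse_off F \<Lambda> \<longleftrightarrow>
     analytic_subset \<Lambda> \<and> \<Lambda> \<noteq> UNIV \<and>
     (\<exists>B. \<Lambda> = fst -` (- B) \<and> transverse_to_fibration (restrict_foliation F (- \<Lambda>)) B)"

definition transverse_to_almost_every_fibre :: "generator set \<Rightarrow> bool" where
  "transverse_to_almost_every_fibre F \<longleftrightarrow> (\<exists>\<Lambda>. transverse_off F \<Lambda>)"

definition exceptional_set :: "generator set \<Rightarrow> total set \<Rightarrow> bool" where
  "exceptional_set F \<Lambda> \<longleftrightarrow>
     transverse_off F \<Lambda> \<and> (\<forall>\<Lambda>'. transverse_off F \<Lambda>' \<and> \<Lambda>' \<subseteq> \<Lambda> \<longrightarrow> \<Lambda>' = \<Lambda>)"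

definition riccati_foliation :: "generator set \<Rightarrow> bool" where
  "riccati_foliation F \<longleftrightarrow>
     transverse_to_almost_every_fibre F \<and> (\<exists>\<Lambda>. exceptional_set F \<Lambda> \<and> invariant_set F \<Lambda>)"

end

theory Submission
  imports Defs "HOL-Complex_Analysis.Complex_Analysis"
begin

text \<open>
  Over the complement \<open>B\<close> of the exceptional fibres the base component of \<open>X\<close> has no zero on a fibre, so it
  depends on \<open>x\<close> only. A generator at \<open>[0:1:0]\<close> keeps \<open>s\<^sup>2 Q(x, 1/s, t/s)\<close> and \<open>s R(x, 1/s, t/s) - s t Q(x, 1/s, t/s)\<close>
  bounded as \<open>s\<close> tends to \<open>0\<close>, which gives the degree bound and the relations between the quadratic parts.

  Near an excluded fibre the base component of the generators has no zeros off that fibre, so by the maximum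
  principle it vanishes on the whole fibre or nowhere on it. In the first case the fibre is invariant. In the second
  case the fibre can be added to \<open>B\<close>: a Riccati field is the projection of a linear system, whose fundamental matrix
  trivialises the foliation over a disc and so shows that leaves cover the base. A set \<open>B\<close> with the fewest excluded
  fibres therefore has an invariant exceptional set.
\<close>

text \<open>Being transverse includes that the leaves, in their fine topology, cover the base. So on
  a fibre to be added pointwise transversality is not enough: the covering has to be produced.
  Solutions of a Riccati equation may leave an affine chart, but their homogeneous lifts solve a
  linear equation and exist on one disc for all initial values; this is where the projective fibre
  helps. The remaining global fact, that each leaf over the enlarged base meets every fibre, is
  carried over from the old leaves along the sheets of one disc around the new point.

  The polynomial field says nothing directly about the fibre over infinity or the line at infinity
  of a fibre. Near such points the linear system is recovered from a local generator, and continuity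
  takes identities from the affine part to its closure.

  Counting excluded fibres makes sense because an analytic union of fibres, if not the whole space,
  consists of finitely many: this uses isolated zeros along a transversal disc and compactness of
  the sphere.\<close>

no_notation fps_nth (infixl \<open>$\<close> 75)

section \<open>Standard charts\<close>

text \<open>\<open>True\<close> marks the chart at infinity. Indexing the charts by a flag for the
  base and by the homogeneous coordinate set to 1 lets one formula treat all six charts and all
  transitions between them.\<close>

definition base_chart :: "bool \<Rightarrow> complex \<Rightarrow> complex option" where
  "base_chart b w = (if b then if w = 0 then None else Some (inverse w) else Some w)"

text \<open>The two indices other than \<open>j\<close>, in increasing order. This is the order in
  which the affine fibre coordinates are passed to \<open>homog\<close>.\<close>

definition fst_idx :: "3 \<Rightarrow> 3" where "fst_idx j = (if j = 1 then 2 else 1)"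
definition snd_idx :: "3 \<Rightarrow> 3" where "snd_idx j = (if j = 3 then 2 else 3)"

definition fibre_lift :: "3 \<Rightarrow> complex^3 \<Rightarrow> complex^3" where
  "fibre_lift j v = (\<chi> k. if k = j then 1 else if k = fst_idx j then v$2 else v$3)"

definition std_chart :: "bool \<Rightarrow> 3 \<Rightarrow> chart" where
  "std_chart b j v = (base_chart b (v$1), abs_cp2 (fibre_lift j v))"

text \<open>The inverse of \<open>std_chart\<close>, evaluated on an arbitrary representative
  \<open>L\<close> of the projective point. It is meaningful when \<open>L$j\<close> is
  nonzero.\<close>

definition std_coords :: "complex \<Rightarrow> 3 \<Rightarrow> complex^3 \<Rightarrow> complex^3" where
  "std_coords w j L = vector [w, L$fst_idx j / L$j, L$snd_idx j / L$j]"

text \<open>The coordinate change from chart \<open>b\<close> to chart \<open>c\<close>. At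
  \<open>x = 0\<close> with different charts it returns the default value
  \<open>inverse 0 = 0\<close>, which is why \<open>b = c \<or> x \<noteq> 0\<close> accompanies it
  throughout.\<close>

definition base_trans :: "bool \<Rightarrow> bool \<Rightarrow> complex \<Rightarrow> complex" where
  "base_trans b c x = (if b = c then x else inverse x)"

definition base_dtrans :: "bool \<Rightarrow> bool \<Rightarrow> complex \<Rightarrow> complex" where
  "base_dtrans b c x = (if b = c then 1 else - ((inverse x)\<^sup>2))"

lemma idx_simps [simp]:
  "fst_idx 1 = 2" "fst_idx 2 = 1" "fst_idx 3 = 1" "snd_idx 1 = 3" "snd_idx 2 = 3" "snd_idx 3 = 2"
  by (simp_all add: fst_idx_def snd_idx_def)

lemma idx_neq [simp]: "fst_idx j \<noteq> j" "snd_idx j \<noteq> j" "fst_idx j \<noteq> snd_idx j"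
    "j \<noteq> fst_idx j" "j \<noteq> snd_idx j" "snd_idx j \<noteq> fst_idx j"
  using exhaust_3[of j] by auto

lemma idx_cases: "k = j \<or> k = fst_idx j \<or> k = snd_idx j"
  using exhaust_3[of j] exhaust_3[of k] by auto

lemma fibre_lift_nth [simp]:
  "fibre_lift j v $ j = 1" "fibre_lift j v $ fst_idx j = v$2" "fibre_lift j v $ snd_idx j = v$3"
  by (simp_all add: fibre_lift_def)

lemma std_coords_nth [simp]:
  "std_coords w j L $ 1 = w" "std_coords w j L $ 2 = L$fst_idx j / L$j"
  "std_coords w j L $ 3 = L$snd_idx j / L$j"
  by (simp_all add: std_coords_def)

lemma fibre_lift_nonzero [simp]: "fibre_lift j v \<noteq> 0"
  by (metis fibre_lift_nth(1) zero_index zero_neq_one)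

lemma vec3_eq_iff: "(u::'a^3) = v \<longleftrightarrow> u$1 = v$1 \<and> u$2 = v$2 \<and> u$3 = v$3"
  by (simp add: vec_eq_iff forall_3)

lemma vec3_eq_idx: "(u::'a^3) = v \<longleftrightarrow> u$j = v$j \<and> u$fst_idx j = v$fst_idx j \<and> u$snd_idx j = v$snd_idx j"
  using exhaust_3[of j] by (auto simp: vec3_eq_iff)

lemma fibre_lift_std_coords: "L$j \<noteq> 0 \<Longrightarrow> fibre_lift j (std_coords w j L) = inverse (L$j) *s L"
  by (simp add: vec3_eq_idx[of _ _ j] field_simps)

lemma std_coords_fibre_lift: "c \<noteq> 0 \<Longrightarrow> std_coords (v$1) j (c *s fibre_lift j v) = v"
  by (simp add: vec3_eq_iff)

lemma base_chart_eq_iff: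
  "base_chart b x = base_chart c w \<longleftrightarrow> (b = c \<or> x \<noteq> 0) \<and> w = base_trans b c x"
  by (auto simp: base_chart_def base_trans_def)

lemma base_chart_trans: "b = c \<or> x \<noteq> 0 \<Longrightarrow> base_chart c (base_trans b c x) = base_chart b x"
  by (auto simp: base_chart_def base_trans_def)

lemma base_chart_inj [simp]: "base_chart b x = base_chart b y \<longleftrightarrow> x = y"
  by (auto simp: base_chart_def)

text \<open>Two closed unit discs cover the sphere. The norm bound carries the compactness of the
  sphere into the argument that only finitely many fibres are excluded.\<close>

lemma base_chart_cases: obtains b w where "p = base_chart b w" "norm w \<le> 1"
proof (cases p)
  case None
  then show ?thesis using that[of True 0] by (simp add: base_chart_def)
next
  case (Some x)
  show ?thesis
  proof (cases "norm x \<le> 1")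
    case True
    then show ?thesis using that[of False x] Some by (simp add: base_chart_def)
  next
    case False
    then have "norm (inverse x) \<le> 1" "x \<noteq> 0" by (auto simp: norm_inverse inverse_le_1_iff)
    then show ?thesis using that[of True "inverse x"] Some by (simp add: base_chart_def)
  qed
qed

lemma base_trans_has_derivative:
  "b = c \<or> x \<noteq> 0 \<Longrightarrow> (base_trans b c has_field_derivative base_dtrans b c x) (at x)"
  by (cases "b = c") (auto simp: base_trans_def[abs_def] base_dtrans_def power2_eq_square
      intro!: derivative_eq_intros)

lemma base_dtrans_nonzero: "b = c \<or> x \<noteq> 0 \<Longrightarrow> base_dtrans b c x \<noteq> 0"
  by (auto simp: base_dtrans_def)

lemma sphere_charts_eq: "sphere_charts = range base_chart"
  by (auto simp: sphere_charts_def base_chart_def[abs_def] image_iff fun_eq_iff UNIV_bool)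

lemma vector_eq_fibre_lift:
  "vector [1, v$2, v$3] = fibre_lift 1 v" "vector [v$2, 1, v$3] = fibre_lift 2 v"
  "vector [v$2, v$3, 1] = fibre_lift 3 v"
  by (simp_all add: vec3_eq_iff fibre_lift_def)

lemma total_charts_eq: "total_charts = {std_chart b j | b j. True}"
proof (intro set_eqI iffI)
  fix \<phi> assume "\<phi> \<in> total_charts"
  then obtain b \<tau> where *: "\<phi> = (\<lambda>v. (base_chart b (v$1), \<tau> (v$2) (v$3)))" "\<tau> \<in> cp2_charts"
    unfolding total_charts_def sphere_charts_eq by blast
  then have "\<phi> = std_chart b 1 \<or> \<phi> = std_chart b 2 \<or> \<phi> = std_chart b 3"
    unfolding cp2_charts_def
    by (elim insertE) (simp_all add: fun_eq_iff std_chart_def homog_def vector_eq_fibre_lift)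
  then show "\<phi> \<in> {std_chart b j | b j. True}" by blast
next
  fix \<phi> assume "\<phi> \<in> {std_chart b j | b j. True}"
  then obtain b j where \<phi>: "\<phi> = std_chart b j" by blast
  \<comment> \<open>The entry 0 is a dummy, since \<open>fibre_lift\<close> reads only the other two
    entries.\<close>
  define \<tau> where "\<tau> = (\<lambda>s t. abs_cp2 (fibre_lift j (vector [0, s, t])))"
  have "\<tau> \<in> cp2_charts"
    using exhaust_3[of j]
    by (auto simp: \<tau>_def cp2_charts_def homog_def fun_eq_iff simp flip: vector_eq_fibre_lift)
  moreover have "\<phi> = (\<lambda>v. (base_chart b (v$1), \<tau> (v$2) (v$3)))"
    by (simp add: \<phi> \<tau>_def std_chart_def[abs_def] fibre_lift_def cong: if_cong)
  ultimately show "\<phi> \<in> total_charts"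
    unfolding total_charts_def sphere_charts_eq by blast
qed

lemma affine_chart_eq: "affine_chart = std_chart False 1"
  by (simp add: fun_eq_iff affine_chart_def std_chart_def base_chart_def homog_def vector_eq_fibre_lift)

section \<open>Projective points and chart transitions\<close>

lemma abs_cp2_eq_iff:
  assumes "v \<noteq> 0" "w \<noteq> 0"
  shows "abs_cp2 v = abs_cp2 w \<longleftrightarrow> (\<exists>c. c \<noteq> 0 \<and> w = c *s v)"
proof -
  have "projrel v v" "projrel w w"
    using assms by (auto simp: projrel_def intro!: exI[of _ 1])
  then have "abs_cp2 v = abs_cp2 w \<longleftrightarrow> projrel v w"
    using Quotient3_rel[OF Quotient3_cp2] by metis
  then show ?thesis using assms by (auto simp: projrel_def)
qed

lemma abs_cp2_scale: "v \<noteq> 0 \<Longrightarrow> c \<noteq> 0 \<Longrightarrow> abs_cp2 (c *s v) = abs_cp2 v"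
  using abs_cp2_eq_iff[of v "c *s v"] by auto

lemma cp2_cases: obtains L where "q = abs_cp2 L" "L \<noteq> 0"
  using Quotient3_abs_rep[OF Quotient3_cp2, of q] Quotient3_rep_reflp[OF Quotient3_cp2, of q]
  unfolding projrel_def by metis

lemma std_chart_eq_iff:
  assumes "L \<noteq> 0"
  shows "std_chart c j v = (base_chart c w, abs_cp2 L) \<longleftrightarrow> L$j \<noteq> 0 \<and> v = std_coords w j L"
proof
  assume *: "std_chart c j v = (base_chart c w, abs_cp2 L)"
  then have 1: "v$1 = w" "abs_cp2 (fibre_lift j v) = abs_cp2 L" by (auto simp: std_chart_def)
  then obtain k where k: "k \<noteq> 0" "L = k *s fibre_lift j v"
    using abs_cp2_eq_iff[of "fibre_lift j v" L] assms by auto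
  then show "L$j \<noteq> 0 \<and> v = std_coords w j L" using 1 std_coords_fibre_lift[OF k(1), of v j] by simp
next
  assume *: "L$j \<noteq> 0 \<and> v = std_coords w j L"
  then show "std_chart c j v = (base_chart c w, abs_cp2 L)"
    by (simp add: std_chart_def fibre_lift_std_coords abs_cp2_scale assms)
qed

lemma std_chart_inj [simp]: "std_chart c j v = std_chart c j v' \<longleftrightarrow> v = v'"
  using std_chart_eq_iff[of "fibre_lift j v'" c j v "v'$1"] std_coords_fibre_lift[of 1 v' j]
  by (simp add: std_chart_def)

lemma inv_std_chart: "inv (std_chart c j) (std_chart c j v) = v"
  by (rule inv_f_f) (simp add: inj_def)

lemma std_chart_std_coords:
  "L \<noteq> 0 \<Longrightarrow> L$j \<noteq> 0 \<Longrightarrow> std_chart c j (std_coords w j L) = (base_chart c w, abs_cp2 L)"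
  by (simp add: std_chart_eq_iff)

text \<open>Domain and formula of every chart change are read off together. The base condition keeps
  the point off the fibre missing from chart \<open>c\<close>, the fibre condition off the line
  missing from the affine chart \<open>j\<close>.\<close>

lemma std_chart_transition_iff:
  "std_chart c j v = std_chart b i u \<longleftrightarrow>
     (b = c \<or> u$1 \<noteq> 0) \<and> fibre_lift i u $ j \<noteq> 0 \<and> v = std_coords (base_trans b c (u$1)) j (fibre_lift i u)"
proof (cases "b = c \<or> u$1 \<noteq> 0")
  case True
  then have "std_chart b i u = (base_chart c (base_trans b c (u$1)), abs_cp2 (fibre_lift i u))"
    by (simp add: std_chart_def base_chart_trans)
  then show ?thesis using True by (simp add: std_chart_eq_iff)
next
  case False
  then have "base_chart c (v$1) \<noteq> base_chart b (u$1)"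
    by (auto simp: base_chart_def)
  then show ?thesis using False by (auto simp: std_chart_def)
qed

section \<open>Derivatives of the chart transitions\<close>

lemma eventually_nonzero_nhds:
  fixes f :: "'a::t2_space \<Rightarrow> 'b::real_normed_vector"
  assumes "isCont f u" "f u \<noteq> 0" shows "eventually (\<lambda>v. f v \<noteq> 0) (nhds u)"
  using assms tendsto_imp_eventually_ne[of f "f u" "at u" 0]
  by (auto simp: isCont_def eventually_at_filter elim!: eventually_mono)

text \<open>The linear part of the affine map \<open>fibre_lift j\<close>, hence its derivative; the
  constant entry 1 becomes 0.\<close>

definition dlift :: "3 \<Rightarrow> complex^3 \<Rightarrow> complex^3" where
  "dlift j v = (\<chi> k. if k = j then 0 else if k = fst_idx j then v$2 else v$3)"

lemma dlift_nth [simp]: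
  "dlift j v $ j = 0" "dlift j v $ fst_idx j = v$2" "dlift j v $ snd_idx j = v$3"
  by (simp_all add: dlift_def)

lemma fibre_lift_nth_has_derivative:
  "((\<lambda>v. fibre_lift i v $ k) has_derivative (\<lambda>h. dlift i h $ k)) (at u)"
  using idx_cases[of k i]
  by (auto simp: fibre_lift_def dlift_def intro: bounded_linear_vec_nth[THEN bounded_linear_imp_has_derivative])

lemma has_derivative_vec_nth_iff:
  fixes f :: "'a::real_normed_vector \<Rightarrow> complex^'n"
  shows "(f has_derivative T) (at u) \<longleftrightarrow> (\<forall>k. ((\<lambda>v. f v $ k) has_derivative (\<lambda>h. T h $ k)) (at u))"
proof
  assume "(f has_derivative T) (at u)"
  then show "\<forall>k. ((\<lambda>v. f v $ k) has_derivative (\<lambda>h. T h $ k)) (at u)"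
    using bounded_linear.has_derivative[OF bounded_linear_vec_nth] by auto
next
  assume *: "\<forall>k. ((\<lambda>v. f v $ k) has_derivative (\<lambda>h. T h $ k)) (at u)"
  show "(f has_derivative T) (at u)"
    unfolding has_derivative_componentwise_within[of f] Basis_vec_def
  proof safe
    fix k :: 'n and e :: complex assume "e \<in> Basis"
    have "((\<lambda>v. f v $ k) has_derivative (\<lambda>h. T h $ k)) (at u)" using * by simp
    from has_derivative_inner_left[OF this, of e]
    show "((\<lambda>x. f x \<bullet> axis k e) has_derivative (\<lambda>x. T x \<bullet> axis k e)) (at u)"
      by (simp add: inner_axis)
  qed
qed

text \<open>The quotient rule for ratios of homogeneous coordinates; this derivative is the one that
  \<open>compatible\<close> refers to. The first entry involves \<open>h$1\<close> alone because
  transitions preserve the fibration.\<close>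

lemma std_transition_has_derivative:
  assumes "b = c \<or> u$1 \<noteq> 0" "fibre_lift i u $ j \<noteq> 0"
  defines "T \<equiv> \<lambda>h. vector [base_dtrans b c (u$1) * h$1,
     (dlift i h $ fst_idx j * fibre_lift i u $ j - fibre_lift i u $ fst_idx j * dlift i h $ j) / (fibre_lift i u $ j)^2,
     (dlift i h $ snd_idx j * fibre_lift i u $ j - fibre_lift i u $ snd_idx j * dlift i h $ j) / (fibre_lift i u $ j)^2] :: complex^3"
  shows "(inv (std_chart c j) \<circ> std_chart b i has_derivative T) (at u)"
proof -
  let ?S = "\<lambda>v. std_coords (base_trans b c (v$1)) j (fibre_lift i v)"
  have 1: "((\<lambda>v. base_trans b c (v$1)) has_derivative (\<lambda>h. T h $ 1)) (at u)"
    using has_derivative_compose[OF bounded_linear.has_derivative[OF bounded_linear_vec_nth has_derivative_ident]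
      base_trans_has_derivative[OF assms(1), unfolded has_field_derivative_def]]
    by (simp add: T_def)
  have q: "((\<lambda>v. fibre_lift i v $ k / fibre_lift i v $ j) has_derivative
     (\<lambda>h. (dlift i h $ k * fibre_lift i u $ j - fibre_lift i u $ k * dlift i h $ j) / (fibre_lift i u $ j)^2)) (at u)" for k
    using has_derivative_divide'[OF fibre_lift_nth_has_derivative[of i k u] fibre_lift_nth_has_derivative[of i j u] assms(2)]
    by (simp add: power2_eq_square)
  have 3: "(?S has_derivative T) (at u)"
    unfolding has_derivative_vec_nth_iff
  proof
    fix k
    show "((\<lambda>v. ?S v $ k) has_derivative (\<lambda>h. T h $ k)) (at u)"
      using exhaust_3[of k] 1 q[of "fst_idx j"] q[of "snd_idx j"] by (auto simp: T_def)
  qed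
  \<comment> \<open>\<open>inv\<close> is specified only on the range of the chart, so the explicit
    quotients are compared with it on a neighbourhood where the transition is defined.\<close>
  have "eventually (\<lambda>v. ?S v = (inv (std_chart c j) \<circ> std_chart b i) v) (nhds u)"
  proof -
    have "eventually (\<lambda>v. b = c \<or> v$1 \<noteq> 0) (nhds u)"
      using assms(1) eventually_nonzero_nhds[where f = "\<lambda>v. v$1" and u = u] by (auto elim: eventually_mono)
    moreover have "eventually (\<lambda>v. fibre_lift i v $ j \<noteq> 0) (nhds u)"
      using fibre_lift_nth_has_derivative has_derivative_continuous assms(2)
      by (intro eventually_nonzero_nhds) blast+
    ultimately show ?thesis
    proof eventually_elim
      case (elim v)
      then have "std_chart c j (?S v) = std_chart b i v"
        by (simp add: std_chart_transition_iff)
      then show ?case by (metis inv_std_chart comp_apply)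
    qed
  qed
  then obtain V where "open V" "u \<in> V" "\<And>v. v \<in> V \<Longrightarrow> ?S v = (inv (std_chart c j) \<circ> std_chart b i) v"
    unfolding eventually_nhds by blast
  then show ?thesis
    using 3 has_derivative_transform_within_open[of ?S T u UNIV V] by blast
qed

section \<open>Linear systems on a disc\<close>

text \<open>Picard iteration written as a series: the first term is the constant \<open>v\<close>,
  and each further term is the primitive, vanishing at \<open>w0\<close>, of \<open>M\<close> times
  the preceding one. The condition \<open>small\<close> makes each step halve the bound, so the
  differentiated series converges uniformly on the disc.\<close>

lemma linear_ode_solution:
  fixes M :: "complex \<Rightarrow> complex^'n^'n" and v :: "complex^'n" and r K :: real
  assumes hol: "\<And>i j. (\<lambda>w. M w $ i $ j) holomorphic_on ball w0 r" and r: "0 < r"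
    and bd: "\<And>w i j. w \<in> ball w0 r \<Longrightarrow> norm (M w $ i $ j) \<le> K"
    and small: "r * (CARD('n) * K) \<le> 1/2"
  obtains u where "u w0 = v"
    "\<And>w i. w \<in> ball w0 r \<Longrightarrow> ((\<lambda>w. u w $ i) has_field_derivative (M w *v u w) $ i) (at w)"
proof -
  let ?B = "ball w0 r"
  define C where "C = norm v"
  define P where "P k f \<longleftrightarrow> (k = 0 \<longrightarrow> f = (\<lambda>_. v)) \<and> (\<forall>i. (\<lambda>w. f w $ i) holomorphic_on ?B) \<and>
      (\<forall>w\<in>?B. \<forall>i. norm (f w $ i) \<le> C * (1/2)^k)" for k :: nat and f :: "complex \<Rightarrow> complex^'n"
  define Q where "Q f g \<longleftrightarrow> g w0 = 0 \<and> (\<forall>w\<in>?B. \<forall>i. ((\<lambda>w. g w $ i) has_field_derivative (M w *v f w) $ i) (at w))"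
    for f g :: "complex \<Rightarrow> complex^'n"
  have w0: "w0 \<in> ?B" using r by simp
  have "K \<ge> 0" using order_trans[OF norm_ge_zero bd[OF w0]] .
  have Mbd: "norm ((M w *v f w) $ i) \<le> CARD('n) * K * D"
    if "w \<in> ?B" "\<And>j. norm (f w $ j) \<le> D" for w i D and f :: "complex \<Rightarrow> complex^'n"
  proof -
    have "norm ((M w *v f w) $ i) \<le> (\<Sum>j\<in>(UNIV::'n set). K * D)"
      unfolding matrix_vector_mult_def vec_lambda_beta
    proof (rule sum_norm_le)
      fix j show "norm (M w $ i $ j * f w $ j) \<le> K * D"
        unfolding norm_mult using that bd[OF that(1)] \<open>K \<ge> 0\<close> by (intro mult_mono) auto
    qed
    then show ?thesis by simp
  qed
  have "\<exists>f. \<forall>k. P k (f k) \<and> Q (f k) (f (Suc k))"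
  proof (rule dependent_nat_choice)
    have "norm (v $ i) \<le> C" for i unfolding C_def by (rule Finite_Cartesian_Product.norm_nth_le)
    then show "\<exists>f. P 0 f" by (auto simp: P_def)
  next
    fix f k assume f: "P k f"
    have holMf: "(\<lambda>w. (M w *v f w) $ i) holomorphic_on ?B" for i
      using f hol by (auto simp: P_def matrix_vector_mult_def intro!: holomorphic_intros)
    have "\<exists>g. \<forall>w\<in>?B. (g has_field_derivative (M w *v f w) $ i) (at w within ?B)" for i
      by (rule holomorphic_convex_primitive'[OF convex_ball open_ball holMf[of i]]) blast
    then obtain G where G: "\<And>i w. w \<in> ?B \<Longrightarrow> (G i has_field_derivative (M w *v f w) $ i) (at w within ?B)"
      by metis
    define g :: "complex \<Rightarrow> complex^'n" where "g w = (\<chi> i. G i w - G i w0)" for w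
    have Gd: "(G i has_field_derivative (M w *v f w) $ i) (at w)" if "w \<in> ?B" for i w
      using G[OF that] at_within_open[OF that] by simp
    have gd: "((\<lambda>w. g w $ i) has_field_derivative (M w *v f w) $ i) (at w)" if "w \<in> ?B" for i w
      using Gd[OF that] by (auto simp: g_def intro!: derivative_eq_intros)
    moreover have "norm (g w $ i) \<le> C * (1/2)^Suc k" if "w \<in> ?B" for w i
    proof -
      have "norm (G i w - G i w0) \<le> CARD('n) * K * (C * (1/2)^k) * norm (w - w0)"
        using f w0 that by (intro field_differentiable_bound[OF convex_ball G] Mbd) (auto simp: P_def)
      also have "\<dots> \<le> CARD('n) * K * (C * (1/2)^k) * r"
        using that \<open>K \<ge> 0\<close> by (intro mult_left_mono) (auto simp: dist_norm norm_minus_commute C_def)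
      also have "\<dots> = (r * (CARD('n) * K)) * (C * (1/2)^k)" by simp
      also have "\<dots> \<le> 1/2 * (C * (1/2)^k)"
        using small by (intro mult_right_mono) (auto simp: C_def)
      finally show ?thesis by (simp add: g_def)
    qed
    moreover have "(\<lambda>w. g w $ i) holomorphic_on ?B" for i
      unfolding holomorphic_on_open[OF open_ball] using gd by blast
    ultimately have "P (Suc k) g \<and> Q f g"
      by (auto simp: P_def Q_def g_def vec_eq_iff)
    then show "\<exists>g. P (Suc k) g \<and> Q f g" by blast
  qed
  then obtain f where f: "\<And>k. P k (f k)" "\<And>k. Q (f k) (f (Suc k))" by blast
  \<comment> \<open>The derivative of each term is \<open>M\<close> times the preceding term; the
    term of index 0 is constant.\<close>
  define f' where "f' k w i = (case k of 0 \<Rightarrow> 0 | Suc k \<Rightarrow> (M w *v f k w) $ i)" for k w i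
  have fd: "((\<lambda>w. f k w $ i) has_field_derivative f' k w i) (at w within ?B)" if "w \<in> ?B" for k w i
  proof (cases k)
    case 0
    then show ?thesis using f(1)[of 0] by (simp add: P_def f'_def)
  next
    case (Suc l)
    then show ?thesis using f(2)[of l] that
      by (auto simp: Q_def f'_def intro: has_field_derivative_at_within)
  qed
  have fb: "norm (f k w $ i) \<le> C * (1/2)^k" if "w \<in> ?B" for k w i
    using f(1)[of k] that by (auto simp: P_def)
  have summ: "summable (\<lambda>k. f k w $ i)" if "w \<in> ?B" for w i
    by (rule summable_comparison_test'[of "\<lambda>k. C * (1/2)^k" 0])
       (use fb that in \<open>auto intro!: summable_mult summable_geometric\<close>)
  \<comment> \<open>The shift by one index costs a factor 2, which appears as
    \<open>C * 2\<close>.\<close>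
  have f'b: "norm (f' k w i) \<le> CARD('n) * K * (C * 2) * (1/2)^k" if "w \<in> ?B" for k w i
  proof (cases k)
    case 0
    then show ?thesis using \<open>K \<ge> 0\<close> by (simp add: f'_def C_def)
  next
    case (Suc l)
    then show ?thesis using Mbd[of w "f l" "C * (1/2)^l" i] fb[OF that] that by (simp add: f'_def)
  qed
  have uc: "uniformly_convergent_on ?B (\<lambda>n w. \<Sum>k<n. f' k w i)" for i
    by (rule Weierstrass_m_test'[OF f'b]) (auto intro!: summable_mult summable_geometric)
  define u :: "complex \<Rightarrow> complex^'n" where "u w = (\<chi> i. \<Sum>k. f k w $ i)" for w
  have "((\<lambda>w. u w $ i) has_field_derivative (M w *v u w) $ i) (at w)" if w: "w \<in> ?B" for w i
  proof -
    have 1: "((\<lambda>w. \<Sum>k. f k w $ i) has_field_derivative (\<Sum>k. f' k w i)) (at w)"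
      using has_field_derivative_series'(2)[OF convex_ball fd uc w0 summ[OF w0]] w by auto
    have "(\<lambda>k. f' (Suc k) w i) sums ((M w *v u w) $ i)"
      unfolding f'_def matrix_vector_mult_def u_def
      by (simp, intro sums_sum sums_mult summable_sums summ w)
    then have "(\<lambda>k. f' k w i) sums ((M w *v u w) $ i)"
      by (subst (asm) sums_Suc_iff) (simp add: f'_def)
    then have "(\<Sum>k. f' k w i) = (M w *v u w) $ i" by (simp add: sums_iff)
    moreover have "(\<lambda>w. u w $ i) = (\<lambda>w. \<Sum>k. f k w $ i)" by (simp add: u_def)
    ultimately show ?thesis using 1 by simp
  qed
  moreover have "u w0 = v"
  proof -
    have "(\<lambda>k. f k w0 $ i) sums (f 0 w0 $ i)" for i
      using f(2) by (intro sums_single[of 0 "\<lambda>k. f k w0 $ i", THEN sums_cong[THEN iffD1, rotated]])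
        (auto simp: Q_def split: nat.splits dest!: gr0_implies_Suc)
    then show ?thesis using f(1)[of 0] by (simp add: u_def vec_eq_iff P_def sums_iff)
  qed
  ultimately show ?thesis using that by blast
qed

text \<open>\<open>\<Psi>\<close> solves the adjoint equation, so \<open>\<Psi> ** \<Phi>\<close>
  has derivative zero and keeps its value \<open>mat 1\<close> from \<open>w0\<close>. This gives a
  holomorphic inverse without determinants.\<close>

lemma fundamental_matrix:
  fixes M :: "complex \<Rightarrow> complex^'n^'n"
  assumes hol: "\<And>i j. (\<lambda>w. M w $ i $ j) holomorphic_on ball w0 R" and "0 < R"
  obtains r and \<Phi> \<Psi> :: "complex \<Rightarrow> complex^'n^'n" where "0 < r" "r \<le> R"
    "\<And>w i j. w \<in> ball w0 r \<Longrightarrow> ((\<lambda>w. \<Phi> w $ i $ j) has_field_derivative (M w ** \<Phi> w) $ i $ j) (at w)"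
    "\<And>w i j. w \<in> ball w0 r \<Longrightarrow> ((\<lambda>w. \<Psi> w $ i $ j) has_field_derivative - (\<Psi> w ** M w) $ i $ j) (at w)"
    "\<And>w. w \<in> ball w0 r \<Longrightarrow> \<Psi> w ** \<Phi> w = mat 1" "\<And>w. w \<in> ball w0 r \<Longrightarrow> \<Phi> w ** \<Psi> w = mat 1"
proof -
  have "\<exists>K. \<forall>w\<in>cball w0 (R/2). norm (M w $ i $ j) \<le> K" for i j
  proof -
    have "continuous_on (cball w0 (R/2)) (\<lambda>w. M w $ i $ j)"
      by (rule holomorphic_on_imp_continuous_on[OF holomorphic_on_subset[OF hol]]) (use \<open>0 < R\<close> in auto)
    then have "bounded ((\<lambda>w. M w $ i $ j) ` cball w0 (R/2))"
      by (intro compact_imp_bounded compact_continuous_image) auto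
    then show ?thesis by (auto simp: bounded_iff)
  qed
  then obtain K where K: "\<And>i j w. w \<in> cball w0 (R/2) \<Longrightarrow> norm (M w $ i $ j) \<le> K i j" by metis
  \<comment> \<open>One bound for all entries; the summand 1 makes it positive, so that the radius
    can be chosen by dividing by it.\<close>
  define L where "L = (\<Sum>i\<in>UNIV. \<Sum>j\<in>UNIV. \<bar>K i j\<bar>) + 1"
  have L: "K i j \<le> L" for i j
  proof -
    have "K i j \<le> \<bar>K i j\<bar>" by simp
    also have "\<dots> \<le> (\<Sum>j\<in>UNIV. \<bar>K i j\<bar>)" by (rule member_le_sum) auto
    also have "\<dots> \<le> (\<Sum>i\<in>UNIV. \<Sum>j\<in>UNIV. \<bar>K i j\<bar>)"
      by (rule member_le_sum[of i UNIV "\<lambda>i. \<Sum>j\<in>UNIV. \<bar>K i j\<bar>"]) (auto intro: sum_nonneg)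
    finally show ?thesis by (simp add: L_def)
  qed
  have "L > 0" unfolding L_def by (intro add_nonneg_pos sum_nonneg) auto
  define r where "r = min (R/2) (1 / (2 * (CARD('n) * L)))"
  have r: "0 < r" "r \<le> R/2" using \<open>L > 0\<close> \<open>0 < R\<close> by (auto simp: r_def)
  have "r * (CARD('n) * L) \<le> (1 / (2 * (CARD('n) * L))) * (CARD('n) * L)"
    using \<open>L > 0\<close> by (intro mult_right_mono) (auto simp: r_def)
  then have small: "r * (CARD('n) * L) \<le> 1/2" using \<open>L > 0\<close> by simp
  have sub: "ball w0 r \<subseteq> cball w0 (R/2)" "ball w0 r \<subseteq> ball w0 R" using r \<open>0 < R\<close> by auto
  have bd: "norm (M w $ i $ j) \<le> L" if "w \<in> ball w0 r" for w i j
    using K[of w i j] L[of i j] sub that by force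
  have hol': "(\<lambda>w. M w $ i $ j) holomorphic_on ball w0 r" for i j
    using hol holomorphic_on_subset sub by blast
  have "\<exists>u. u w0 = v \<and> (\<forall>w\<in>ball w0 r. \<forall>i. ((\<lambda>w. u w $ i) has_field_derivative (M w *v u w) $ i) (at w))" for v
    by (rule linear_ode_solution[OF hol' r(1) bd small, of v]) auto
  then obtain u where u: "\<And>v. u v w0 = v"
    "\<And>v w i. w \<in> ball w0 r \<Longrightarrow> ((\<lambda>w. u v w $ i) has_field_derivative (M w *v u v w) $ i) (at w)"
    by metis
  \<comment> \<open>The negative transpose: the rows of \<open>\<Psi>\<close>, written as columns,
    solve this system.\<close>
  let ?M = "\<lambda>w. (\<chi> i j. - M w $ j $ i) :: complex^'n^'n"
  have "\<exists>u. u w0 = v \<and> (\<forall>w\<in>ball w0 r. \<forall>i. ((\<lambda>w. u w $ i) has_field_derivative (?M w *v u w) $ i) (at w))" for v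
    by (rule linear_ode_solution[of ?M w0 r L v]) (use hol' r(1) bd small in \<open>auto intro!: holomorphic_intros\<close>)
  then obtain u' where u': "\<And>v. u' v w0 = v"
    "\<And>v w i. w \<in> ball w0 r \<Longrightarrow> ((\<lambda>w. u' v w $ i) has_field_derivative (?M w *v u' v w) $ i) (at w)"
    by metis
  define \<Phi> :: "complex \<Rightarrow> complex^'n^'n" where "\<Phi> w = (\<chi> i j. u (axis j 1) w $ i)" for w
  define \<Psi> :: "complex \<Rightarrow> complex^'n^'n" where "\<Psi> w = (\<chi> i j. u' (axis i 1) w $ j)" for w
  have 1: "((\<lambda>w. \<Phi> w $ i $ j) has_field_derivative (M w ** \<Phi> w) $ i $ j) (at w)" if "w \<in> ball w0 r" for w i j
    using u(2)[OF that, of "axis j 1" i] by (simp add: \<Phi>_def matrix_matrix_mult_def matrix_vector_mult_def)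
  have 2: "((\<lambda>w. \<Psi> w $ i $ j) has_field_derivative - (\<Psi> w ** M w) $ i $ j) (at w)" if "w \<in> ball w0 r" for w i j
    using u'(2)[OF that, of "axis i 1" j]
    by (simp add: \<Psi>_def matrix_matrix_mult_def matrix_vector_mult_def sum_negf mult.commute)
  have 3: "\<Psi> w ** \<Phi> w = mat 1" if w: "w \<in> ball w0 r" for w
  proof -
    have "(\<Psi> w ** \<Phi> w) $ i $ j = mat 1 $ i $ j" for i j
    proof -
      have "((\<lambda>w. (\<Psi> w ** \<Phi> w) $ i $ j) has_field_derivative 0) (at w within ball w0 r)"
        if "w \<in> ball w0 r" for w
      proof -
        have "((\<lambda>w. \<Sum>k\<in>UNIV. \<Psi> w $ i $ k * \<Phi> w $ k $ j) has_field_derivative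
           (\<Sum>k\<in>UNIV. \<Psi> w $ i $ k * (M w ** \<Phi> w) $ k $ j + - (\<Psi> w ** M w) $ i $ k * \<Phi> w $ k $ j)) (at w)"
          by (intro DERIV_sum DERIV_mult' 1 2 that)
        moreover have "(\<Sum>k\<in>UNIV. \<Psi> w $ i $ k * (M w ** \<Phi> w) $ k $ j + - (\<Psi> w ** M w) $ i $ k * \<Phi> w $ k $ j) =
           (\<Psi> w ** (M w ** \<Phi> w)) $ i $ j - ((\<Psi> w ** M w) ** \<Phi> w) $ i $ j"
          by (simp add: matrix_matrix_mult_def[of "\<Psi> w" "M w ** \<Phi> w"]
            matrix_matrix_mult_def[of "\<Psi> w ** M w"] sum_subtractf)
        ultimately have "((\<lambda>w. (\<Psi> w ** \<Phi> w) $ i $ j) has_field_derivative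
           (\<Psi> w ** (M w ** \<Phi> w)) $ i $ j - ((\<Psi> w ** M w) ** \<Phi> w) $ i $ j) (at w)"
          by (simp add: matrix_matrix_mult_def[of "\<Psi> _" "\<Phi> _"])
        then show ?thesis by (simp add: matrix_mul_assoc has_field_derivative_at_within)
      qed
      then obtain c where c: "\<And>w. w \<in> ball w0 r \<Longrightarrow> (\<Psi> w ** \<Phi> w) $ i $ j = c"
        using has_field_derivative_zero_constant[OF convex_ball, of w0 r "\<lambda>w. (\<Psi> w ** \<Phi> w) $ i $ j"] by blast
      have "\<Phi> w0 = mat 1" "\<Psi> w0 = mat 1"
        by (auto simp: \<Phi>_def \<Psi>_def u(1) u'(1) mat_def axis_def vec_eq_iff)
      then show ?thesis using c[OF w] c[of w0] r(1) by simp
    qed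
    then show ?thesis by (simp add: vec_eq_iff)
  qed
  have "\<Phi> w ** \<Psi> w = mat 1" if "w \<in> ball w0 r" for w
    using 3[OF that] matrix_left_right_inverse by blast
  moreover have "r \<le> R" using r \<open>0 < R\<close> by auto
  ultimately show ?thesis by (intro that[of r \<Phi> \<Psi>] r(1) 1 2 3)
qed

section \<open>Coverings from local sheets\<close>

text \<open>The leaf for an arbitrary family of arcs. Separating it from vector fields makes the
  covering argument purely topological.\<close>

definition arc_leaf :: "'a set set \<Rightarrow> 'a \<Rightarrow> 'a set" where
  "arc_leaf A p = {q. (\<lambda>a b. \<exists>P\<in>A. a \<in> P \<and> b \<in> P)\<^sup>*\<^sup>* p q}"

lemma arc_leaf_refl: "p \<in> arc_leaf A p"
  by (simp add: arc_leaf_def)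

lemma arc_leaf_step: "a \<in> arc_leaf A p \<Longrightarrow> P \<in> A \<Longrightarrow> a \<in> P \<Longrightarrow> b \<in> P \<Longrightarrow> b \<in> arc_leaf A p"
  unfolding arc_leaf_def by (auto intro: rtranclp.rtrancl_into_rtrancl)

lemma arc_leaf_subset:
  assumes "p \<in> Z" "\<And>P a b. P \<in> A \<Longrightarrow> a \<in> P \<Longrightarrow> b \<in> P \<Longrightarrow> a \<in> Z \<Longrightarrow> b \<in> Z"
  shows "arc_leaf A p \<subseteq> Z"
proof
  fix q assume "q \<in> arc_leaf A p"
  then have "(\<lambda>a b. \<exists>P\<in>A. a \<in> P \<and> b \<in> P)\<^sup>*\<^sup>* p q" by (simp add: arc_leaf_def)
  then show "q \<in> Z" by (induction rule: rtranclp_induct) (use assms in blast)+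
qed

lemma arc_leaf_trans: "q \<in> arc_leaf A p \<Longrightarrow> arc_leaf A q \<subseteq> arc_leaf A p"
  by (rule arc_leaf_subset) (auto intro: arc_leaf_step)

lemma arc_leaf_mono: "A \<subseteq> A' \<Longrightarrow> arc_leaf A p \<subseteq> arc_leaf A' p"
  by (rule arc_leaf_subset) (auto intro: arc_leaf_step arc_leaf_refl)

text \<open>A set of local sections over a connected open set, as in a product neighbourhood of a
  foliation. The last two clauses compare sections with arcs in both directions: the first makes the
  image of a section open in the topology generated by the arcs, the second makes the section
  continuous into it.\<close>

definition flow_box :: "'a set set \<Rightarrow> 'b topology \<Rightarrow> ('a \<Rightarrow> 'b) \<Rightarrow> 'b set \<Rightarrow> ('b \<Rightarrow> 'a) set \<Rightarrow> bool" where
  "flow_box A X f V S \<longleftrightarrow> openin X V \<and> connectedin X V \<and>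
     (\<forall>s\<in>S. \<forall>x\<in>V. f (s x) = x) \<and>
     (\<forall>q. f q \<in> V \<longrightarrow> (\<exists>s\<in>S. s (f q) = q)) \<and>
     (\<forall>s\<in>S. \<forall>s'\<in>S. \<forall>x\<in>V. s x = s' x \<longrightarrow> (\<forall>y\<in>V. s y = s' y)) \<and>
     (\<forall>s\<in>S. \<forall>x\<in>V. \<forall>W. openin X W \<and> x \<in> W \<and> W \<subseteq> V \<longrightarrow> (\<exists>P\<in>A. s x \<in> P \<and> P \<subseteq> s ` W)) \<and>
     (\<forall>s\<in>S. \<forall>x\<in>V. \<forall>P\<in>A. s x \<in> P \<longrightarrow> (\<exists>W. openin X W \<and> x \<in> W \<and> W \<subseteq> V \<and> s ` W \<subseteq> P))"

lemma flow_boxD: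
  assumes "flow_box A X f V S"
  shows "openin X V" "connectedin X V" "\<And>s x. s \<in> S \<Longrightarrow> x \<in> V \<Longrightarrow> f (s x) = x"
    "\<And>q. f q \<in> V \<Longrightarrow> \<exists>s\<in>S. s (f q) = q"
    "\<And>s s' x y. s \<in> S \<Longrightarrow> s' \<in> S \<Longrightarrow> x \<in> V \<Longrightarrow> s x = s' x \<Longrightarrow> y \<in> V \<Longrightarrow> s y = s' y"
    "\<And>s x W. s \<in> S \<Longrightarrow> openin X W \<Longrightarrow> x \<in> W \<Longrightarrow> W \<subseteq> V \<Longrightarrow> \<exists>P\<in>A. s x \<in> P \<and> P \<subseteq> s ` W"
    "\<And>s x P. s \<in> S \<Longrightarrow> x \<in> V \<Longrightarrow> P \<in> A \<Longrightarrow> s x \<in> P \<Longrightarrow> \<exists>W. openin X W \<and> x \<in> W \<and> W \<subseteq> V \<and> s ` W \<subseteq> P"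
proof -
  note c1 = assms[unfolded flow_box_def]
  note c2 = conjunct2[OF c1] note c3 = conjunct2[OF c2] note c4 = conjunct2[OF c3]
  note c5 = conjunct2[OF c4] note c6 = conjunct2[OF c5] note c7 = conjunct2[OF c6]
  show "openin X V" by (rule conjunct1[OF c1])
  show "connectedin X V" by (rule conjunct1[OF c2])
  show "\<And>s x. s \<in> S \<Longrightarrow> x \<in> V \<Longrightarrow> f (s x) = x" using conjunct1[OF c3] by blast
  show "\<And>q. f q \<in> V \<Longrightarrow> \<exists>s\<in>S. s (f q) = q" using conjunct1[OF c4] by blast
  show "\<And>s s' x y. s \<in> S \<Longrightarrow> s' \<in> S \<Longrightarrow> x \<in> V \<Longrightarrow> s x = s' x \<Longrightarrow> y \<in> V \<Longrightarrow> s y = s' y"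
    using conjunct1[OF c5] by blast
  show "\<And>s x W. s \<in> S \<Longrightarrow> openin X W \<Longrightarrow> x \<in> W \<Longrightarrow> W \<subseteq> V \<Longrightarrow> \<exists>P\<in>A. s x \<in> P \<and> P \<subseteq> s ` W"
    using conjunct1[OF c6] by blast
  show "\<And>s x P. s \<in> S \<Longrightarrow> x \<in> V \<Longrightarrow> P \<in> A \<Longrightarrow> s x \<in> P \<Longrightarrow> \<exists>W. openin X W \<and> x \<in> W \<and> W \<subseteq> V \<and> s ` W \<subseteq> P"
    using c7 by blast
qed

lemma flow_box_sheet_open:
  assumes "flow_box A X f V S" "s \<in> S" "openin X W" "W \<subseteq> V"
  shows "openin (topology_generated_by A) (s ` W)"
proof (subst openin_subopen, safe)
  fix x assume "x \<in> W"
  then obtain P where "P \<in> A" "s x \<in> P" "P \<subseteq> s ` W" using flow_boxD(6)[OF assms(1-3)] assms(4) by blast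
  then show "\<exists>T. openin (topology_generated_by A) T \<and> s x \<in> T \<and> T \<subseteq> s ` W"
    using topology_generated_by_Basis by blast
qed

text \<open>For the generated topology the arcs are a subbasis. A pointwise claim passes through
  finite intersections and unions, which leaves only single arcs, where the last clause of
  \<open>flow_box\<close> applies.\<close>

lemma flow_box_sheet_continuous:
  assumes fb: "flow_box A X f V S" and s: "s \<in> S" and "openin (topology_generated_by A) Q"
  shows "openin X {x \<in> V. s x \<in> Q}"
proof -
  have "generate_topology_on A Q" using assms(3) by (simp add: openin_topology_generated_by_iff)
  then have *: "\<exists>W. openin X W \<and> x \<in> W \<and> W \<subseteq> V \<and> s ` W \<subseteq> Q" if "x \<in> V" "s x \<in> Q" for x
    using that
  proof (induction rule: generate_topology_on.induct)
    case (Int a b)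
    from Int.prems have "s x \<in> a" "s x \<in> b" by auto
    from Int.IH(1)[OF Int.prems(1) this(1)] Int.IH(2)[OF Int.prems(1) this(2)]
    obtain W W' where "openin X W" "x \<in> W" "W \<subseteq> V" "s ` W \<subseteq> a" "openin X W'" "x \<in> W'" "s ` W' \<subseteq> b"
      by auto
    then show ?case by (intro exI[of _ "W \<inter> W'"]) auto
  next
    case (UN K)
    then obtain k where "k \<in> K" "s x \<in> k" by auto
    with UN.IH[of k] UN.prems obtain W where "openin X W" "x \<in> W" "W \<subseteq> V" "s ` W \<subseteq> k" by auto
    with \<open>k \<in> K\<close> show ?case by (intro exI[of _ W]) auto
  next
    case (Basis P)
    show ?case by (rule flow_boxD(7)[OF fb s Basis.prems(1) Basis.hyps Basis.prems(2)])
  qed simp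
  show ?thesis
  proof (subst openin_subopen, safe)
    fix x assume "x \<in> V" "s x \<in> Q"
    then obtain W where "openin X W" "x \<in> W" "W \<subseteq> V" "s ` W \<subseteq> Q" using *[of x] by auto
    then show "\<exists>W. openin X W \<and> x \<in> W \<and> W \<subseteq> {x \<in> V. s x \<in> Q}" by (intro exI[of _ W]) auto
  qed
qed

text \<open>An arc lies inside the leaf or misses it. So whether \<open>s y\<close> belongs to the
  leaf is locally constant in \<open>y\<close>, and the base of a flow box is connected.\<close>

lemma flow_box_sheet_subset_leaf:
  assumes fb: "flow_box A X f V S" and s: "s \<in> S" and x: "x \<in> V" "s x \<in> arc_leaf A p"
  shows "s ` V \<subseteq> arc_leaf A p"
proof -
  let ?L = "arc_leaf A p"
  have "\<exists>W. openin X W \<and> y \<in> W \<and> W \<subseteq> V \<and> (s ` W \<subseteq> ?L \<or> s ` W \<inter> ?L = {})" if yV: "y \<in> V" for y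
  proof -
    obtain P where P: "P \<in> A" "s y \<in> P"
      using flow_boxD(6)[OF fb s flow_boxD(1)[OF fb] yV] by auto
    have "P \<subseteq> ?L \<or> P \<inter> ?L = {}" using P(1) by (auto intro: arc_leaf_step)
    moreover obtain W where "openin X W" "y \<in> W" "W \<subseteq> V" "s ` W \<subseteq> P"
      using flow_boxD(7)[OF fb s yV P] by auto
    ultimately show ?thesis by (intro exI[of _ W]) auto
  qed
  note * = this
  have 1: "openin X {y\<in>V. s y \<in> ?L}"
  proof (subst openin_subopen, safe)
    fix y assume "y \<in> V" "s y \<in> ?L"
    then obtain W where "openin X W" "y \<in> W" "W \<subseteq> V" "s ` W \<subseteq> ?L" using *[of y] by auto
    then show "\<exists>W. openin X W \<and> y \<in> W \<and> W \<subseteq> {y\<in>V. s y \<in> ?L}" by (intro exI[of _ W]) auto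
  qed
  have 2: "openin X {y\<in>V. s y \<notin> ?L}"
  proof (subst openin_subopen, safe)
    fix y assume "y \<in> V" "s y \<notin> ?L"
    then obtain W where "openin X W" "y \<in> W" "W \<subseteq> V" "s ` W \<inter> ?L = {}" using *[of y] by auto
    then show "\<exists>W. openin X W \<and> y \<in> W \<and> W \<subseteq> {y\<in>V. s y \<notin> ?L}" by (intro exI[of _ W]) auto
  qed
  have "{y\<in>V. s y \<notin> ?L} = {}"
  proof (rule ccontr)
    assume "{y\<in>V. s y \<notin> ?L} \<noteq> {}"
    then show False
      using x by (intro connectedinD[OF flow_boxD(2)[OF fb] 1 2]) auto
  qed
  then show ?thesis by auto
qed

text \<open>The base of a flow box is evenly covered: the sheets of a leaf over it are those sheets
  of the flow box that lie in the leaf. Surjectivity is a global matter and enters as the assumption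
  \<open>surj\<close>.\<close>

lemma covering_map_of_flow_boxes:
  fixes A :: "'a set set" and X :: "'b topology"
  assumes fb: "\<And>b. b \<in> topspace X \<Longrightarrow> \<exists>V S. b \<in> V \<and> flow_box A X f V S"
    and A: "f ` \<Union>A \<subseteq> topspace X"
    and p: "f p \<in> topspace X"
    and surj: "topspace X \<subseteq> f ` arc_leaf A p"
  shows "covering_map (subtopology (topology_generated_by A) (arc_leaf A p)) X f"
proof -
  let ?T = "topology_generated_by A" and ?L = "arc_leaf A p"
  have "p \<in> \<Union>A"
  proof -
    obtain V S where V: "f p \<in> V" "flow_box A X f V S" using fb[OF p] by blast
    then obtain s where "s \<in> S" "s (f p) = p" using flow_boxD(4)[OF V(2,1)] by auto
    then show ?thesis using flow_boxD(6)[OF V(2) \<open>s \<in> S\<close> flow_boxD(1)[OF V(2)] V(1)] by auto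
  qed
  then have "?L \<subseteq> \<Union>A"
    by (intro arc_leaf_subset) auto
  then have topL: "topspace (subtopology ?T ?L) = ?L" by auto
  have cont: "continuous_map ?T X f"
    unfolding continuous_map_def
  proof (intro conjI allI impI)
    show "f \<in> topspace ?T \<rightarrow> topspace X" using A by auto
    fix W assume W: "openin X W"
    show "openin ?T {q \<in> topspace ?T. f q \<in> W}"
    proof (subst openin_subopen, safe)
      fix q assume q: "q \<in> topspace ?T" "f q \<in> W"
      then obtain V S where V: "f q \<in> V" "flow_box A X f V S"
        using fb[of "f q"] openin_subset[OF W] by auto
      then obtain s where s: "s \<in> S" "s (f q) = q" using flow_boxD(4)[OF V(2,1)] by auto
      have "openin ?T (s ` (W \<inter> V))"
        by (rule flow_box_sheet_open[OF V(2) s(1)]) (use W flow_boxD(1)[OF V(2)] in auto)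
      moreover have "q \<in> s ` (W \<inter> V)" using q V s by (metis IntI imageI)
      moreover have "s ` (W \<inter> V) \<subseteq> {q \<in> topspace ?T. f q \<in> W}"
        using openin_subset[OF calculation(1)] flow_boxD(3)[OF V(2) s(1)] by auto
      ultimately show "\<exists>U. openin ?T U \<and> q \<in> U \<and> U \<subseteq> {q \<in> topspace ?T. f q \<in> W}" by blast
    qed
  qed
  have "\<exists>V. b \<in> V \<and> openin X V \<and>
        (\<exists>\<U>. \<Union>\<U> = {x \<in> topspace (subtopology ?T ?L). f x \<in> V} \<and> (\<forall>U\<in>\<U>. openin (subtopology ?T ?L) U) \<and> pairwise disjnt \<U> \<and>
             (\<forall>U\<in>\<U>. homeomorphic_map (subtopology (subtopology ?T ?L) U) (subtopology X V) f))"
    if b: "b \<in> topspace X" for b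
  proof -
    obtain V S where V: "b \<in> V" "flow_box A X f V S" using fb[OF b] by blast
    note VD = flow_boxD[OF V(2)]
    \<comment> \<open>Images are collected, not sections, since different members of
      \<open>S\<close> may have the same image over \<open>V\<close>.\<close>
    define \<U> where "\<U> = {s ` V | s. s \<in> S \<and> s ` V \<subseteq> ?L}"
    have un: "\<Union>\<U> = {x \<in> ?L. f x \<in> V}"
    proof (intro equalityI subsetI)
      fix q assume q: "q \<in> {x \<in> ?L. f x \<in> V}"
      then obtain s where s: "s \<in> S" "s (f q) = q" using VD(4)[of q] by auto
      then have "s ` V \<subseteq> ?L" using flow_box_sheet_subset_leaf[OF V(2) s(1), of "f q" p] q s(2) by auto
      moreover have "q \<in> s ` V" using s(2) q by (intro image_eqI[of _ _ "f q"]) auto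
      ultimately show "q \<in> \<Union>\<U>" unfolding \<U>_def using s(1) by auto
    qed (auto simp: \<U>_def VD(3))
    have op: "openin (subtopology ?T ?L) U" if U: "U \<in> \<U>" for U
    proof -
      obtain s where s: "s \<in> S" "U = s ` V" "U \<subseteq> ?L" using U by (auto simp: \<U>_def)
      then have "openin ?T U" using flow_box_sheet_open[OF V(2) s(1) VD(1)] by simp
      then show ?thesis using s(3) by (simp add: openin_subset_topspace_eq openin_subtopology_Int2 subset_openin_subtopology)
    qed
    have pd: "pairwise disjnt \<U>"
      unfolding pairwise_def
    proof (intro ballI impI)
      fix U U' assume "U \<in> \<U>" "U' \<in> \<U>" "U \<noteq> U'"
      then obtain s s' where s: "s \<in> S" "s' \<in> S" "U = s ` V" "U' = s' ` V" by (auto simp: \<U>_def)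
      show "disjnt U U'"
      proof (rule ccontr)
        assume "\<not> disjnt U U'"
        then obtain x x' where x: "x \<in> V" "x' \<in> V" "s x = s' x'" using s by (auto simp: disjnt_def)
        then have "x = x'" using VD(3) s by metis
        then have "s ` V = s' ` V" using VD(5)[OF s(1,2) x(1)] x by (auto intro!: image_cong)
        then show False using \<open>U \<noteq> U'\<close> s by simp
      qed
    qed
    have hm: "homeomorphic_map (subtopology (subtopology ?T ?L) U) (subtopology X V) f" if U: "U \<in> \<U>" for U
    proof -
      obtain s where s: "s \<in> S" "U = s ` V" "U \<subseteq> ?L" using U by (auto simp: \<U>_def)
      have VX: "V \<subseteq> topspace X" using VD(1) openin_subset by blast
      have UT: "U \<subseteq> \<Union>A" using s \<open>?L \<subseteq> \<Union>A\<close> by blast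
      have 1: "subtopology (subtopology ?T ?L) U = subtopology ?T U"
        using s by (simp add: subtopology_subtopology Int_absorb1)
      have "continuous_map (subtopology ?T U) (subtopology X V) f"
        using cont s VD(3) by (auto simp: continuous_map_in_subtopology continuous_map_from_subtopology)
      moreover have "continuous_map (subtopology X V) ?T s"
        unfolding continuous_map_def
      proof (intro conjI allI impI)
        show "s \<in> topspace (subtopology X V) \<rightarrow> topspace ?T" using UT s by auto
        fix Q assume "openin ?T Q"
        then have "openin X {x \<in> V. s x \<in> Q}" by (rule flow_box_sheet_continuous[OF V(2) s(1)])
        moreover have "{x \<in> topspace (subtopology X V). s x \<in> Q} = {x \<in> V. s x \<in> Q}" using VX by auto
        ultimately show "openin (subtopology X V) {x \<in> topspace (subtopology X V). s x \<in> Q}"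
          using VD(1) by (simp add: openin_open_subtopology)
      qed
      then have "continuous_map (subtopology X V) (subtopology ?T U) s"
        using s by (auto simp: continuous_map_in_subtopology)
      ultimately have "homeomorphic_maps (subtopology ?T U) (subtopology X V) f s"
        unfolding homeomorphic_maps_def using s VD(3) by auto
      then show ?thesis unfolding 1 homeomorphic_map_maps by blast
    qed
    show ?thesis
      unfolding topL by (intro exI[of _ V] conjI exI[of _ \<U>] ballI V(1) VD(1) un pd op hm)
  qed
  moreover have "f ` ?L = topspace X" using surj A \<open>?L \<subseteq> \<Union>A\<close> by blast
  ultimately show ?thesis
    unfolding covering_map_def topL using cont by (auto intro: continuous_map_from_subtopology)
qed

lemma leaf_eq_arc_leaf: "leaf F p = arc_leaf (integral_arcs F) p"
  by (simp add: leaf_def arc_leaf_def)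

section \<open>Curves and the topology of the sphere\<close>

lemma has_derivative_curve_iff:
  fixes \<gamma> :: "complex \<Rightarrow> complex^'n"
  shows "(\<gamma> has_derivative (\<lambda>h. h *s Y)) (at t) \<longleftrightarrow> (\<forall>k. ((\<lambda>t. \<gamma> t $ k) has_field_derivative Y $ k) (at t))"
proof -
  have "(\<lambda>h. (h *s Y) $ k) = (*) (Y $ k)" for k by (auto simp: fun_eq_iff mult.commute)
  then show ?thesis unfolding has_derivative_vec_nth_iff has_field_derivative_def by simp
qed

lemma isCont_vec:
  fixes \<gamma> :: "'a::t2_space \<Rightarrow> complex^'n"
  assumes "\<And>k. isCont (\<lambda>t. \<gamma> t $ k) t"
  shows "isCont \<gamma> t"
  using assms unfolding isCont_def by (intro vec_tendstoI)

lemma holo_fun_isCont: "holo_fun f U \<Longrightarrow> v \<in> U \<Longrightarrow> isCont f v"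
  unfolding holo_fun_def using has_derivative_continuous by blast

lemma holo_field_isCont: "holo_field Y U \<Longrightarrow> v \<in> U \<Longrightarrow> isCont Y v"
  unfolding holo_field_def by (intro isCont_vec) (auto intro: holo_fun_isCont)

text \<open>The homogeneity \<open>D (c *s h) = c * D h\<close> turns the real derivative of the
  composite into multiplication by the complex number \<open>D Y\<close>.\<close>

lemma holo_fun_compose_curve:
  assumes f: "holo_fun f U" and U: "\<gamma> t \<in> U"
    and d: "\<And>k. ((\<lambda>t. \<gamma> t $ k) has_field_derivative Y $ k) (at t)"
  shows "(\<lambda>t. f (\<gamma> t)) field_differentiable at t"
proof -
  obtain D where D: "(f has_derivative D) (at (\<gamma> t))" "\<And>c h. D (c *s h) = c * D h"
    using f U unfolding holo_fun_def by blast
  have "(\<gamma> has_derivative (\<lambda>h. h *s Y)) (at t)" using d by (simp add: has_derivative_curve_iff)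
  from has_derivative_compose[OF this D(1)]
  have "((\<lambda>t. f (\<gamma> t)) has_derivative (\<lambda>h. D Y * h)) (at t)" by (simp add: D(2) mult.commute)
  then show ?thesis
    unfolding field_differentiable_def has_field_derivative_def by blast
qed

lemma eventually_nhds_isCont_open:
  assumes "isCont f x" "open S" "f x \<in> S"
  shows "eventually (\<lambda>y. f y \<in> S) (nhds x)"
  using topological_tendstoD[OF assms(1)[unfolded isCont_def] assms(2,3)] assms(3)
  by (auto simp: eventually_at_filter elim!: eventually_mono)

lemma open_eventuallyI:
  assumes "\<And>w. w \<in> S \<Longrightarrow> eventually (\<lambda>y. y \<in> S) (nhds w)" shows "open S"
proof (subst open_subopen, intro ballI)
  fix w assume "w \<in> S"
  then obtain T where "open T" "w \<in> T" "\<And>y. y \<in> T \<Longrightarrow> y \<in> S"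
    using assms[of w] unfolding eventually_nhds by blast
  then show "\<exists>T. open T \<and> w \<in> T \<and> T \<subseteq> S" by auto
qed

text \<open>The topology of the one-point compactification, read in the two charts. Under inversion
  the complement of a compact set, together with infinity, becomes a neighbourhood of 0, and
  conversely.\<close>

lemma openin_sphere_iff: "openin sphere_top W \<longleftrightarrow> (\<forall>c. open {w. base_chart c w \<in> W})"
proof
  assume W: "openin sphere_top W"
  show "\<forall>c. open {w. base_chart c w \<in> W}"
    unfolding all_bool_eq
  proof
    have inverse_ev: "eventually (\<lambda>y. base_chart True y \<in> W) (nhds w)"
      if w: "w \<noteq> 0" "inverse w \<in> U" and U: "open U" "Some ` U \<subseteq> W" for w U
    proof -
      have "eventually (\<lambda>y. inverse y \<in> U) (nhds w)"
        by (rule eventually_nhds_isCont_open) (use w U in \<open>auto intro!: continuous_intros\<close>)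
      moreover have "eventually (\<lambda>y. y \<noteq> 0) (nhds w)" using w by (intro t1_space_nhds)
      ultimately show ?thesis
        by eventually_elim (use U in \<open>auto simp: base_chart_def\<close>)
    qed
    consider (1) U where "open U" "W = Some ` U" | (2) C where "compact C" "W = insert None (Some ` (- C))"
      using W unfolding openin_Alexandroff_compactification by (auto simp: Compl_eq_Diff_UNIV)
    then have "open {w. base_chart False w \<in> W} \<and> open {w. base_chart True w \<in> W}"
    proof cases
      case 1
      have "eventually (\<lambda>y. y \<in> {w. base_chart True w \<in> W}) (nhds w)" if "w \<in> {w. base_chart True w \<in> W}" for w
      proof -
        have "w \<noteq> 0" "inverse w \<in> U" using that 1 by (auto simp: base_chart_def split: if_splits)
        then show ?thesis using inverse_ev[of w U] 1 by simp
      qed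
      moreover have "{w. base_chart False w \<in> W} = U" using 1 by (auto simp: base_chart_def)
      ultimately show ?thesis using 1 open_eventuallyI[of "{w. base_chart True w \<in> W}"] by simp
    next
      case 2
      then obtain r where r: "r > 0" "\<And>x. x \<in> C \<Longrightarrow> norm x \<le> r"
        using bounded_pos compact_imp_bounded by metis
      have "eventually (\<lambda>y. y \<in> {w. base_chart True w \<in> W}) (nhds w)" if w: "w \<in> {w. base_chart True w \<in> W}" for w
      proof (cases "w = 0")
        case True
        have "y \<in> {w. base_chart True w \<in> W}" if "norm y < inverse r" for y
        proof (cases "y = 0")
          case False
          then have "norm (inverse y) > r" using that r(1) less_imp_inverse_less[OF that] by (simp add: norm_inverse)
          then have "inverse y \<notin> C" using r(2) by force
          then show ?thesis using False 2 by (auto simp: base_chart_def)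
        qed (use 2 in \<open>auto simp: base_chart_def\<close>)
        then show ?thesis
          unfolding True eventually_nhds_metric using r(1) by (intro exI[of _ "inverse r"]) (auto simp: dist_norm)
      next
        case False
        then have "inverse w \<in> - C" using w 2 by (auto simp: base_chart_def)
        then show ?thesis
          using inverse_ev[of w "- C"] False 2 compact_imp_closed[OF 2(1)] by (simp add: open_Compl subset_insertI)
      qed
      moreover have "{w. base_chart False w \<in> W} = - C" using 2 by (auto simp: base_chart_def)
      ultimately show ?thesis
        using compact_imp_closed[OF 2(1)] open_eventuallyI[of "{w. base_chart True w \<in> W}"] by (simp add: open_Compl)
    qed
    then show "open {w. base_chart False w \<in> W}" "open {w. base_chart True w \<in> W}" by auto
  qed
next
  assume *: "\<forall>c. open {w. base_chart c w \<in> W}"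
  define U where "U = {w. base_chart False w \<in> W}"
  have "W - {None} \<subseteq> Some ` U"
  proof
    fix y assume y: "y \<in> W - {None}"
    then obtain x where "y = Some x" by auto
    then show "y \<in> Some ` U" using y by (auto simp: U_def base_chart_def)
  qed
  moreover have "Some ` U \<subseteq> W - {None}" by (auto simp: U_def base_chart_def)
  ultimately have U: "Some ` U = W - {None}" by (rule equalityI[rotated])
  have "open U" using * unfolding U_def by simp
  show "openin sphere_top W"
  proof (cases "None \<in> W")
    case False
    then show ?thesis unfolding openin_Alexandroff_compactification using U \<open>open U\<close> by (intro disjI1 exI[of _ U]) auto
  next
    case True
    have "open {w. base_chart True w \<in> W}" "0 \<in> {w. base_chart True w \<in> W}"
      using spec[OF *, of True] True by (simp_all add: base_chart_def)
    then obtain e where e: "e > 0" "ball 0 e \<subseteq> {w. base_chart True w \<in> W}" using open_contains_ball by blast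
    have "norm x \<le> inverse e" if x: "x \<in> - U" for x
    proof (rule ccontr)
      assume "\<not> norm x \<le> inverse e"
      then have "norm x > inverse e" by simp
      moreover have "inverse e > 0" using e by simp
      ultimately have "x \<noteq> 0" "norm (inverse x) < e"
        using less_imp_inverse_less[of "inverse e" "norm x"] by (auto simp: norm_inverse)
      then have "inverse x \<in> {w. base_chart True w \<in> W}" using e by auto
      then show False using x \<open>x \<noteq> 0\<close> by (auto simp: U_def base_chart_def)
    qed
    then have "bounded (- U)" unfolding bounded_iff by blast
    then have "compact (- U)" using \<open>open U\<close> by (simp add: compact_eq_bounded_closed closed_Compl)
    moreover have "W = insert None (Some ` (UNIV - (- U)))" using U True by auto
    ultimately show ?thesis
      unfolding openin_Alexandroff_compactification using \<open>open U\<close>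
      by (intro disjI2 exI[of _ "- U"]) (auto simp: closed_Compl)
  qed
qed

lemma openin_sphere_base_chart_image:
  assumes "open D" shows "openin sphere_top (base_chart c ` D)"
  unfolding openin_sphere_iff
proof
  fix b
  show "open {w. base_chart b w \<in> base_chart c ` D}"
  proof (cases "b = c")
    case True
    then have "{w. base_chart b w \<in> base_chart c ` D} = D" by auto
    then show ?thesis using assms by simp
  next
    case False
    have "{w. base_chart b w \<in> base_chart c ` D} = - {0} \<inter> inverse -` D"
      using False by (auto simp: base_chart_eq_iff base_trans_def)
    also have "open \<dots>"
      using assms by (intro continuous_open_preimage) (auto intro!: continuous_intros)
    finally show ?thesis .
  qed
qed

lemma topspace_sphere: "topspace sphere_top = UNIV"
  by (auto simp: image_iff)

lemma connectedin_sphere_base_chart_image: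
  assumes "connected D" shows "connectedin sphere_top (base_chart c ` D)"
proof (rule connectedin_continuous_map_image)
  show "continuous_map euclidean sphere_top (base_chart c)"
    unfolding continuous_map_def using topspace_sphere by (auto simp: openin_sphere_iff)
  show "connectedin euclidean D" using assms by simp
qed

section \<open>Sheets of a linear system\<close>

text \<open>The quotient rule arranged so that only ratios by \<open>g w\<close> occur. For a
  solution of the linear system these ratios are the entries of \<open>M\<close> applied to the
  normalised vector, as in \<open>riccati_at\<close>.\<close>

lemma has_field_derivative_vector_quotient:
  assumes "(f has_field_derivative f') (at w)" "(g has_field_derivative g') (at w)" "g w \<noteq> 0"
  shows "((\<lambda>w. f w / g w) has_field_derivative (f' / g w - (f w / g w) * (g' / g w))) (at (w::complex))"
  using DERIV_divide[OF assms] assms(3) by (auto simp: field_simps)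

lemma base_trans_inverse: "b = c \<or> x \<noteq> 0 \<Longrightarrow> base_trans c b (base_trans b c x) = x"
  by (auto simp: base_trans_def)

lemma base_dtrans_inverse: "b = c \<or> x \<noteq> 0 \<Longrightarrow> base_dtrans c b (base_trans b c x) * base_dtrans b c x = 1"
  by (auto simp: base_trans_def base_dtrans_def field_simps)

text \<open>In homogeneous fibre coordinates \<open>L\<close> the field is \<open>dL/dw = M(w) L\<close> up to multiples of \<open>L\<close>. Here \<open>w\<close> is the
  coordinate of the base chart \<open>c\<close>, while the generator may use the other base chart.\<close>

definition riccati_at :: "bool \<Rightarrow> (complex \<Rightarrow> complex^3^3) \<Rightarrow> bool \<Rightarrow> 3 \<Rightarrow> (complex^3 \<Rightarrow> complex^3) \<Rightarrow> complex^3 \<Rightarrow> bool" where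
  "riccati_at c M b j Y v \<longleftrightarrow>
     (let N = M (base_trans b c (v$1)) *v fibre_lift j v; e = Y v $ 1 * base_dtrans b c (v$1)
      in Y v $ 2 = e * (N $ fst_idx j - N $ j * v $ 2) \<and> Y v $ 3 = e * (N $ snd_idx j - N $ j * v $ 3))"

text \<open>The local situation over one disc: generators cover all points there, are transverse to
  the fibres and are projections of the linear system. \<open>\<Phi>\<close> and
  \<open>\<Psi>\<close> are mutually inverse fundamental matrices, so constant vectors parametrise
  the solutions.\<close>

locale linear_flow =
  fixes G :: "generator set" and c :: bool and w0 :: complex and r :: real
    and M \<Phi> \<Psi> :: "complex \<Rightarrow> complex^3^3"
  assumes r: "0 < r"
    and G: "\<And>H. H \<in> G \<Longrightarrow> is_generator H"
    and G_cover: "\<And>q. fst q \<in> base_chart c ` ball w0 r \<Longrightarrow> \<exists>b j U Y u. (std_chart b j, U, Y) \<in> G \<and> u \<in> U \<and> std_chart b j u = q"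
    and G_riccati: "\<And>b j U Y v. (std_chart b j, U, Y) \<in> G \<Longrightarrow> v \<in> U \<Longrightarrow> base_chart b (v$1) \<in> base_chart c ` ball w0 r \<Longrightarrow>
       Y v $ 1 \<noteq> 0 \<and> riccati_at c M b j Y v"
    and \<Phi>: "\<And>w i j. w \<in> ball w0 r \<Longrightarrow> ((\<lambda>w. \<Phi> w $ i $ j) has_field_derivative (M w ** \<Phi> w) $ i $ j) (at w)"
    and \<Psi>: "\<And>w i j. w \<in> ball w0 r \<Longrightarrow> ((\<lambda>w. \<Psi> w $ i $ j) has_field_derivative - (\<Psi> w ** M w) $ i $ j) (at w)"
    and \<Psi>\<Phi>: "\<And>w. w \<in> ball w0 r \<Longrightarrow> \<Psi> w ** \<Phi> w = mat 1"
    and \<Phi>\<Psi>: "\<And>w. w \<in> ball w0 r \<Longrightarrow> \<Phi> w ** \<Psi> w = mat 1"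
begin

text \<open>The projectivised solution of the linear system with parameter \<open>v\<close>.
  Proportional vectors \<open>v\<close> give the same sheet.\<close>

definition sheet :: "complex^3 \<Rightarrow> complex \<Rightarrow> total" where
  "sheet v w = (base_chart c w, abs_cp2 (\<Phi> w *v v))"

lemma \<Psi>\<Phi>_vec: "w \<in> ball w0 r \<Longrightarrow> \<Psi> w *v (\<Phi> w *v v) = v"
  by (simp add: matrix_vector_mul_assoc \<Psi>\<Phi>)

lemma \<Phi>\<Psi>_vec: "w \<in> ball w0 r \<Longrightarrow> \<Phi> w *v (\<Psi> w *v v) = v"
  by (simp add: matrix_vector_mul_assoc \<Phi>\<Psi>)

lemma \<Phi>_nonzero: "w \<in> ball w0 r \<Longrightarrow> v \<noteq> 0 \<Longrightarrow> \<Phi> w *v v \<noteq> 0"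
  using \<Psi>\<Phi>_vec[of w v] by auto

lemma \<Psi>_nonzero: "w \<in> ball w0 r \<Longrightarrow> v \<noteq> 0 \<Longrightarrow> \<Psi> w *v v \<noteq> 0"
  using \<Phi>\<Psi>_vec[of w v] by auto

lemma \<Phi>_vec_deriv:
  "w \<in> ball w0 r \<Longrightarrow> ((\<lambda>w. (\<Phi> w *v v) $ i) has_field_derivative (M w *v (\<Phi> w *v v)) $ i) (at w)"
proof -
  assume w: "w \<in> ball w0 r"
  have "((\<lambda>w. \<Sum>k\<in>UNIV. \<Phi> w $ i $ k * v $ k) has_field_derivative (\<Sum>k\<in>UNIV. (M w ** \<Phi> w) $ i $ k * v $ k)) (at w)"
    by (intro DERIV_sum DERIV_cmult_right \<Phi> w)
  moreover have "(\<Sum>k\<in>UNIV. (M w ** \<Phi> w) $ i $ k * v $ k) = (M w *v (\<Phi> w *v v)) $ i"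
    by (simp add: matrix_vector_mul_assoc) (simp add: matrix_vector_mult_def)
  ultimately show ?thesis by (simp add: matrix_vector_mult_def[of "\<Phi> _"])
qed

text \<open>The sheet is parametrised by the base coordinate, an integral arc by time. The velocity
  of the sheet is \<open>h\<close> times the field, so a primitive \<open>T\<close> of
  \<open>h\<close> is the time, and the sheet reparametrised by the local inverse of
  \<open>T\<close> is an integral arc.\<close>

lemma sheet_contains_arc:
  assumes v: "v \<noteq> 0" and W: "open W" "w1 \<in> W" "W \<subseteq> ball w0 r"
  shows "\<exists>P\<in>integral_arcs G. sheet v w1 \<in> P \<and> P \<subseteq> sheet v ` W"
proof -
  define u where "u w = \<Phi> w *v v" for w
  have w1: "w1 \<in> ball w0 r" using W by blast
  obtain b j U Y u1 where gen: "(std_chart b j, U, Y) \<in> G" "u1 \<in> U" "std_chart b j u1 = sheet v w1"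
    using G_cover[of "sheet v w1"] w1 by (auto simp: sheet_def)
  have Y: "holo_field Y U" "open U" using G[OF gen(1)] by auto
  define S where "S w = std_coords (base_trans c b w) j (u w)" for w
  have base1: "c = b \<or> w1 \<noteq> 0" "u1 $ 1 = base_trans c b w1"
    using gen(3) base_chart_eq_iff[of c w1 b "u1 $ 1"] by (auto simp: sheet_def std_chart_def)
  have "std_chart b j u1 = (base_chart b (base_trans c b w1), abs_cp2 (u w1))"
    using gen(3) base1 by (simp add: sheet_def u_def base_chart_trans)
  then have u1: "u w1 $ j \<noteq> 0" "u1 = S w1"
    using std_chart_eq_iff \<Phi>_nonzero[OF w1 v] by (auto simp: S_def u_def)
  let ?N = "\<lambda>w. M w *v fibre_lift j (S w)"
  have S_deriv: "((\<lambda>w. S w $ 1) has_field_derivative base_dtrans c b w) (at w)"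
      "((\<lambda>w. S w $ 2) has_field_derivative ?N w $ fst_idx j - S w $ 2 * ?N w $ j) (at w)"
      "((\<lambda>w. S w $ 3) has_field_derivative ?N w $ snd_idx j - S w $ 3 * ?N w $ j) (at w)"
    if w: "w \<in> ball w0 r" "c = b \<or> w \<noteq> 0" "u w $ j \<noteq> 0" for w
  proof -
    have N: "?N w $ k = (M w *v u w) $ k / u w $ j" for k
      unfolding S_def fibre_lift_std_coords[OF w(3)]
      by (simp add: vector_scalar_mult_def matrix_vector_mult_def sum_distrib_left sum_divide_distrib field_simps)
    have u': "((\<lambda>w. u w $ k) has_field_derivative (M w *v u w) $ k) (at w)" for k
      unfolding u_def by (rule \<Phi>_vec_deriv[OF w(1)])
    show "((\<lambda>w. S w $ 1) has_field_derivative base_dtrans c b w) (at w)"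
      unfolding S_def std_coords_nth using base_trans_has_derivative[OF w(2)] by simp
    show "((\<lambda>w. S w $ 2) has_field_derivative ?N w $ fst_idx j - S w $ 2 * ?N w $ j) (at w)"
      using has_field_derivative_vector_quotient[OF u' u' w(3), of "fst_idx j"] unfolding N by (simp add: S_def)
    show "((\<lambda>w. S w $ 3) has_field_derivative ?N w $ snd_idx j - S w $ 3 * ?N w $ j) (at w)"
      using has_field_derivative_vector_quotient[OF u' u' w(3), of "snd_idx j"] unfolding N by (simp add: S_def)
  qed
  have "isCont (\<lambda>w. u w $ j) w1"
    unfolding u_def using \<Phi>_vec_deriv[OF w1] DERIV_isCont by blast
  then have ev1: "eventually (\<lambda>w. u w $ j \<noteq> 0) (nhds w1)" using u1 by (intro eventually_nonzero_nhds)
  have "isCont (\<lambda>w. S w $ k) w1" for k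
    using S_deriv[OF w1 base1(1) u1(1)] DERIV_isCont exhaust_3[of k] by blast
  then have "isCont S w1" by (rule isCont_vec)
  then have ev2: "eventually (\<lambda>w. S w \<in> U) (nhds w1)"
    using Y(2) gen(2) u1 by (intro eventually_nhds_isCont_open) auto
  have ev3: "eventually (\<lambda>w. c = b \<or> w \<noteq> 0) (nhds w1)"
    using base1(1) t1_space_nhds[of w1 0] by (auto elim: eventually_mono)
  have ev4: "eventually (\<lambda>w. w \<in> W) (nhds w1)" using W by (simp add: eventually_nhds_in_open)
  have "eventually (\<lambda>w. (c = b \<or> w \<noteq> 0) \<and> u w $ j \<noteq> 0 \<and> S w \<in> U \<and> w \<in> W) (nhds w1)"
    using ev1 ev2 ev3 ev4 by eventually_elim auto
  then obtain \<epsilon> where \<epsilon>: "\<epsilon> > 0" "\<And>w. w \<in> ball w1 \<epsilon> \<Longrightarrow> (c = b \<or> w \<noteq> 0) \<and> u w $ j \<noteq> 0 \<and> S w \<in> U \<and> w \<in> W"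
    unfolding eventually_nhds_metric by (auto simp: dist_commute)
  have ballr: "w \<in> ball w0 r" if "w \<in> ball w1 \<epsilon>" for w using \<epsilon>(2)[OF that] W by auto
  have chart: "std_chart b j (S w) = sheet v w" if "w \<in> ball w1 \<epsilon>" for w
    using \<epsilon>(2)[OF that] \<Phi>_nonzero[OF ballr[OF that] v]
    by (simp add: S_def sheet_def std_chart_std_coords u_def base_chart_trans)
  have Y1: "Y (S w) $ 1 \<noteq> 0" "riccati_at c M b j Y (S w)" if "w \<in> ball w1 \<epsilon>" for w
  proof -
    have "base_chart b (S w $ 1) = base_chart c w" using \<epsilon>(2)[OF that] by (simp add: S_def base_chart_trans)
    then show "Y (S w) $ 1 \<noteq> 0" "riccati_at c M b j Y (S w)"
      using G_riccati[OF gen(1), of "S w"] \<epsilon>(2)[OF that] ballr[OF that] by auto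
  qed
  \<comment> \<open>Time per unit of \<open>w\<close>: the velocity of the first chart coordinate
    along the sheet divided by its velocity along the field.\<close>
  define h where "h w = base_dtrans c b w / Y (S w) $ 1" for w
  have S': "((\<lambda>w. S w $ k) has_field_derivative h w * Y (S w) $ k) (at w)" if w: "w \<in> ball w1 \<epsilon>" for w k
  proof -
    note * = \<epsilon>(2)[OF w] ballr[OF w] Y1[OF w]
    have 1: "base_trans b c (S w $ 1) = w" using * by (simp add: S_def base_trans_inverse)
    have 2: "h w * (Y (S w) $ 1 * base_dtrans b c (S w $ 1)) = 1"
      using base_dtrans_inverse[of c b w] * by (simp add: h_def S_def mult.commute)
    have 3: "h w * (Y (S w) $ 1 * base_dtrans b c (S w $ 1) * z) = z" for z
      using 2 by (simp add: mult.assoc[symmetric])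
    have "h w * Y (S w) $ 1 = base_dtrans c b w" using * by (simp add: h_def)
    moreover have "h w * Y (S w) $ 2 = ?N w $ fst_idx j - S w $ 2 * ?N w $ j"
      "h w * Y (S w) $ 3 = ?N w $ snd_idx j - S w $ 3 * ?N w $ j"
      using *(4) unfolding riccati_at_def Let_def 1 by (simp_all add: 3 mult.commute)
    ultimately show ?thesis using S_deriv[of w] * exhaust_3[of k] by auto
  qed
  have hnz: "h w \<noteq> 0" if "w \<in> ball w1 \<epsilon>" for w
    using Y1(1)[OF that] base_dtrans_nonzero[of c b w] \<epsilon>(2)[OF that] by (simp add: h_def)
  have "h field_differentiable at w" if w: "w \<in> ball w1 \<epsilon>" for w
  proof -
    have "(\<lambda>w. Y (S w) $ 1) field_differentiable at w"
      by (rule holo_fun_compose_curve[of "\<lambda>v. Y v $ 1" U S _ "h w *s Y (S w)"])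
         (use Y \<epsilon>(2)[OF w] S'[OF w] in \<open>auto simp: holo_field_def\<close>)
    moreover have "base_dtrans c b field_differentiable at w"
      using \<epsilon>(2)[OF w] unfolding base_dtrans_def[abs_def] power2_eq_square
      by (cases "c = b") (auto intro!: field_differentiable_minus field_differentiable_mult field_differentiable_inverse)
    ultimately show ?thesis
      unfolding h_def[abs_def] using Y1(1)[OF w] by (intro field_differentiable_divide)
  qed
  then have "h holomorphic_on ball w1 \<epsilon>" by (simp add: holomorphic_on_def field_differentiable_at_within)
  then obtain T where T: "\<And>w. w \<in> ball w1 \<epsilon> \<Longrightarrow> (T has_field_derivative h w) (at w)"
    using holomorphic_convex_primitive'[OF convex_ball open_ball, of h w1 \<epsilon>] at_within_open[OF _ open_ball, of _ w1 \<epsilon>]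
    by auto
  have holT: "T holomorphic_on ball w1 \<epsilon>"
    unfolding holomorphic_on_open[OF open_ball] using T by blast
  have "deriv T w1 \<noteq> 0" using DERIV_imp_deriv[OF T[of w1]] hnz[of w1] \<epsilon>(1) by simp
  then obtain \<rho> where \<rho>: "\<rho> > 0" "ball w1 \<rho> \<subseteq> ball w1 \<epsilon>" "open (T ` ball w1 \<rho>)" "inj_on T (ball w1 \<rho>)"
    using has_complex_derivative_locally_invertible[OF holT _ open_ball, of w1] \<epsilon>(1) by auto
  obtain g where g: "g holomorphic_on (T ` ball w1 \<rho>)" "\<And>z. z \<in> ball w1 \<rho> \<Longrightarrow> deriv T z * deriv g (T z) = 1"
     "\<And>z. z \<in> ball w1 \<rho> \<Longrightarrow> g (T z) = z"
    using holomorphic_has_inverse[OF holomorphic_on_subset[OF holT \<rho>(2)] open_ball \<rho>(4)] by auto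
  define \<gamma> where "\<gamma> t = S (g t)" for t
  let ?D = "T ` ball w1 \<rho>"
  have "(\<gamma> has_derivative (\<lambda>h. h *s Y (\<gamma> t))) (at t)" if t: "t \<in> ?D" for t
    unfolding has_derivative_curve_iff
  proof
    fix k
    obtain z where z: "z \<in> ball w1 \<rho>" "t = T z" using t by auto
    have z': "z \<in> ball w1 \<epsilon>" using z \<rho> by auto
    have "(g has_field_derivative deriv g t) (at t)"
      using holomorphic_derivI[OF g(1) \<rho>(3) t] .
    moreover have "deriv g t = 1 / h z"
      using g(2)[OF z(1)] DERIV_imp_deriv[OF T[OF z']] hnz[OF z'] z by (simp add: field_simps)
    ultimately have g': "(g has_field_derivative 1 / h z) (at t)" by simp
    have "((\<lambda>w. S w $ k) has_field_derivative h z * Y (S z) $ k) (at (g t))"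
      using S'[OF z', of k] g(3)[OF z(1)] z by simp
    from DERIV_chain2[OF this g'] show "((\<lambda>t. \<gamma> t $ k) has_field_derivative Y (\<gamma> t) $ k) (at t)"
      using hnz[OF z'] g(3)[OF z(1)] z by (simp add: \<gamma>_def)
  qed
  moreover have "open ?D" by (rule \<rho>(3))
  moreover have "connected ?D"
    using holT \<rho>(2) by (intro connected_continuous_image holomorphic_on_imp_continuous_on[OF holomorphic_on_subset]) auto
  moreover have \<gamma>D: "\<gamma> ` ?D = S ` ball w1 \<rho>"
    unfolding image_image \<gamma>_def using g(3) by (intro image_cong) auto
  moreover have "S ` ball w1 \<rho> \<subseteq> U" using \<epsilon>(2) \<rho>(2) by auto
  moreover have "Y (\<gamma> t) \<noteq> 0" if t: "t \<in> ?D" for t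
  proof -
    obtain z where z: "z \<in> ball w1 \<rho>" "t = T z" using t by auto
    then have "Y (\<gamma> t) $ 1 \<noteq> 0" using Y1(1)[of z] g(3)[OF z(1)] \<rho>(2) by (auto simp: \<gamma>_def)
    then show ?thesis by auto
  qed
  ultimately have "std_chart b j ` \<gamma> ` ?D \<in> integral_arcs G"
    unfolding integral_arcs_def using gen(1)
    by (intro CollectI exI[of _ "std_chart b j"] exI[of _ U] exI[of _ Y] exI[of _ \<gamma>] exI[of _ ?D]) auto
  moreover have "std_chart b j ` \<gamma> ` ?D = sheet v ` ball w1 \<rho>"
  proof -
    have "std_chart b j ` \<gamma> ` ?D = std_chart b j ` S ` ball w1 \<rho>" by (simp only: \<gamma>D)
    also have "\<dots> = sheet v ` ball w1 \<rho>"
      unfolding image_image using chart \<rho>(2) by (intro image_cong) auto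
    finally show ?thesis .
  qed
  moreover have "sheet v ` ball w1 \<rho> \<subseteq> sheet v ` W" using \<epsilon>(2) \<rho>(2) by (intro image_mono) auto
  moreover have "sheet v w1 \<in> sheet v ` ball w1 \<rho>" using \<rho>(1) by simp
  ultimately show ?thesis by auto
qed

text \<open>Along an arc the normalised lift \<open>l\<close> solves the linear system up to
  multiples of itself, so \<open>\<Psi>\<close> turns it into a vector \<open>n\<close> whose
  derivative is a multiple of \<open>n\<close>. The line spanned by \<open>n\<close> is therefore
  locally constant, which means that the arc runs in one sheet near \<open>t0\<close>.\<close>

lemma arc_contains_sheet_piece:
  assumes v: "v \<noteq> 0" and w1: "w1 \<in> ball w0 r" and P: "P \<in> integral_arcs G" "sheet v w1 \<in> P"
  shows "\<exists>W. open W \<and> w1 \<in> W \<and> W \<subseteq> ball w0 r \<and> sheet v ` W \<subseteq> P"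
proof -
  obtain \<phi> U Y \<gamma> D where gen: "(\<phi>, U, Y) \<in> G" and D: "open D" "connected D" "\<gamma> ` D \<subseteq> U" and PD: "P = \<phi> ` \<gamma> ` D"
    and \<gamma>: "\<And>t. t \<in> D \<Longrightarrow> (\<gamma> has_derivative (\<lambda>h. h *s Y (\<gamma> t))) (at t)"
    using P(1) unfolding integral_arcs_def by auto
  have "\<phi> \<in> total_charts" using G[OF gen] by simp
  then obtain b j where \<phi>: "\<phi> = std_chart b j" by (auto simp: total_charts_eq)
  note gen = gen[unfolded \<phi>]
  have \<gamma>': "((\<lambda>t. \<gamma> t $ k) has_field_derivative Y (\<gamma> t) $ k) (at t)" if "t \<in> D" for t k
    using \<gamma>[OF that] by (simp add: has_derivative_curve_iff)
  obtain t0 where t0: "t0 \<in> D" "std_chart b j (\<gamma> t0) = sheet v w1"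
    using P(2) PD \<phi> by auto
  define x where "x t = \<gamma> t $ 1" for t
  define w where "w t = base_trans b c (x t)" for t
  define l where "l t = fibre_lift j (\<gamma> t)" for t
  define n where "n t = \<Psi> (w t) *v l t" for t
  have base0: "b = c \<or> x t0 \<noteq> 0" "w t0 = w1"
    using t0(2) base_chart_eq_iff[of b "x t0" c w1] by (auto simp: sheet_def std_chart_def x_def w_def)
  have w': "(w has_field_derivative base_dtrans b c (x t) * Y (\<gamma> t) $ 1) (at t)"
    if t: "t \<in> D" "b = c \<or> x t \<noteq> 0" for t
    unfolding w_def[abs_def] using DERIV_chain2[OF base_trans_has_derivative[OF t(2)] \<gamma>'[OF t(1), of 1, folded x_def]] .
  have Y1: "Y (\<gamma> t) $ 1 \<noteq> 0" "riccati_at c M b j Y (\<gamma> t)"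
    if t: "t \<in> D" "b = c \<or> x t \<noteq> 0" "w t \<in> ball w0 r" for t
  proof -
    have "base_chart b (\<gamma> t $ 1) = base_chart c (w t)" using t(2) by (simp add: w_def x_def base_chart_trans)
    then show "Y (\<gamma> t) $ 1 \<noteq> 0" "riccati_at c M b j Y (\<gamma> t)"
      using G_riccati[OF gen, of "\<gamma> t"] D(3) t by auto
  qed
  \<comment> \<open>The velocity of \<open>w\<close> along the arc; the fibre velocities are
    expressed as multiples of it.\<close>
  define e where "e t = base_dtrans b c (x t) * Y (\<gamma> t) $ 1" for t
  have l': "((\<lambda>t. l t $ k) has_field_derivative e t * ((M (w t) *v l t) $ k - (M (w t) *v l t) $ j * l t $ k)) (at t)"
    if t: "t \<in> D" "b = c \<or> x t \<noteq> 0" "w t \<in> ball w0 r" for t k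
  proof -
    have Y2: "Y (\<gamma> t) $ 2 = e t * ((M (w t) *v l t) $ fst_idx j - (M (w t) *v l t) $ j * \<gamma> t $ 2)"
      and Y3: "Y (\<gamma> t) $ 3 = e t * ((M (w t) *v l t) $ snd_idx j - (M (w t) *v l t) $ j * \<gamma> t $ 3)"
      using Y1(2)[OF t] by (simp_all add: riccati_at_def Let_def l_def w_def x_def e_def mult_ac)
    consider "k = j" | "k = fst_idx j" | "k = snd_idx j" using idx_cases[of k j] by blast
    then show ?thesis
    proof cases
      case 1 then show ?thesis by (simp add: l_def)
    next
      case 2 then show ?thesis using \<gamma>'[OF t(1), of 2, unfolded Y2] by (simp add: l_def)
    next
      case 3 then show ?thesis using \<gamma>'[OF t(1), of 3, unfolded Y3] by (simp add: l_def)
    qed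
  qed
  have n': "((\<lambda>t. n t $ i) has_field_derivative - (e t * (M (w t) *v l t) $ j) * n t $ i) (at t)"
    if t: "t \<in> D" "b = c \<or> x t \<noteq> 0" "w t \<in> ball w0 r" for t i
  proof -
    let ?N = "M (w t) *v l t"
    have 1: "((\<lambda>t. \<Psi> (w t) $ i $ k) has_field_derivative - (\<Psi> (w t) ** M (w t)) $ i $ k * e t) (at t)" for k
      unfolding e_def by (rule DERIV_chain2[OF \<Psi>[OF t(3)] w'[OF t(1,2)]])
    have "((\<lambda>t. \<Sum>k\<in>UNIV. \<Psi> (w t) $ i $ k * l t $ k) has_field_derivative
       (\<Sum>k\<in>UNIV. \<Psi> (w t) $ i $ k * (e t * (?N $ k - ?N $ j * l t $ k)) + - (\<Psi> (w t) ** M (w t)) $ i $ k * e t * l t $ k)) (at t)"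
      by (intro DERIV_sum DERIV_mult' 1 l' t)
    moreover have "(\<Sum>k\<in>UNIV. \<Psi> (w t) $ i $ k * (e t * (?N $ k - ?N $ j * l t $ k)) + - (\<Psi> (w t) ** M (w t)) $ i $ k * e t * l t $ k)
       = e t * ((\<Psi> (w t) *v ?N) $ i - ((\<Psi> (w t) ** M (w t)) *v l t) $ i) - e t * ?N $ j * n t $ i"
      unfolding n_def matrix_vector_mult_def[of "\<Psi> _"] matrix_vector_mult_def[of "\<Psi> _ ** _"] vec_lambda_beta
      by (simp add: sum.distrib sum_subtractf sum_distrib_left right_diff_distrib sum_negf mult_ac)
    ultimately show ?thesis
      by (simp add: n_def matrix_vector_mult_def[of "\<Psi> _"] matrix_vector_mul_assoc)
  qed
  have w1': "w t0 \<in> ball w0 r" using base0 w1 by simp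
  have "n t0 \<noteq> 0" unfolding n_def using \<Psi>_nonzero[OF w1'] by (simp add: l_def)
  then obtain k0 where k0: "n t0 $ k0 \<noteq> 0" by (auto simp: vec_eq_iff)
  have "isCont (\<lambda>t. n t $ k0) t0" using n'[OF t0(1) base0(1) w1'] by (rule DERIV_isCont)
  then have ev1: "eventually (\<lambda>t. n t $ k0 \<noteq> 0) (nhds t0)" using k0 by (rule eventually_nonzero_nhds)
  have "isCont w t0" using w'[OF t0(1) base0(1)] by (rule DERIV_isCont)
  from eventually_nhds_isCont_open[OF this open_ball w1']
  have ev2: "eventually (\<lambda>t. w t \<in> ball w0 r) (nhds t0)" .
  have "isCont x t0" unfolding x_def using \<gamma>'[OF t0(1)] by (rule DERIV_isCont)
  then have ev3: "eventually (\<lambda>t. b = c \<or> x t \<noteq> 0) (nhds t0)"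
    using base0(1) eventually_nonzero_nhds[of t0 x] by (auto elim: eventually_mono)
  have ev4: "eventually (\<lambda>t. t \<in> D) (nhds t0)" using D t0 by (simp add: eventually_nhds_in_open)
  have "eventually (\<lambda>t. n t $ k0 \<noteq> 0 \<and> w t \<in> ball w0 r \<and> (b = c \<or> x t \<noteq> 0) \<and> t \<in> D) (nhds t0)"
    using ev1 ev2 ev3 ev4 by eventually_elim auto
  then obtain \<epsilon> where \<epsilon>: "\<epsilon> > 0" "\<And>t. t \<in> ball t0 \<epsilon> \<Longrightarrow> n t $ k0 \<noteq> 0 \<and> w t \<in> ball w0 r \<and> (b = c \<or> x t \<noteq> 0) \<and> t \<in> D"
    unfolding eventually_nhds_metric by (auto simp: dist_commute)
  obtain \<kappa> where \<kappa>: "\<kappa> \<noteq> 0" "\<Phi> w1 *v v = \<kappa> *s l t0"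
    using t0(2) abs_cp2_eq_iff[of "l t0" "\<Phi> w1 *v v"] \<Phi>_nonzero[OF w1 v] by (auto simp: sheet_def std_chart_def l_def)
  have v_n: "v = \<kappa> *s n t0"
    using \<Psi>\<Phi>_vec[OF w1, of v] by (simp add: \<kappa>(2) n_def base0 vector_scalar_commute)
  have on_sheet: "std_chart b j (\<gamma> t) = sheet v (w t)" if t: "t \<in> ball t0 \<epsilon>" for t
  proof -
    have "n t $ i / n t $ k0 = n t0 $ i / n t0 $ k0" for i
    proof -
      have "((\<lambda>t. n t $ i / n t $ k0) has_field_derivative 0) (at s within ball t0 \<epsilon>)" if s: "s \<in> ball t0 \<epsilon>" for s
      proof -
        have s': "s \<in> D" "b = c \<or> x s \<noteq> 0" "w s \<in> ball w0 r" "n s $ k0 \<noteq> 0" using \<epsilon>(2)[OF s] by auto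
        from has_field_derivative_vector_quotient[OF n'[OF s'(1-3)] n'[OF s'(1-3)] s'(4), of i]
        show ?thesis using s'(4) by (auto intro: has_field_derivative_at_within)
      qed
      then obtain z where "\<And>s. s \<in> ball t0 \<epsilon> \<Longrightarrow> n s $ i / n s $ k0 = z"
        using has_field_derivative_zero_constant[OF convex_ball, of t0 \<epsilon> "\<lambda>t. n t $ i / n t $ k0"] by blast
      then show ?thesis using t \<epsilon>(1) by simp
    qed
    then have n_par: "n t = (n t $ k0 / n t0 $ k0) *s n t0"
      using \<epsilon>(2)[OF t] k0 by (simp add: vec_eq_iff field_simps)
    have wt: "w t \<in> ball w0 r" using \<epsilon>(2)[OF t] by simp
    define \<mu> where "\<mu> = n t $ k0 / n t0 $ k0 / \<kappa>"
    have "n t = \<mu> *s v" using n_par \<kappa>(1) unfolding v_n \<mu>_def by (simp add: vector_smult_assoc)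
    then have "l t = \<mu> *s (\<Phi> (w t) *v v)"
      using \<Phi>\<Psi>_vec[OF wt, of "l t"] by (simp add: n_def[symmetric] vector_scalar_commute)
    moreover have "\<mu> \<noteq> 0" using \<epsilon>(2)[OF t] k0 \<kappa>(1) by (simp add: \<mu>_def)
    ultimately have "abs_cp2 (l t) = abs_cp2 (\<Phi> (w t) *v v)"
      using abs_cp2_scale[OF \<Phi>_nonzero[OF wt v]] by simp
    moreover have "base_chart b (\<gamma> t $ 1) = base_chart c (w t)"
      using \<epsilon>(2)[OF t] by (simp add: w_def x_def base_chart_trans)
    ultimately show ?thesis by (simp add: sheet_def std_chart_def l_def)
  qed
  have holw: "w holomorphic_on ball t0 \<epsilon>"
    unfolding holomorphic_on_open[OF open_ball] using w' \<epsilon>(2) by blast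
  \<comment> \<open>Transversality makes the base coordinate a local parameter on the arc, so a
    piece of the arc projects onto an open set.\<close>
  have "deriv w t0 \<noteq> 0"
    using DERIV_imp_deriv[OF w'[OF t0(1) base0(1)]] Y1(1)[OF t0(1) base0(1) w1'] base_dtrans_nonzero[OF base0(1)] by simp
  then obtain \<rho> where \<rho>: "\<rho> > 0" "ball t0 \<rho> \<subseteq> ball t0 \<epsilon>" "open (w ` ball t0 \<rho>)"
    using has_complex_derivative_locally_invertible[OF holw _ open_ball, of t0] \<epsilon>(1) by auto
  have "w1 \<in> w ` ball t0 \<rho>" using base0 \<rho>(1) by (auto intro!: image_eqI[of _ _ t0])
  moreover have "w ` ball t0 \<rho> \<subseteq> ball w0 r" using \<epsilon>(2) \<rho>(2) by auto
  moreover have "sheet v (w t) \<in> P" if t: "t \<in> ball t0 \<rho>" for t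
  proof -
    have t': "t \<in> ball t0 \<epsilon>" using t \<rho>(2) by auto
    then have "t \<in> D" using \<epsilon>(2) by auto
    then show ?thesis using on_sheet[OF t'] unfolding PD \<phi> by force
  qed
  ultimately show ?thesis using \<rho>(3) by (intro exI[of _ "w ` ball t0 \<rho>"]) auto
qed

text \<open>The sheets are indexed by all nonzero vectors. Two that meet over \<open>w\<close>
  coincide, because \<open>\<Psi> w\<close> carries the proportionality of
  \<open>\<Phi> w *v v\<close> and \<open>\<Phi> w *v v'\<close> back to \<open>v\<close> and
  \<open>v'\<close>.\<close>

lemma flow_box_sheets:
  "\<exists>S. flow_box (integral_arcs G) sphere_top fst (base_chart c ` ball w0 r) S"
proof -
  define coord where "coord = inv (base_chart c)"
  have coord: "coord (base_chart c w) = w" for w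
    unfolding coord_def by (rule inv_f_f) (simp add: inj_def)
  let ?V = "base_chart c ` ball w0 r"
  define S where "S = {\<lambda>p. sheet v (coord p) | v. v \<noteq> 0}"
  have S: "\<exists>v. v \<noteq> 0 \<and> s = (\<lambda>p. sheet v (coord p))" if "s \<in> S" for s
    using that by (auto simp: S_def)
  have f1: "openin sphere_top ?V" by (rule openin_sphere_base_chart_image) simp
  have f2: "connectedin sphere_top ?V" by (rule connectedin_sphere_base_chart_image) simp
  have f3: "fst (s p) = p" if sp: "s \<in> S" "p \<in> ?V" for s p
  proof -
    obtain v w where "s = (\<lambda>p. sheet v (coord p))" "p = base_chart c w" using S[OF sp(1)] sp(2) by auto
    then show ?thesis by (simp add: sheet_def coord)
  qed
  have f4: "\<exists>s\<in>S. s (fst q) = q" if q: "fst q \<in> ?V" for q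
  proof -
    obtain w where w: "w \<in> ball w0 r" "fst q = base_chart c w" using q by auto
    obtain L where L: "snd q = abs_cp2 L" "L \<noteq> 0" by (rule cp2_cases)
    have "(\<lambda>p. sheet (\<Psi> w *v L) (coord p)) \<in> S" using \<Psi>_nonzero[OF w(1) L(2)] by (auto simp: S_def)
    moreover have "sheet (\<Psi> w *v L) (coord (fst q)) = q"
      using w L \<Phi>\<Psi>_vec[OF w(1)] by (simp add: sheet_def coord prod_eq_iff)
    ultimately show ?thesis by (intro bexI[of _ "\<lambda>p. sheet (\<Psi> w *v L) (coord p)"])
  qed
  have f5: "s y = s' y" if st: "s \<in> S" "s' \<in> S" "s x = s' x" "x \<in> ?V" "y \<in> ?V" for s s' x y
  proof -
    obtain v v' where v: "v \<noteq> 0" "v' \<noteq> 0" "s = (\<lambda>p. sheet v (coord p))" "s' = (\<lambda>p. sheet v' (coord p))"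
      using S[OF st(1)] S[OF st(2)] by auto
    obtain w z where w: "w \<in> ball w0 r" "x = base_chart c w" "z \<in> ball w0 r" "y = base_chart c z" using st by auto
    have "abs_cp2 (\<Phi> w *v v) = abs_cp2 (\<Phi> w *v v')" using st(3) by (simp add: v w coord sheet_def)
    then obtain k where k: "k \<noteq> 0" "\<Phi> w *v v' = k *s (\<Phi> w *v v)"
      using abs_cp2_eq_iff \<Phi>_nonzero w v by auto
    have "v' = k *s v"
      using \<Psi>\<Phi>_vec[OF w(1), of v'] \<Psi>\<Phi>_vec[OF w(1), of v] by (simp add: k vector_scalar_commute)
    then have "\<Phi> z *v v' = k *s (\<Phi> z *v v)" by (simp add: vector_scalar_commute)
    then have "abs_cp2 (\<Phi> z *v v') = abs_cp2 (\<Phi> z *v v)"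
      using abs_cp2_scale[OF \<Phi>_nonzero[OF w(3) v(1)] k(1)] by simp
    then show ?thesis by (simp add: v w coord sheet_def)
  qed
  have f6: "\<exists>P\<in>integral_arcs G. s x \<in> P \<and> P \<subseteq> s ` W"
    if st: "s \<in> S" "x \<in> ?V" "openin sphere_top W" "x \<in> W" "W \<subseteq> ?V" for s x W
  proof -
    obtain v where v: "v \<noteq> 0" "s = (\<lambda>p. sheet v (coord p))" using S[OF st(1)] by auto
    let ?W = "{w. base_chart c w \<in> W}"
    obtain w where w: "x = base_chart c w" "w \<in> ball w0 r" using st(2) by auto
    have "open ?W" using st(3) by (simp add: openin_sphere_iff)
    moreover have "?W \<subseteq> ball w0 r" using st(5) by (auto simp: subset_eq image_iff)
    ultimately obtain P where P: "P \<in> integral_arcs G" "sheet v w \<in> P" "P \<subseteq> sheet v ` ?W"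
      using sheet_contains_arc[OF v(1), of ?W w] st(4) w by auto
    moreover have "sheet v ` ?W \<subseteq> s ` W"
    proof
      fix q assume "q \<in> sheet v ` ?W"
      then obtain w where "base_chart c w \<in> W" "q = s (base_chart c w)" by (auto simp: v coord)
      then show "q \<in> s ` W" by simp
    qed
    moreover have "s x = sheet v w" by (simp add: v w coord)
    ultimately show ?thesis by (intro bexI[of _ P]) auto
  qed
  have f7: "\<exists>W. openin sphere_top W \<and> x \<in> W \<and> W \<subseteq> ?V \<and> s ` W \<subseteq> P"
    if st: "s \<in> S" "x \<in> ?V" "P \<in> integral_arcs G" "s x \<in> P" for s x P
  proof -
    obtain v where v: "v \<noteq> 0" "s = (\<lambda>p. sheet v (coord p))" using S[OF st(1)] by auto
    obtain w where w: "x = base_chart c w" "w \<in> ball w0 r" using st(2) by auto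
    have "sheet v w \<in> P" using st(4) by (simp add: v w coord)
    then obtain W where W: "open W" "w \<in> W" "W \<subseteq> ball w0 r" "sheet v ` W \<subseteq> P"
      using arc_contains_sheet_piece[OF v(1) w(2) st(3)] by auto
    have "openin sphere_top (base_chart c ` W)" by (rule openin_sphere_base_chart_image[OF W(1)])
    moreover have "s ` base_chart c ` W \<subseteq> P" using W(4) by (auto simp: v coord)
    ultimately show ?thesis using W w by (intro exI[of _ "base_chart c ` W"]) auto
  qed
  show ?thesis
    unfolding flow_box_def
    by (intro exI[of _ S] conjI ballI allI impI f1 f2 f3 f4 f6 f7; (elim conjE)?; (assumption | rule f5, assumption+))
qed

end

section \<open>Exceptional fibres\<close>

text \<open>The line through \<open>v\<close> parallel to the base direction. One-variable function
  theory is applied along these lines.\<close>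

definition slice :: "complex^3 \<Rightarrow> complex \<Rightarrow> complex^3" where
  "slice v z = v + axis 1 z"

lemma slice_nth [simp]: "slice v z $ 1 = v $ 1 + z" "slice v z $ 2 = v $ 2" "slice v z $ 3 = v $ 3"
  by (simp_all add: slice_def axis_def)

lemma norm_axis_complex: "norm (axis k z :: complex^3) = norm z"
  using exhaust_3[of k] by (auto simp: norm_vec_def L2_set_def axis_def sum_3)

lemma dist_slice: "dist (slice v z) u \<le> dist v u + norm z"
  using norm_triangle_ineq[of "v - u" "axis 1 z"] by (simp add: slice_def dist_norm algebra_simps norm_axis_complex)

lemma slice_has_field_derivative:
  "((\<lambda>z. slice v z $ k) has_field_derivative (axis 1 1 :: complex^3) $ k) (at z)"
  using exhaust_3[of k] by (auto simp: axis_def intro!: derivative_eq_intros)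

lemma holo_fun_slice_differentiable:
  "holo_fun f U \<Longrightarrow> slice v z \<in> U \<Longrightarrow> (\<lambda>z. f (slice v z)) field_differentiable at z"
  by (rule holo_fun_compose_curve[OF _ _ slice_has_field_derivative])

lemma holo_fun_slice_holomorphic:
  assumes "holo_fun f U" "\<And>z. z \<in> S \<Longrightarrow> slice v z \<in> U"
  shows "(\<lambda>z. f (slice v z)) holomorphic_on S"
  unfolding holomorphic_on_def
proof
  fix z assume "z \<in> S"
  show "(\<lambda>z. f (slice v z)) field_differentiable at z within S"
    by (rule field_differentiable_at_within[OF holo_fun_slice_differentiable[OF assms(1) assms(2)[OF \<open>z \<in> S\<close>]]])
qed

lemma holo_fun_fst:
  assumes "\<And>z. (g has_field_derivative g' z) (at z)"
  shows "holo_fun (\<lambda>v. g (v$1)) U"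
  unfolding holo_fun_def
proof
  fix v :: "complex^3" assume "v \<in> U"
  have "((\<lambda>v. g (v$1)) has_derivative (\<lambda>h. g' (v$1) * h$1)) (at v)"
    by (rule has_derivative_compose[OF bounded_linear_imp_has_derivative[OF bounded_linear_vec_nth]
      assms[unfolded has_field_derivative_def]])
  then show "\<exists>D. ((\<lambda>v. g (v$1)) has_derivative D) (at v) \<and> (\<forall>c h. D (c *s h) = c * D h)"
    by (intro exI[of _ "\<lambda>h. g' (v$1) * h$1"]) auto
qed

text \<open>In each chart one polynomial in the base coordinate, with the excluded values as its
  roots, is a global equation.\<close>

lemma analytic_subset_finite:
  assumes "finite (- B)" shows "analytic_subset (fst -` (- B))"
  unfolding analytic_subset_def
proof (intro ballI allI)
  fix \<phi> v assume "\<phi> \<in> total_charts"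
  then obtain b j where \<phi>: "\<phi> = std_chart b j" by (auto simp: total_charts_eq)
  define A where "A = {w. base_chart b w \<in> - B}"
  have "finite A"
    unfolding A_def using finite_vimageI[OF assms, of "base_chart b"] by (simp add: inj_def vimage_def)
  define g where "g z = (\<Prod>a\<in>A. z - a)" for z
  have "g field_differentiable at z" for z
    by (rule holomorphic_on_imp_differentiable_at[of g UNIV])
       (unfold g_def, auto intro!: holomorphic_on_prod holomorphic_intros)
  then obtain g' where g': "\<And>z. (g has_field_derivative g' z) (at z)"
    unfolding field_differentiable_def by metis
  have "g z = 0 \<longleftrightarrow> base_chart b z \<in> - B" for z
    unfolding g_def using \<open>finite A\<close> by (auto simp: A_def)
  then have "{u \<in> UNIV. \<phi> u \<in> fst -` (- B)} = {u \<in> UNIV. \<forall>f\<in>{\<lambda>v. g (v$1)}. f u = 0}"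
    by (auto simp: \<phi> std_chart_def)
  then show "\<exists>U fs. open U \<and> v \<in> U \<and> finite fs \<and> (\<forall>f\<in>fs. holo_fun f U) \<and>
        {u\<in>U. \<phi> u \<in> fst -` (- B)} = {u\<in>U. \<forall>f\<in>fs. f u = 0}"
    using holo_fun_fst[OF g', of UNIV] by (intro exI[of _ UNIV] exI[of _ "{\<lambda>v. g (v$1)}"]) simp
qed

text \<open>A union of fibres is known from a disc transverse to them, here the one through
  \<open>(w0, 0, 0)\<close>. Restricted to it, either all defining equations vanish identically or
  one of them has isolated zeros.\<close>

lemma analytic_subset_local_dichotomy:
  assumes "analytic_subset (fst -` (- B))"
  shows "\<exists>e>0. (\<forall>w\<in>ball w0 e. base_chart c w \<notin> B) \<or> (\<forall>w\<in>ball w0 e - {w0}. base_chart c w \<in> B)"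
proof -
  define v0 :: "complex^3" where "v0 = axis 1 w0"
  have "std_chart c 1 \<in> total_charts" by (auto simp: total_charts_eq)
  from assms[unfolded analytic_subset_def, THEN bspec, OF this, THEN spec, of v0]
  obtain U fs where U: "open U" "v0 \<in> U" "finite fs" "\<forall>f\<in>fs. holo_fun f U"
    "{u\<in>U. std_chart c 1 u \<in> fst -` (- B)} = {u\<in>U. \<forall>f\<in>fs. f u = 0}"
    by (elim exE conjE) (rule that)
  obtain e where e: "e > 0" "ball v0 e \<subseteq> U" using U(1,2) open_contains_ball by blast
  have sl: "slice v0 z \<in> U" if "norm z < e" for z
    using dist_slice[of v0 z v0] that e(2) by (auto simp: subset_eq dist_commute)
  have iff: "base_chart c w \<notin> B \<longleftrightarrow> (\<forall>f\<in>fs. f (slice v0 (w - w0)) = 0)" if "w \<in> ball w0 e" for w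
  proof -
    have "slice v0 (w - w0) \<in> U" using sl[of "w - w0"] that by (simp add: dist_norm norm_minus_commute)
    moreover have "std_chart c 1 (slice v0 (w - w0)) \<in> fst -` (- B) \<longleftrightarrow> base_chart c w \<notin> B"
      by (simp add: std_chart_def v0_def axis_def)
    ultimately show ?thesis using U(5) by blast
  qed
  show ?thesis
  proof (cases "\<forall>f\<in>fs. \<forall>z\<in>ball 0 e. f (slice v0 z) = 0")
    case True
    then have "\<forall>w\<in>ball w0 e. base_chart c w \<notin> B"
      using iff by (auto simp: dist_norm norm_minus_commute)
    then show ?thesis using e(1) by blast
  next
    case False
    then obtain f \<beta> where f: "f \<in> fs" "\<beta> \<in> ball 0 e" "f (slice v0 \<beta>) \<noteq> 0" by blast
    have hol: "(\<lambda>z. f (slice v0 z)) holomorphic_on ball 0 e"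
      by (rule holo_fun_slice_holomorphic[OF bspec[OF U(4) f(1)]]) (use sl in auto)
    obtain r where r: "r > 0" "ball (0::complex) r \<subseteq> ball 0 e" "\<And>z. z \<in> ball 0 r - {0} \<Longrightarrow> f (slice v0 z) \<noteq> 0"
    proof (cases "f (slice v0 0) = 0")
      case True
      have "0 \<in> ball (0::complex) e" using e(1) by simp
      show ?thesis
      proof (rule isolated_zeros[OF hol open_ball connected_ball \<open>0 \<in> ball 0 e\<close> True f(2,3)])
        fix r assume "0 < r" "ball (0::complex) r \<subseteq> ball 0 e" "\<And>z. z \<in> ball 0 r - {0} \<Longrightarrow> f (slice v0 z) \<noteq> 0"
        then show thesis by (rule that)
      qed
    next
      case False
      have "isCont (\<lambda>z. f (slice v0 z)) 0"
        using holo_fun_slice_differentiable[OF bspec[OF U(4) f(1)] sl[of 0]] e(1) field_differentiable_imp_continuous_at by auto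
      then have "eventually (\<lambda>z. f (slice v0 z) \<noteq> 0) (nhds 0)" using False by (rule eventually_nonzero_nhds)
      then obtain r where r: "r > 0" "\<And>z. dist z 0 < r \<Longrightarrow> f (slice v0 z) \<noteq> 0"
        unfolding eventually_nhds_metric by auto
      show ?thesis by (rule that[of "min r e"]) (use r e(1) in auto)
    qed
    have "base_chart c w \<in> B" if "w \<in> ball w0 r - {w0}" for w
    proof -
      have "w - w0 \<in> ball 0 r - {0}" using that by (auto simp: dist_norm norm_minus_commute)
      then have "f (slice v0 (w - w0)) \<noteq> 0" "w - w0 \<in> ball 0 e" using r by blast+
      then show ?thesis using iff[of w] f(1) by (auto simp: dist_norm norm_minus_commute)
    qed
    then show ?thesis using r(1) by blast
  qed
qed

lemma analytic_subset_fibres_finite: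
  assumes an: "analytic_subset (fst -` (- B))" and ne: "fst -` (- B) \<noteq> (UNIV :: total set)"
  shows "finite (- B)"
proof -
  \<comment> \<open>The interior of the excluded set in chart \<open>c\<close>. By the dichotomy
    every other point has a punctured neighbourhood inside \<open>B\<close>, which makes
    \<open>N c\<close> open and closed.\<close>
  define N where "N c = {w. \<exists>e>0. \<forall>z\<in>ball w e. base_chart c z \<notin> B}" for c
  have punct: "\<exists>e>0. \<forall>z\<in>ball w e - {w}. base_chart c z \<in> B" if "w \<notin> N c" for w c
    using analytic_subset_local_dichotomy[OF an, of w c] that unfolding N_def by blast
  have "open (N c)" for c
  proof (rule openI)
    fix w assume "w \<in> N c"
    then obtain e where e: "e > 0" "\<forall>z\<in>ball w e. base_chart c z \<notin> B" unfolding N_def by auto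
    have "ball w e \<subseteq> N c"
    proof
      fix z assume "z \<in> ball w e"
      then obtain d where "d > 0" "ball z d \<subseteq> ball w e" by (rule openE[OF open_ball])
      then show "z \<in> N c" unfolding N_def using e by blast
    qed
    then show "\<exists>T>0. ball w T \<subseteq> N c" using e(1) by blast
  qed
  moreover have "open (- N c)" for c
  proof (rule openI)
    fix w assume "w \<in> - N c"
    then obtain e where e: "e > 0" "\<forall>z\<in>ball w e - {w}. base_chart c z \<in> B" using punct by blast
    have "z \<notin> N c" if z: "z \<in> ball w e" for z
    proof (cases "z = w")
      case True
      then show ?thesis using \<open>w \<in> - N c\<close> by simp
    next
      case False
      then have "base_chart c z \<in> B" using e z by blast
      then show ?thesis unfolding N_def by (auto intro!: bexI[of _ z])
    qed
    then show "\<exists>T>0. ball w T \<subseteq> - N c" using e(1) by blast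
  qed
  ultimately have N: "N c = {} \<or> N c = UNIV" for c
    using clopen[of "N c"] by (simp add: closed_open)
  have N_all: "base_chart c w \<notin> B" if "N c = UNIV" for c w
  proof -
    have "w \<in> N c" using that by simp
    then obtain e where "e > 0" "\<forall>z\<in>ball w e. base_chart c z \<notin> B" unfolding N_def by auto
    then show ?thesis by simp
  qed
  have "N c = {}" for c
  proof (rule ccontr)
    assume "N c \<noteq> {}"
    then have c: "N c = UNIV" using N by blast
    \<comment> \<open>The point 1 lies in the overlap of the two charts, so the exclusion of one
      whole chart spreads to the other.\<close>
    have "1 \<in> N (\<not> c)"
    proof (rule ccontr)
      assume "1 \<notin> N (\<not> c)"
      then obtain e where e: "e > 0" "\<forall>z\<in>ball 1 e - {1}. base_chart (\<not> c) z \<in> B" using punct by blast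
      \<comment> \<open>A point of the punctured disc with positive real part, hence nonzero and
        visible in chart \<open>c\<close>.\<close>
      define z :: complex where "z = 1 + of_real (e / 2)"
      have "Re z > 0" using e(1) by (simp add: z_def)
      then have "z \<noteq> 0" by auto
      have "z \<in> ball 1 e - {1}" using e(1) by (auto simp: z_def dist_norm)
      then have "base_chart (\<not> c) z \<in> B" using e by blast
      moreover have "base_chart (\<not> c) z = base_chart c (inverse z)" using \<open>z \<noteq> 0\<close> by (auto simp: base_chart_def)
      ultimately show False using N_all[OF c] by simp
    qed
    then have c': "N (\<not> c) = UNIV" using N by blast
    have "base_chart b w \<notin> B" for b w
      using N_all[OF c, of w] N_all[OF c', of w] by (cases "b = c") auto
    then have "p \<notin> B" for p using base_chart_cases[of p] by metis
    then show False using ne by auto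
  qed
  then have punct': "\<exists>e>0. \<forall>z\<in>ball w e - {w}. base_chart c z \<in> B" for w c using punct by blast
  have fin: "finite {w \<in> cball 0 1. base_chart c w \<notin> B}" for c
  proof (rule ccontr)
    let ?T = "{w \<in> cball 0 1. base_chart c w \<notin> B}"
    assume "infinite ?T"
    moreover have "?T \<subseteq> cball 0 1" by blast
    ultimately obtain x where x: "x islimpt ?T"
      using Heine_Borel_imp_Bolzano_Weierstrass[OF compact_cball] by blast
    obtain e where e: "e > 0" "\<forall>z\<in>ball x e - {x}. base_chart c z \<in> B" using punct' by blast
    obtain z where "z \<noteq> x" "dist z x < e" "base_chart c z \<notin> B"
      using x e(1) unfolding islimpt_approachable by blast
    then show False using e(2) by (auto simp: dist_commute)
  qed
  have "- B \<subseteq> (\<Union>c. base_chart c ` {w \<in> cball 0 1. base_chart c w \<notin> B})"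
  proof
    fix p assume p: "p \<in> - B"
    obtain c w where "p = base_chart c w" "norm w \<le> 1" by (rule base_chart_cases)
    then show "p \<in> (\<Union>c. base_chart c ` {w \<in> cball 0 1. base_chart c w \<notin> B})" using p by auto
  qed
  moreover have "finite (\<Union>c. base_chart c ` {w \<in> cball 0 1. base_chart c w \<notin> B})" using fin by auto
  ultimately show ?thesis by (rule finite_subset)
qed

lemma finite_complement_punctured:
  assumes "finite (- B)"
  shows "\<exists>e>0. \<forall>w\<in>ball w0 e - {w0}. base_chart c w \<in> B"
proof -
  have "finite {w. base_chart c w \<in> - B}"
    using finite_vimageI[OF assms, of "base_chart c"] by (simp add: inj_def vimage_def)
  from finite_set_avoid[OF this, of w0]
  obtain d where "d > 0" "\<forall>x\<in>{w. base_chart c w \<in> - B}. x \<noteq> w0 \<longrightarrow> d \<le> dist w0 x" by auto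
  then show ?thesis by (intro exI[of _ d]) fastforce
qed

section \<open>Comparing generators, and points of vertical tangency\<close>

lemma compatible_transition:
  assumes comp: "compatible (std_chart b i, U, Y) (std_chart c j, V, Z)"
    and uv: "u \<in> U" "v \<in> V" "std_chart c j v = std_chart b i u"
  obtains g where "g \<noteq> 0" "base_dtrans b c (u$1) * Y u $ 1 = g * Z v $ 1"
    "(dlift i (Y u) $ fst_idx j * fibre_lift i u $ j - fibre_lift i u $ fst_idx j * dlift i (Y u) $ j) / (fibre_lift i u $ j)^2 = g * Z v $ 2"
    "(dlift i (Y u) $ snd_idx j * fibre_lift i u $ j - fibre_lift i u $ snd_idx j * dlift i (Y u) $ j) / (fibre_lift i u $ j)^2 = g * Z v $ 3"
proof -
  have tr: "b = c \<or> u $ 1 \<noteq> 0" "fibre_lift i u $ j \<noteq> 0" using uv(3) by (auto simp: std_chart_transition_iff)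
  obtain g where g: "\<forall>u\<in>U. std_chart b i u \<in> std_chart c j ` V \<longrightarrow> g u \<noteq> 0 \<and>
      frechet_derivative (inv (std_chart c j) \<circ> std_chart b i) (at u) (Y u) = g u *s Z (inv (std_chart c j) (std_chart b i u))"
    using comp by auto
  have "std_chart b i u \<in> std_chart c j ` V" using uv by (metis imageI)
  then have *: "g u \<noteq> 0"
      "frechet_derivative (inv (std_chart c j) \<circ> std_chart b i) (at u) (Y u) = g u *s Z v"
    using g uv(1) by (simp_all add: uv(3)[symmetric] inv_std_chart)
  show ?thesis
    by (rule that[of "g u"])
      (use * in \<open>simp_all add: frechet_derivative_at[OF std_transition_has_derivative[OF tr], symmetric] vec3_eq_iff\<close>)
qed

text \<open>The pointwise part of transversality: a line complements the plane
  \<open>w$1 = 0\<close> exactly when it is spanned by a vector with nonzero first entry.\<close>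

definition transversal_over :: "generator set \<Rightarrow> complex option set \<Rightarrow> bool" where
  "transversal_over F B \<longleftrightarrow>
     (\<forall>b j U Y u. (std_chart b j, U, Y) \<in> F \<longrightarrow> u \<in> U \<longrightarrow> base_chart b (u$1) \<in> B \<longrightarrow> Y u $ 1 \<noteq> 0)"

text \<open>Singular points count as vertical, so that these are exactly the zeros of the base
  component.\<close>

definition vertical_at :: "generator set \<Rightarrow> total \<Rightarrow> bool" where
  "vertical_at F q \<longleftrightarrow> (\<exists>b j U Y u. (std_chart b j, U, Y) \<in> F \<and> u \<in> U \<and> std_chart b j u = q \<and> Y u $ 1 = 0)"

lemma foliation_generator_at:
  assumes "singular_foliation F"
  obtains b j U Y u where "(std_chart b j, U, Y) \<in> F" "u \<in> U" "std_chart b j u = q"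
proof -
  have "q \<in> (\<Union>(\<phi>, U, Y)\<in>F. \<phi> ` U)" using assms by (simp add: singular_foliation_def)
  then obtain \<phi> U Y u where *: "(\<phi>, U, Y) \<in> F" "u \<in> U" "\<phi> u = q" by auto
  have "is_generator (\<phi>, U, Y)" using assms *(1) unfolding singular_foliation_def by blast
  then have "\<phi> \<in> total_charts" by simp
  then obtain b j where "\<phi> = std_chart b j" by (auto simp: total_charts_eq)
  then show ?thesis using that * by blast
qed

lemma foliation_is_generator: "singular_foliation F \<Longrightarrow> H \<in> F \<Longrightarrow> is_generator H"
  by (simp add: singular_foliation_def)

text \<open>Chart changes rescale the base component by the nonzero \<open>base_dtrans\<close>, and
  generators differ by a nonzero factor, so its vanishing does not depend on the generator.\<close>

lemma vertical_at_iff: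
  assumes F: "singular_foliation F" and gen: "(std_chart b j, U, Y) \<in> F" "u \<in> U"
  shows "vertical_at F (std_chart b j u) \<longleftrightarrow> Y u $ 1 = 0"
proof
  assume "vertical_at F (std_chart b j u)"
  then obtain c i V Z v where *: "(std_chart c i, V, Z) \<in> F" "v \<in> V" "std_chart c i v = std_chart b j u" "Z v $ 1 = 0"
    unfolding vertical_at_def by auto
  have "compatible (std_chart b j, U, Y) (std_chart c i, V, Z)"
    using F gen(1) *(1) unfolding singular_foliation_def by blast
  then obtain g where "base_dtrans b c (u$1) * Y u $ 1 = g * Z v $ 1"
    using compatible_transition gen(2) *(2,3) by metis
  moreover have "base_dtrans b c (u$1) \<noteq> 0"
    using *(3) base_dtrans_nonzero by (auto simp: std_chart_transition_iff)
  ultimately show "Y u $ 1 = 0" using *(4) by simp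
next
  assume "Y u $ 1 = 0"
  then show "vertical_at F (std_chart b j u)"
    unfolding vertical_at_def using gen by (intro exI[of _ b] exI[of _ j] exI[of _ U] exI[of _ Y] exI[of _ u]) simp
qed

lemma transversal_overD:
  "transversal_over F B \<Longrightarrow> (std_chart b j, U, Y) \<in> F \<Longrightarrow> u \<in> U \<Longrightarrow> base_chart b (u$1) \<in> B \<Longrightarrow> Y u $ 1 \<noteq> 0"
  unfolding transversal_over_def by blast

text \<open>A zero of \<open>f\<close> on \<open>v$1 = u$1\<close> cannot disappear when the slice is moved: otherwise \<open>1/f\<close> would be
  holomorphic on the moved slices with bounded boundary values, against the maximum principle.\<close>

lemma zero_persists_across_slices:
  assumes f: "holo_fun f U" and U: "open U" "u \<in> U" and fu: "f u = 0"
    and nz: "\<And>v. v \<in> U \<Longrightarrow> v$1 \<noteq> u$1 \<Longrightarrow> dist (v$1) (u$1) < e \<Longrightarrow> f v \<noteq> 0" and e: "e > 0"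
  shows "\<exists>\<delta>>0. \<forall>v\<in>ball u \<delta>. v$1 = u$1 \<longrightarrow> f v = 0"
proof -
  obtain \<rho> where \<rho>: "\<rho> > 0" "cball u \<rho> \<subseteq> U" using U open_contains_cball by blast
  \<comment> \<open>\<open>r < e\<close> keeps the circle over base points where \<open>nz\<close>
    applies; half of \<rho> leaves room for moving the centre of the slice.\<close>
  define r where "r = min (e/2) (\<rho>/2)"
  have r: "r > 0" "r < e" "r \<le> \<rho>/2" using e \<rho>(1) by (auto simp: r_def)
  have sl: "slice v z \<in> cball u \<rho>" if "dist v u \<le> \<rho>/2" "norm z \<le> r" for v z
    using dist_slice[of v z u] that r by (simp add: dist_commute)
  have fcont: "continuous_on (cball u \<rho>) f"
    by (intro continuous_at_imp_continuous_on ballI holo_fun_isCont[OF f]) (use \<rho> in auto)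
  have slcont: "continuous_on S (\<lambda>z. f (slice v z))" if "dist v u \<le> \<rho>/2" "S \<subseteq> cball 0 r" for S v
    by (intro holomorphic_on_imp_continuous_on holo_fun_slice_holomorphic[OF f])
       (use sl[OF that(1)] that(2) \<rho>(2) in \<open>auto simp: subset_eq\<close>)
  have "\<exists>z0\<in>sphere 0 r. \<forall>z\<in>sphere 0 r. norm (f (slice u z0)) \<le> norm (f (slice u z))"
    using r(1) \<rho>(1) by (intro continuous_attains_inf continuous_on_norm slcont) auto
  then obtain z0 where z0: "norm z0 = r" "\<And>z. norm z = r \<Longrightarrow> norm (f (slice u z0)) \<le> norm (f (slice u z))" by auto
  define m where "m = norm (f (slice u z0))"
  have "f (slice u z0) \<noteq> 0"
    by (rule nz) (use sl[of u z0] z0(1) r \<rho> in \<open>auto simp: dist_norm\<close>)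
  then have m: "m > 0" by (simp add: m_def)
  \<comment> \<open>Uniform continuity carries the lower bound \<open>m\<close> on the boundary
    circle of the slice through \<open>u\<close> to \<open>m/2\<close> on nearby slices.\<close>
  have "uniformly_continuous_on (cball u \<rho>) f" by (rule compact_uniformly_continuous[OF fcont compact_cball])
  then obtain d where d: "d > 0" "\<And>x y. x \<in> cball u \<rho> \<Longrightarrow> y \<in> cball u \<rho> \<Longrightarrow> dist x y < d \<Longrightarrow> dist (f x) (f y) < m/2"
    unfolding uniformly_continuous_on_def using m by (metis half_gt_zero)
  have "f v = 0" if v: "v \<in> ball u (min d (\<rho>/2))" "v$1 = u$1" for v
  proof (rule ccontr)
    assume fv: "f v \<noteq> 0"
    have dv: "dist v u \<le> \<rho>/2" "dist v u < d" using v by (auto simp: dist_commute)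
    have F_nz: "f (slice v z) \<noteq> 0" if "z \<in> cball 0 r" for z
    proof (cases "z = 0")
      case True
      have "slice v 0 = v" by (simp add: vec3_eq_iff)
      then show ?thesis using fv True by simp
    next
      case False
      show ?thesis
        by (rule nz) (use sl[OF dv(1), of z] that False v(2) r \<rho>(2) in \<open>auto simp: dist_norm\<close>)
    qed
    have bd: "norm (1 / f (slice v z)) \<le> 2 / m" if "norm z = r" for z
    proof -
      have "dist (slice v z) (slice u z) < d" using dv(2) by (simp add: slice_def dist_norm)
      then have "dist (f (slice v z)) (f (slice u z)) < m/2"
        using d(2) sl[OF dv(1), of z] sl[of u z] \<rho>(1) that by simp
      moreover have "m \<le> norm (f (slice u z))" using z0(2)[OF that] by (simp add: m_def)
      ultimately have "norm (f (slice v z)) \<ge> m/2"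
        using norm_triangle_ineq2[of "f (slice u z)" "f (slice v z)"] by (simp add: dist_norm norm_minus_commute)
      then have "1 / norm (f (slice v z)) \<le> 1 / (m/2)" using m by (intro divide_left_mono mult_pos_pos) auto
      then show ?thesis by (simp add: norm_divide)
    qed
    have "norm (1 / f (slice v 0)) \<le> 2 / m"
    proof (rule maximum_modulus_frontier[of "\<lambda>z. 1 / f (slice v z)" "cball 0 r"])
      show "(\<lambda>z. 1 / f (slice v z)) holomorphic_on interior (cball 0 r)"
        using F_nz sl[OF dv(1)] \<rho>(2)
        by (intro holomorphic_on_divide holo_fun_slice_holomorphic[OF f]) (auto simp: subset_eq)
      show "continuous_on (closure (cball 0 r)) (\<lambda>z. 1 / f (slice v z))"
        using F_nz slcont[OF dv(1), of "cball 0 r"] by (intro continuous_on_divide) auto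
    qed (use bd r in auto)
    moreover have "slice v 0 = v" by (simp add: vec3_eq_iff)
    ultimately have "1 / norm (f v) \<le> 2 / m" by (simp add: norm_divide)
    then have "m / 2 \<le> norm (f v)" using m fv by (simp add: field_simps)
    moreover have "dist (f v) (f u) < m/2" using d(2)[of v u] dv \<rho>(1) by (simp add: dist_commute)
    ultimately show False using fu by (simp add: dist_norm)
  qed
  then show ?thesis using d(1) \<rho>(1) by (intro exI[of _ "min d (\<rho>/2)"]) auto
qed

lemma isCont_std_coords:
  fixes L :: "real \<Rightarrow> complex^3"
  assumes "isCont L t" "L t $ j \<noteq> 0"
  shows "isCont (\<lambda>t. std_coords w j (L t)) t"
proof (rule isCont_vec)
  fix k
  have nth: "isCont (\<lambda>t. L t $ i) t" for i using assms(1) by (intro continuous_intros)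
  have "isCont (\<lambda>t. L t $ i / L t $ j) t" for i by (rule isCont_divide[OF nth nth assms(2)])
  then show "isCont (\<lambda>t. std_coords w j (L t) $ k) t"
    using exhaust_3[of k] by (elim disjE) simp_all
qed

text \<open>Two points of the fibre are joined by a real line of homogeneous vectors. The parameters
  with a vertical point form an open set because zeros persist along the fibre, and a closed set by
  continuity.\<close>

lemma vertical_fibre_dichotomy:
  assumes F: "singular_foliation F" and fin: "finite (- B)" and tr: "transversal_over F B"
    and q0: "vertical_at F (p, q0)"
  shows "vertical_at F (p, q)"
proof -
  obtain L0 where L0: "q0 = abs_cp2 L0" "L0 \<noteq> 0" by (rule cp2_cases)
  obtain L1 where L1: "q = abs_cp2 L1" "L1 \<noteq> 0" by (rule cp2_cases)
  show ?thesis
  proof (cases "\<exists>k. k \<noteq> 0 \<and> L1 = k *s L0")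
    case True
    then have "q = q0" using abs_cp2_eq_iff[OF L0(2) L1(2)] L0 L1 by auto
    then show ?thesis using q0 by simp
  next
    case False
    \<comment> \<open>The line misses the origin because \<open>L0\<close> and \<open>L1\<close> are
      not proportional.\<close>
    define L :: "real \<Rightarrow> complex^3" where "L t = (1 - t) *\<^sub>R L0 + t *\<^sub>R L1" for t
    have Lnz: "L t \<noteq> 0" for t
    proof
      assume 0: "L t = 0"
      show False
      proof (cases "t = 0")
        case True
        then show False using 0 L0(2) by (simp add: L_def)
      next
        case t: False
        have "L1 = complex_of_real (- (1 - t) / t) *s L0"
        proof -
          have "(1 - t) *\<^sub>R (L0 $ k) + t *\<^sub>R (L1 $ k) = 0" for k
            using arg_cong[OF 0, of "\<lambda>v. v $ k"] by (simp add: L_def)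
          then have "of_real (1 - t) * L0 $ k + of_real t * L1 $ k = 0" for k
            by (simp add: scaleR_conv_of_real)
          then have "of_real t * L1 $ k = - (of_real (1 - t) * L0 $ k)" for k
            by (simp only: eq_neg_iff_add_eq_0 add.commute)
          then have "L1 $ k * of_real t = - (of_real (1 - t) * L0 $ k)" for k
            by (simp only: mult.commute[of "L1 $ k"])
          then have "L1 $ k = - (of_real (1 - t) * L0 $ k) / of_real t" for k
            using t by (subst nonzero_eq_divide_eq) simp_all
          then show ?thesis by (simp add: vec_eq_iff left_diff_distrib)
        qed
        moreover have "complex_of_real (- (1 - t) / t) \<noteq> 0"
        proof
          assume "complex_of_real (- (1 - t) / t) = 0"
          then have "L1 = 0" using calculation by simp
          then show False using L1(2) by simp
        qed
        ultimately show False using False by blast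
      qed
    qed
    have Lcont: "isCont L t" for t unfolding L_def by (intro continuous_intros)
    define Z where "Z = {t. vertical_at F (p, abs_cp2 (L t))}"
    have local: "eventually (\<lambda>t. t \<in> Z \<longleftrightarrow> t0 \<in> Z) (nhds t0)" for t0
    proof -
      obtain b j U Y u where gen: "(std_chart b j, U, Y) \<in> F" "u \<in> U" "std_chart b j u = (p, abs_cp2 (L t0))"
        by (rule foliation_generator_at[OF F])
      have Y: "open U" "holo_field Y U" using foliation_is_generator[OF F gen(1)] by auto
      then have Y1: "holo_fun (\<lambda>v. Y v $ 1) U" by (simp add: holo_field_def)
      have p: "p = base_chart b (u$1)" using gen(3) by (simp add: std_chart_def)
      have u: "L t0 $ j \<noteq> 0" "u = std_coords (u$1) j (L t0)"
        using gen(3) std_chart_eq_iff[OF Lnz, of b j u "u$1" t0] unfolding p by auto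
      define S where "S t = std_coords (u$1) j (L t)" for t
      have "isCont S t0" unfolding S_def by (rule isCont_std_coords[OF Lcont u(1)])
      have St0: "S t0 = u" using u(2) by (simp add: S_def)
      have "isCont (\<lambda>t. L t $ j) t0" using Lcont by (intro continuous_intros)
      then have ev1: "eventually (\<lambda>t. L t $ j \<noteq> 0) (nhds t0)" using u(1) by (rule eventually_nonzero_nhds)
      have ev2: "eventually (\<lambda>t. S t \<in> U) (nhds t0)"
        by (rule eventually_nhds_isCont_open[OF \<open>isCont S t0\<close> Y(1)]) (simp add: St0 gen(2))
      have iff: "t \<in> Z \<longleftrightarrow> Y (S t) $ 1 = 0" if "L t $ j \<noteq> 0" "S t \<in> U" for t
      proof -
        have "std_chart b j (S t) = (p, abs_cp2 (L t))"
          unfolding S_def p using that(1) Lnz by (simp add: std_chart_std_coords)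
        then show ?thesis using vertical_at_iff[OF F gen(1) that(2)] by (simp add: Z_def)
      qed
      have t0: "t0 \<in> Z \<longleftrightarrow> Y u $ 1 = 0" using iff[of t0] u(1) gen(2) St0 by simp
      have "eventually (\<lambda>t. Y (S t) $ 1 = 0 \<longleftrightarrow> t0 \<in> Z) (nhds t0)"
      proof (cases "t0 \<in> Z")
        case True
        obtain e where e: "e > 0" "\<forall>w\<in>ball (u$1) e - {u$1}. base_chart b w \<in> B"
          using finite_complement_punctured[OF fin] by blast
        have "\<exists>\<delta>>0. \<forall>v\<in>ball u \<delta>. v$1 = u$1 \<longrightarrow> Y v $ 1 = 0"
        proof (rule zero_persists_across_slices[OF Y1 Y(1) gen(2) _ _ e(1)])
          show "Y u $ 1 = 0" using True t0 by simp
          fix v assume v: "v \<in> U" "v$1 \<noteq> u$1" "dist (v$1) (u$1) < e"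
          then have "base_chart b (v$1) \<in> B" using e(2) by (auto simp: dist_commute)
          then show "Y v $ 1 \<noteq> 0" by (rule transversal_overD[OF tr gen(1) v(1)])
        qed
        then obtain \<delta> where \<delta>: "\<delta> > 0" "\<And>v. v \<in> ball u \<delta> \<Longrightarrow> v$1 = u$1 \<Longrightarrow> Y v $ 1 = 0" by auto
        have "eventually (\<lambda>t. S t \<in> ball u \<delta>) (nhds t0)"
          by (rule eventually_nhds_isCont_open[OF \<open>isCont S t0\<close> open_ball]) (simp add: St0 \<delta>(1))
        then show ?thesis by eventually_elim (use True \<delta>(2) in \<open>auto simp: S_def\<close>)
      next
        case False
        have "isCont (\<lambda>v. Y v $ 1) (S t0)" using holo_fun_isCont[OF Y1 gen(2)] by (simp add: St0)
        with \<open>isCont S t0\<close> have "isCont (\<lambda>t. Y (S t) $ 1) t0" by (rule isCont_o2)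
        then have "eventually (\<lambda>t. Y (S t) $ 1 \<noteq> 0) (nhds t0)"
          using False t0 by (intro eventually_nonzero_nhds) (auto simp: St0)
        then show ?thesis by eventually_elim (use False in auto)
      qed
      then show ?thesis using ev1 ev2 by eventually_elim (use iff in auto)
    qed
    have "open Z"
    proof (rule open_eventuallyI)
      fix t assume "t \<in> Z"
      then show "eventually (\<lambda>y. y \<in> Z) (nhds t)" using local[of t] by (auto elim: eventually_mono)
    qed
    moreover have "open (- Z)"
    proof (rule open_eventuallyI)
      fix t assume "t \<in> - Z"
      then show "eventually (\<lambda>y. y \<in> - Z) (nhds t)" using local[of t] by (auto elim: eventually_mono)
    qed
    ultimately have "Z = {} \<or> Z = UNIV" using clopen[of Z] by (simp add: closed_open)
    moreover have "0 \<in> Z" using q0 by (simp add: Z_def L_def L0)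
    ultimately have "1 \<in> Z" by auto
    then show ?thesis by (simp add: Z_def L_def L1)
  qed
qed

section \<open>Invariant fibres\<close>

text \<open>The Schwarz lemma on slices. It yields the estimate that a factorisation of
  \<open>f\<close> by \<open>v$1 - u$1\<close> would give, without constructing the
  quotient.\<close>

lemma vanishing_on_slice_bound:
  assumes f: "holo_fun f U" and U: "open U" "u \<in> U" and z: "\<And>v. v \<in> U \<Longrightarrow> v$1 = u$1 \<Longrightarrow> f v = 0"
  obtains C \<delta> where "\<delta> > 0" "C > 0" "\<And>v. v \<in> ball u \<delta> \<Longrightarrow> norm (f v) \<le> C * norm (v$1 - u$1)"
proof -
  obtain \<rho> where \<rho>: "\<rho> > 0" "cball u \<rho> \<subseteq> U" using U open_contains_cball by blast
  have "continuous_on (cball u \<rho>) f"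
    by (intro continuous_at_imp_continuous_on ballI holo_fun_isCont[OF f]) (use \<rho> in auto)
  then have "bounded (f ` cball u \<rho>)" by (intro compact_imp_bounded compact_continuous_image) auto
  then obtain K0 where "\<forall>w\<in>f ` cball u \<rho>. norm w \<le> K0" unfolding bounded_iff by blast
  then have K0: "norm (f v) \<le> K0" if "v \<in> cball u \<rho>" for v using that by simp
  \<comment> \<open>The summand 1 gives the strict bound that the Schwarz lemma requires.\<close>
  define K where "K = \<bar>K0\<bar> + 1"
  have K: "K > 0" "\<And>v. v \<in> cball u \<rho> \<Longrightarrow> norm (f v) < K" using K0 unfolding K_def by force+
  show ?thesis
  \<comment> \<open>For \<open>v\<close> within \<rho>/4 of \<open>u\<close>, its foot
    \<open>v0\<close> on the fibre lies within \<rho>/2, so the slice of radius \<rho>/2 around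
    \<open>v0\<close> stays in the ball. Rescaling this radius and the bound \<open>K\<close> to 1
    produces the constant \<open>K * 2 / \<rho>\<close>.\<close>
  proof (rule that[of "\<rho>/4" "K * 2 / \<rho>"])
    fix v assume v: "v \<in> ball u (\<rho>/4)"
    define d where "d = v$1 - u$1"
    define v0 where "v0 = slice v (- d)"
    have v0: "v0$1 = u$1" "slice v0 d = v" by (simp_all add: v0_def d_def vec3_eq_iff)
    have d: "norm d < \<rho>/4"
      using v Finite_Cartesian_Product.norm_nth_le[of "v - u" 1]
      by (simp add: d_def dist_norm norm_minus_commute)
    have "dist v0 u \<le> dist v u + norm d" unfolding v0_def using dist_slice[of v "-d" u] by simp
    then have "dist v0 u < \<rho>/2" using v d by (simp add: dist_commute)
    then have sl: "slice v0 z \<in> cball u \<rho>" if "norm z < \<rho>/2" for z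
      using dist_slice[of v0 z u] that by (simp add: dist_commute)
    define h where "h z = f (slice v0 (of_real (\<rho>/2) * z)) / of_real K" for z
    have small: "norm (of_real (\<rho>/2) * z) < \<rho>/2" if "norm z < 1" for z :: complex
      using that \<rho>(1) by (simp add: norm_mult)
    have h1: "h holomorphic_on ball 0 1"
    proof -
      have "(\<lambda>w. f (slice v0 w)) holomorphic_on ball 0 (\<rho>/2)"
        by (rule holo_fun_slice_holomorphic[OF f]) (use sl \<rho>(2) in auto)
      then have "((\<lambda>w. f (slice v0 w)) \<circ> (\<lambda>z. of_real (\<rho>/2) * z)) holomorphic_on ball 0 1"
        by (rule holomorphic_on_compose_gen[rotated]) (use small in \<open>auto intro!: holomorphic_intros\<close>)
      then show ?thesis unfolding h_def[abs_def] using K(1) by (auto simp: o_def intro!: holomorphic_intros)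
    qed
    have h2: "norm (h z) < 1" if "norm z < 1" for z
      using K(2)[OF sl[OF small[OF that]]] K(1) by (simp add: h_def norm_divide)
    have h3: "h 0 = 0"
    proof -
      have "slice v0 0 \<in> U" using sl[of 0] \<rho> by auto
      then show ?thesis using z[of "slice v0 0"] v0(1) by (simp add: h_def)
    qed
    have h4: "norm (d / of_real (\<rho>/2)) < 1" using d \<rho>(1) by (simp add: norm_divide)
    have "norm (h (d / of_real (\<rho>/2))) \<le> norm (d / of_real (\<rho>/2))"
      by (rule Schwarz_Lemma(1)[OF h1 h3 h2 h4])
    then have "norm (f v) / K \<le> norm d / (\<rho>/2)"
      using \<rho>(1) K(1) v0(2) by (simp add: h_def norm_divide)
    then show "norm (f v) \<le> K * 2 / \<rho> * norm (v$1 - u$1)"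
      using \<rho>(1) K(1) by (simp add: d_def field_simps)
  qed (use \<rho>(1) K(1) in auto)
qed

text \<open>A uniqueness argument. The offset \<open>x\<close> from the fibre has derivative
  \<open>f (\<gamma> s)\<close> of norm at most \<open>C * norm (x s)\<close>. On a disc of radius
  \<epsilon> with \<open>C * \<epsilon> \<le> 1/2\<close> the maximum of \<open>norm (x s)\<close>
  is then at most half of itself. So the zeros of \<open>x\<close> are open and closed in the
  connected time domain.\<close>

lemma solution_stays_in_vertical_slice:
  assumes f: "holo_fun f U" and U: "open U" and z: "\<And>v. v \<in> U \<Longrightarrow> v$1 = a \<Longrightarrow> f v = 0"
    and D: "open D" "connected D" "\<gamma> ` D \<subseteq> U"
    and cont: "\<And>t. t \<in> D \<Longrightarrow> isCont \<gamma> t"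
    and x': "\<And>t. t \<in> D \<Longrightarrow> ((\<lambda>t. \<gamma> t $ 1) has_field_derivative f (\<gamma> t)) (at t)"
    and t0: "t0 \<in> D" "\<gamma> t0 $ 1 = a" and t: "t \<in> D"
  shows "\<gamma> t $ 1 = a"
proof -
  define x where "x s = \<gamma> s $ 1 - a" for s
  have xd: "(x has_field_derivative f (\<gamma> s)) (at s)" if "s \<in> D" for s
    unfolding x_def[abs_def] using x'[OF that] by (auto intro!: derivative_eq_intros)
  have local: "\<exists>\<epsilon>>0. \<forall>s\<in>ball s0 \<epsilon>. x s = 0" if s0: "s0 \<in> D" "x s0 = 0" for s0
  proof -
    have a: "\<gamma> s0 $ 1 = a" using s0(2) by (simp add: x_def)
    obtain C \<delta> where C: "\<delta> > 0" "C > 0" "\<And>v. v \<in> ball (\<gamma> s0) \<delta> \<Longrightarrow> norm (f v) \<le> C * norm (v$1 - \<gamma> s0 $ 1)"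
      by (rule vanishing_on_slice_bound[OF f U, of "\<gamma> s0"]) (use s0(1) D(3) z a in auto)
    have "eventually (\<lambda>s. \<gamma> s \<in> ball (\<gamma> s0) \<delta>) (nhds s0)"
      by (rule eventually_nhds_isCont_open[OF cont[OF s0(1)] open_ball]) (simp add: C(1))
    moreover have "eventually (\<lambda>s. s \<in> D) (nhds s0)" using D(1) s0(1) by (simp add: eventually_nhds_in_open)
    ultimately have "eventually (\<lambda>s. \<gamma> s \<in> ball (\<gamma> s0) \<delta> \<and> s \<in> D) (nhds s0)" by eventually_elim simp
    then obtain e where e: "e > 0" "\<And>s. dist s s0 < e \<Longrightarrow> \<gamma> s \<in> ball (\<gamma> s0) \<delta> \<and> s \<in> D"
      unfolding eventually_nhds_metric by auto
    define \<epsilon> where "\<epsilon> = min (e/2) (1 / (2 * C))"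
    have \<epsilon>: "\<epsilon> > 0" "\<epsilon> < e" "C * \<epsilon> \<le> 1/2"
    proof -
      show "\<epsilon> > 0" "\<epsilon> < e" using e(1) C(2) by (auto simp: \<epsilon>_def)
      have "C * \<epsilon> \<le> C * (1 / (2 * C))" using C(2) by (intro mult_left_mono) (auto simp: \<epsilon>_def)
      then show "C * \<epsilon> \<le> 1/2" using C(2) by simp
    qed
    have inD: "s \<in> D" "\<gamma> s \<in> ball (\<gamma> s0) \<delta>" if "s \<in> cball s0 \<epsilon>" for s
      using e(2)[of s] that \<epsilon>(2) by (auto simp: dist_commute)
    have "continuous_on (cball s0 \<epsilon>) x"
      by (intro continuous_at_imp_continuous_on ballI DERIV_isCont[OF xd] inD(1))
    then have "continuous_on (cball s0 \<epsilon>) (\<lambda>s. norm (x s))" by (rule continuous_on_norm)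
    then have "\<exists>s1\<in>cball s0 \<epsilon>. \<forall>s\<in>cball s0 \<epsilon>. norm (x s) \<le> norm (x s1)"
      using \<epsilon>(1) by (intro continuous_attains_sup) auto
    then obtain s1 where s1: "s1 \<in> cball s0 \<epsilon>" and s1_max: "\<forall>s\<in>cball s0 \<epsilon>. norm (x s) \<le> norm (x s1)" by blast
    have "norm (x s1 - x s0) \<le> (C * norm (x s1)) * norm (s1 - s0)"
    proof (rule field_differentiable_bound[OF convex_cball])
      fix s assume s: "s \<in> cball s0 \<epsilon>"
      show "(x has_field_derivative f (\<gamma> s)) (at s within cball s0 \<epsilon>)"
        by (rule has_field_derivative_at_within[OF xd[OF inD(1)[OF s]]])
      have "norm (f (\<gamma> s)) \<le> C * norm (x s)" using C(3)[OF inD(2)[OF s]] by (simp add: x_def a)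
      also have "\<dots> \<le> C * norm (x s1)" using bspec[OF s1_max s] C(2) by simp
      finally show "norm (f (\<gamma> s)) \<le> C * norm (x s1)" .
    qed (use s1 \<epsilon>(1) in auto)
    also have "\<dots> \<le> (C * norm (x s1)) * \<epsilon>"
      using s1 C(2) by (intro mult_left_mono) (auto simp: dist_norm norm_minus_commute)
    also have "\<dots> = (C * \<epsilon>) * norm (x s1)" by simp
    also have "\<dots> \<le> 1/2 * norm (x s1)" using \<epsilon>(3) by (rule mult_right_mono) simp
    finally have "norm (x s1) \<le> 0" using s0(2) by simp
    then have "x s = 0" if "s \<in> cball s0 \<epsilon>" for s using bspec[OF s1_max that] by simp
    then show ?thesis using \<epsilon>(1) by (intro exI[of _ \<epsilon>]) auto
  qed
  have xcont: "continuous_on D x"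
    by (intro continuous_at_imp_continuous_on ballI DERIV_isCont[OF xd])
  have "openin (top_of_set D) {s \<in> D. x s = 0}"
  proof -
    have "open {s \<in> D. x s = 0}"
    proof (rule openI)
      fix s assume s: "s \<in> {s \<in> D. x s = 0}"
      then obtain \<epsilon> where "\<epsilon> > 0" "\<forall>s\<in>ball s \<epsilon>. x s = 0" using local by auto
      moreover obtain \<epsilon>' where "\<epsilon>' > 0" "ball s \<epsilon>' \<subseteq> D" using s D(1) by (auto elim: openE)
      ultimately show "\<exists>e>0. ball s e \<subseteq> {s \<in> D. x s = 0}" by (intro exI[of _ "min \<epsilon> \<epsilon>'"]) auto
    qed
    then show ?thesis by (rule open_subset[rotated]) auto
  qed
  moreover have "closedin (top_of_set D) {s \<in> D. x s = 0}"
    using continuous_closedin_preimage_constant[OF xcont] by simp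
  moreover have "t0 \<in> {s \<in> D. x s = 0}" using t0 by (simp add: x_def)
  ultimately have "{s \<in> D. x s = 0} = D" using D(2) unfolding connected_clopen by blast
  then show ?thesis using t by (auto simp: x_def)
qed

text \<open>Each arc runs in a single chart, where uniqueness confines it to the fibre once it meets
  it; a leaf is made of chains of arcs.\<close>

lemma vertical_fibre_invariant:
  assumes F: "singular_foliation F" and vert: "\<And>q. vertical_at F (p, q)" and q: "fst q = p"
  shows "leaf F q \<subseteq> fst -` {p}"
  unfolding leaf_eq_arc_leaf
proof (rule arc_leaf_subset)
  show "q \<in> fst -` {p}" using q by simp
  fix P a b assume P: "P \<in> integral_arcs F" "a \<in> P" "b \<in> P" and a: "a \<in> fst -` {p}"
  obtain \<phi> U Y \<gamma> D where gen: "(\<phi>, U, Y) \<in> F" and D: "open D" "connected D" "\<gamma> ` D \<subseteq> U" and PD: "P = \<phi> ` \<gamma> ` D"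
    and \<gamma>: "\<And>t. t \<in> D \<Longrightarrow> (\<gamma> has_derivative (\<lambda>h. h *s Y (\<gamma> t))) (at t)"
    using P(1) unfolding integral_arcs_def by auto
  have G: "\<phi> \<in> total_charts" "open U" "holo_field Y U" using foliation_is_generator[OF F gen] by auto
  then obtain c j where \<phi>: "\<phi> = std_chart c j" by (auto simp: total_charts_eq)
  obtain t0 t where t: "t0 \<in> D" "a = std_chart c j (\<gamma> t0)" "t \<in> D" "b = std_chart c j (\<gamma> t)"
    using P(2,3) PD \<phi> by auto
  have p: "p = base_chart c (\<gamma> t0 $ 1)" using a t(2) by (simp add: std_chart_def)
  have "\<gamma> t $ 1 = \<gamma> t0 $ 1"
  proof (rule solution_stays_in_vertical_slice[OF _ G(2) _ D _ _ t(1) refl t(3)])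
    show "holo_fun (\<lambda>v. Y v $ 1) U" using G(3) by (simp add: holo_field_def)
    fix v assume v: "v \<in> U" "v $ 1 = \<gamma> t0 $ 1"
    have "vertical_at F (std_chart c j v)" using vert v(2) by (simp add: std_chart_def p)
    then show "Y v $ 1 = 0" using vertical_at_iff[OF F gen[unfolded \<phi>] v(1)] by simp
  next
    fix s assume "s \<in> D"
    show "isCont \<gamma> s" using \<gamma>[OF \<open>s \<in> D\<close>] has_derivative_continuous by blast
    show "((\<lambda>t. \<gamma> t $ 1) has_field_derivative Y (\<gamma> s) $ 1) (at s)"
      using \<gamma>[OF \<open>s \<in> D\<close>] by (simp add: has_derivative_curve_iff)
  qed
  then show "b \<in> fst -` {p}" using t(4) by (simp add: p std_chart_def)
qed

section \<open>Polynomials along rays in the fibre\<close>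

lemma poly_fun3_coeffs:
  assumes "poly_fun3 f"
  shows "\<exists>N (P :: nat \<Rightarrow> nat \<Rightarrow> complex poly). (\<forall>j k. j > N \<or> k > N \<longrightarrow> P j k = 0) \<and>
    (\<forall>v. f v = (\<Sum>j\<le>N. \<Sum>k\<le>N. poly (P j k) (v$1) * (v$2)^j * (v$3)^k))"
proof -
  obtain N c where f: "\<And>v. f v = (\<Sum>i\<le>N. \<Sum>j\<le>N. \<Sum>k\<le>N. c i j k * (v$1)^i * (v$2)^j * (v$3)^(k::nat))"
    using assms unfolding poly_fun3_def by auto
  \<comment> \<open>Coefficients outside the range are set to 0, so that the range of summation can
    be changed later.\<close>
  define P where "P j k = (if j > N \<or> k > N then 0 else \<Sum>i\<le>N. monom (c i j k) i)" for j k
  have "f v = (\<Sum>j\<le>N. \<Sum>k\<le>N. poly (P j k) (v$1) * (v$2)^j * (v$3)^k)" for v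
  proof -
    have "f v = (\<Sum>j\<le>N. \<Sum>i\<le>N. \<Sum>k\<le>N. c i j k * (v$1)^i * (v$2)^j * (v$3)^k)"
      unfolding f by (rule sum.swap)
    also have "\<dots> = (\<Sum>j\<le>N. \<Sum>k\<le>N. \<Sum>i\<le>N. c i j k * (v$1)^i * (v$2)^j * (v$3)^k)"
      by (intro sum.cong refl sum.swap)
    also have "\<dots> = (\<Sum>j\<le>N. \<Sum>k\<le>N. poly (P j k) (v$1) * (v$2)^j * (v$3)^k)"
      by (intro sum.cong refl) (simp add: P_def poly_sum poly_monom sum_distrib_right)
    finally show ?thesis .
  qed
  then show ?thesis by (intro exI[of _ N] exI[of _ P]) (auto simp: P_def)
qed

text \<open>The restriction of a fibre polynomial to the ray \<open>(y, t * y)\<close>. It reduces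
  growth at infinity to a degree bound in one variable.\<close>

definition ray_poly :: "nat \<Rightarrow> (nat \<Rightarrow> nat \<Rightarrow> complex) \<Rightarrow> complex \<Rightarrow> complex poly" where
  "ray_poly N a t = (\<Sum>j\<le>N. \<Sum>k\<le>N. monom (a j k * t^k) (j + k))"

lemma poly_ray_poly: "poly (ray_poly N a t) y = (\<Sum>j\<le>N. \<Sum>k\<le>N. a j k * y^j * (t * y)^k)"
  by (simp add: ray_poly_def poly_sum poly_monom power_add power_mult_distrib mult_ac)

text \<open>The coefficient of degree \<open>d\<close> is the homogeneous part of degree
  \<open>d\<close> evaluated at \<open>(1, t)\<close>.\<close>

lemma coeff_ray_poly:
  assumes a: "\<And>j k. j > N \<or> k > N \<Longrightarrow> a j k = 0"
  shows "coeff (ray_poly N a t) d = (\<Sum>k\<le>d. a (d - k) k * t^k)"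
proof -
  have "coeff (ray_poly N a t) d = (\<Sum>j\<le>N. \<Sum>k\<le>N. if j + k = d then a j k * t^k else 0)"
    by (simp add: ray_poly_def coeff_sum)
  also have "\<dots> = (\<Sum>k\<le>N. \<Sum>j\<le>N. if j + k = d then a j k * t^k else 0)" by (rule sum.swap)
  also have "\<dots> = (\<Sum>k\<le>N. if k \<le> d then a (d - k) k * t^k else 0)"
  proof (rule sum.cong[OF refl])
    fix k assume "k \<in> {..N}"
    have "(\<Sum>j\<le>N. if j + k = d then a j k * t^k else 0) = (\<Sum>j\<le>N. if j = d - k \<and> k \<le> d then a (d - k) k * t^k else 0)"
      by (intro sum.cong refl) auto
    also have "\<dots> = (if k \<le> d then a (d - k) k * t^k else 0)"
      using a[of "d - k" k] by (auto simp: sum.delta)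
    finally show "(\<Sum>j\<le>N. if j + k = d then a j k * t^k else 0) = (if k \<le> d then a (d - k) k * t^k else 0)" .
  qed
  also have "\<dots> = (\<Sum>k\<in>{..N} \<inter> {..d}. a (d - k) k * t^k)"
    using sum.inter_restrict[of "{..N}" "\<lambda>k. a (d - k) k * t^k" "{..d}"] by (simp only: finite_atMost atMost_iff)
  also have "\<dots> = (\<Sum>k\<le>d. a (d - k) k * t^k)"
    using a by (intro sum.mono_neutral_left) auto
  finally show ?thesis .
qed

text \<open>If the degree were larger, multiplying by the missing power of \<open>s\<close> would
  make the reflected polynomial tend to 0, although its value at 0 is the leading
  coefficient.\<close>

lemma poly_growth_degree:
  fixes g :: "complex poly"
  assumes lim: "((\<lambda>s. s^n * poly g (inverse s)) \<longlongrightarrow> l) (at 0)"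
  shows "degree g \<le> n"
proof (rule ccontr)
  assume "\<not> degree g \<le> n"
  then have d: "n < degree g" by simp
  then have "g \<noteq> 0" by auto
  have "((\<lambda>s. s^(degree g - n) * (s^n * poly g (inverse s))) \<longlongrightarrow> 0^(degree g - n) * l) (at 0)"
    by (intro tendsto_intros lim)
  moreover have "eventually (\<lambda>s. s^(degree g - n) * (s^n * poly g (inverse s)) = poly (reflect_poly g) s) (at 0)"
    unfolding eventually_at_filter
    using d by (intro always_eventually) (auto simp: poly_reflect_poly_nz mult.assoc[symmetric] power_add[symmetric])
  ultimately have "((\<lambda>s. poly (reflect_poly g) s) \<longlongrightarrow> 0^(degree g - n) * l) (at 0)"
    by (rule Lim_transform_eventually)
  then have "((\<lambda>s. poly (reflect_poly g) s) \<longlongrightarrow> 0) (at 0)"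
    using d by (simp add: zero_power)
  moreover have "((\<lambda>s. poly (reflect_poly g) s) \<longlongrightarrow> poly (reflect_poly g) 0) (at 0)"
    by (intro tendsto_intros)
  ultimately have "poly (reflect_poly g) 0 = 0" using LIM_unique by blast
  then show False using \<open>g \<noteq> 0\<close> by simp
qed

lemma coeffs_zero_of_infinite_roots:
  fixes a :: "nat \<Rightarrow> complex"
  assumes "infinite T" "\<And>t. t \<in> T \<Longrightarrow> (\<Sum>k\<le>d. a k * t^k) = 0" "k \<le> d"
  shows "a k = 0"
proof -
  define p where "p = (\<Sum>k\<le>d. monom (a k) k)"
  have "T \<subseteq> {t. poly p t = 0}" using assms(2) by (auto simp: p_def poly_sum poly_monom)
  then have "p = 0" using assms(1) poly_roots_finite[of p] finite_subset by blast
  moreover have "coeff p k = a k" using assms(3) by (simp add: p_def coeff_sum)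
  ultimately show ?thesis by simp
qed

text \<open>The first limit bounds the degree of \<open>q\<close> on each ray by 2, the second that
  of \<open>r - t * q\<close> by 1. So all terms above degree 2 vanish, and in degree 2 the form of
  \<open>r\<close> equals \<open>t\<close> times that of \<open>q\<close> at \<open>(1, t)\<close>.
  This cubic identity holds for infinitely many \<open>t\<close>, hence coefficientwise.\<close>

lemma quadratic_of_ray_limits:
  fixes q r :: "nat \<Rightarrow> nat \<Rightarrow> complex"
  assumes q: "\<And>j k. j > N \<or> k > N \<Longrightarrow> q j k = 0" and r: "\<And>j k. j > N' \<or> k > N' \<Longrightarrow> r j k = 0"
    and T: "infinite T"
    and lim_q: "\<And>t. t \<in> T \<Longrightarrow> \<exists>l. ((\<lambda>s. s^2 * poly (ray_poly N q t) (inverse s)) \<longlongrightarrow> l) (at 0)"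
    and lim_r: "\<And>t. t \<in> T \<Longrightarrow> \<exists>l. ((\<lambda>s. s * (poly (ray_poly N' r t) (inverse s) - t * poly (ray_poly N q t) (inverse s))) \<longlongrightarrow> l) (at 0)"
  shows "\<And>j k. j + k > 2 \<Longrightarrow> q j k = 0" "\<And>j k. j + k > 2 \<Longrightarrow> r j k = 0"
    "q 0 2 = 0" "r 2 0 = 0" "r 1 1 = q 2 0" "r 0 2 = q 1 1"
proof -
  have dq: "degree (ray_poly N q t) \<le> 2" if "t \<in> T" for t
    using lim_q[OF that] poly_growth_degree by blast
  have dr: "degree (ray_poly N' r t - smult t (ray_poly N q t)) \<le> 1" if "t \<in> T" for t
    using lim_r[OF that] poly_growth_degree[where n = 1 and g = "ray_poly N' r t - smult t (ray_poly N q t)"] by auto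
  have cr: "coeff (ray_poly N' r t) d = t * coeff (ray_poly N q t) d" if "t \<in> T" "d > 1" for t d
    using dr[OF that(1)] that(2) coeff_eq_0[of "ray_poly N' r t - smult t (ray_poly N q t)" d] by simp
  have "(\<Sum>k\<le>d. q (d - k) k * t^k) = 0" if "t \<in> T" "d > 2" for t d
    using dq[OF that(1)] that(2) coeff_eq_0[of "ray_poly N q t" d] coeff_ray_poly[OF q] by simp
  from coeffs_zero_of_infinite_roots[OF T this]
  have q0: "q (d - k) k = 0" if "d > 2" "k \<le> d" for d k using that by blast
  then show 1: "q j k = 0" if "j + k > 2" for j k using q0[of "j + k" k] that by simp
  have "(\<Sum>k\<le>d. r (d - k) k * t^k) = 0" if "t \<in> T" "d > 2" for t d
  proof -
    have "coeff (ray_poly N q t) d = 0" using dq[OF that(1)] that(2) by (intro coeff_eq_0) simp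
    then show ?thesis using cr[OF that(1), of d] that(2) coeff_ray_poly[OF r] by simp
  qed
  from coeffs_zero_of_infinite_roots[OF T this]
  have r0: "r (d - k) k = 0" if "d > 2" "k \<le> d" for d k using that by blast
  then show "r j k = 0" if "j + k > 2" for j k using r0[of "j + k" k] that by simp
  \<comment> \<open>The coefficients in \<open>t\<close> of the quadratic form of \<open>r\<close>
    at \<open>(1, t)\<close> minus \<open>t\<close> times that of \<open>q\<close>; index 3 falls
    into the last case.\<close>
  define a where "a k = (if k = 0 then r 2 0 else if k = 1 then r 1 1 - q 2 0 else if k = 2 then r 0 2 - q 1 1 else - q 0 2)" for k :: nat
  have "(\<Sum>k\<le>3. a k * t^k) = 0" if "t \<in> T" for t
  proof -
    have "(\<Sum>k\<le>2. r (2 - k) k * t^k) = t * (\<Sum>k\<le>2. q (2 - k) k * t^k)"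
      using cr[OF that, of 2] coeff_ray_poly[where a = r and N = N' and t = t and d = 2, OF r] coeff_ray_poly[where a = q and N = N and t = t and d = 2, OF q] by simp
    then show ?thesis by (simp add: a_def numeral_2_eq_2 numeral_3_eq_3 algebra_simps)
  qed
  note a0 = coeffs_zero_of_infinite_roots[OF T this]
  show "q 0 2 = 0" "r 2 0 = 0" "r 1 1 = q 2 0" "r 0 2 = q 1 1"
    using a0[of 0] a0[of 1] a0[of 2] a0[of 3] by (simp_all add: a_def)
qed

lemma sum_degree_two:
  fixes a :: "nat \<Rightarrow> nat \<Rightarrow> complex"
  assumes a: "\<And>j k. j > N \<or> k > N \<Longrightarrow> a j k = 0" and a2: "\<And>j k. j + k > 2 \<Longrightarrow> a j k = 0"
  shows "(\<Sum>j\<le>N. \<Sum>k\<le>N. a j k * y^j * z^k) = a 0 0 + a 1 0 * y + a 0 1 * z + a 2 0 * y^2 + a 1 1 * y * z + a 0 2 * z^2"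
proof -
  \<comment> \<open>Raising the bounds to \<open>N+2\<close> makes room for the quadratic terms when
    \<open>N < 2\<close>.\<close>
  have "(\<Sum>j\<le>N. \<Sum>k\<le>N. a j k * y^j * z^k) = (\<Sum>j\<le>N+2. \<Sum>k\<le>N. a j k * y^j * z^k)"
    using a by (intro sum.mono_neutral_left) auto
  also have "\<dots> = (\<Sum>j\<le>N+2. \<Sum>k\<le>N+2. a j k * y^j * z^k)"
    using a by (intro sum.cong sum.mono_neutral_left refl) auto
  also have "\<dots> = (\<Sum>j\<le>2. \<Sum>k\<le>N+2. a j k * y^j * z^k)"
    using a2 by (intro sum.mono_neutral_right) auto
  also have "\<dots> = (\<Sum>j\<le>2. \<Sum>k\<le>2. a j k * y^j * z^k)"
    using a2 by (intro sum.cong sum.mono_neutral_right refl) auto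
  also have "\<dots> = a 0 0 + a 1 0 * y + a 0 1 * z + a 2 0 * y^2 + a 1 1 * y * z + a 0 2 * z^2"
    using a2[of 1 2] a2[of 2 1] a2[of 2 2] by (simp add: numeral_2_eq_2 algebra_simps)
  finally show ?thesis .
qed

section \<open>The polynomial form\<close>

lemma given_by_compatible:
  "given_by F X \<Longrightarrow> H \<in> F \<Longrightarrow> compatible (std_chart False 1, UNIV, X) H"
  by (simp add: given_by_def affine_chart_eq)

lemma infinite_affine_part:
  fixes B :: "complex option set"
  assumes "finite (- B)" shows "infinite {x. Some x \<in> B}"
proof -
  have "finite {x. Some x \<in> - B}" using finite_vimageI[OF assms, of Some] by (simp add: vimage_def)
  moreover have "{x. Some x \<in> B} = UNIV - {x. Some x \<in> - B}" by auto
  ultimately show ?thesis using Diff_infinite_finite[OF _ infinite_UNIV_char_0, of "{x. Some x \<in> - B}"] by simp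
qed

lemma poly_eq_of_infinite:
  fixes p q :: "complex poly"
  assumes "infinite S" "\<And>x. x \<in> S \<Longrightarrow> poly p x = poly q x" shows "p = q"
proof (rule ccontr)
  assume "p \<noteq> q"
  then have "finite {x. poly (p - q) x = 0}" by (intro poly_roots_finite) simp
  moreover have "S \<subseteq> {x. poly (p - q) x = 0}" using assms(2) by auto
  ultimately show False using assms(1) finite_subset by blast
qed

lemma affine_base_component_nonzero:
  assumes F: "singular_foliation F" and X: "given_by F X" and tr: "transversal_over F B"
    and v: "Some (v$1) \<in> B"
  shows "X v $ 1 \<noteq> 0"
proof -
  obtain b j U Y u where gen: "(std_chart b j, U, Y) \<in> F" "u \<in> U" "std_chart b j u = std_chart False 1 v"
    by (rule foliation_generator_at[OF F])
  have "base_chart b (u$1) = Some (v$1)" using gen(3) by (simp add: std_chart_def base_chart_def)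
  then have "Y u $ 1 \<noteq> 0" using transversal_overD[OF tr gen(1,2)] v by simp
  moreover obtain g where "g \<noteq> 0" "base_dtrans False b (v$1) * X v $ 1 = g * Y u $ 1"
    by (rule compatible_transition[OF given_by_compatible[OF X gen(1)] UNIV_I gen(2,3)])
  ultimately show ?thesis by auto
qed

text \<open>Over a fixed \<open>x\<close> in \<open>S\<close>, a polynomial without zeros on a
  complex line is constant by the fundamental theorem of algebra; all lines through the origin of
  the fibre together give independence of the fibre coordinates. Infinitely many \<open>x\<close>
  then suffice, since both sides are polynomial in \<open>x\<close>.\<close>

lemma nonvanishing_poly_fun3_first_only:
  assumes f: "poly_fun3 f" and S: "infinite S" and nz: "\<And>v. v$1 \<in> S \<Longrightarrow> f v \<noteq> 0"
  obtains p :: "complex poly" where "\<And>v. f v = poly p (v$1)"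
proof -
  obtain N and P :: "nat \<Rightarrow> nat \<Rightarrow> complex poly" where
    P: "\<forall>v. f v = (\<Sum>j\<le>N. \<Sum>k\<le>N. poly (P j k) (v$1) * (v$2)^j * (v$3)^k)"
    using poly_fun3_coeffs[OF f] by blast
  have "f v = poly (P 0 0) (v$1)" for v
  proof -
    \<comment> \<open>The fibre coordinates of \<open>v\<close> are frozen and the base coordinate
      varies.\<close>
    define q where "q = (\<Sum>j\<le>N. \<Sum>k\<le>N. smult ((v$2)^j * (v$3)^k) (P j k))"
    have "poly q x = poly (P 0 0) x" if x: "x \<in> S" for x
    proof -
      \<comment> \<open>The restriction to the line through the origin in the direction of
        \<open>v\<close>, inside the fibre over \<open>x\<close>.\<close>
      define g where "g = (\<Sum>j\<le>N. \<Sum>k\<le>N. monom (poly (P j k) x * (v$2)^j * (v$3)^k) (j + k))"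
      have g: "poly g l = f (vector [x, l * v$2, l * v$3])" for l
        by (simp add: g_def spec[OF P] poly_sum poly_monom power_mult_distrib power_add mult_ac)
      have "degree g = 0"
      proof (rule ccontr)
        assume "degree g \<noteq> 0"
        then have "\<exists>i\<in>{1..degree g}. coeff g i \<noteq> 0" by (intro bexI[of _ "degree g"]) auto
        then obtain z where "(\<Sum>i\<le>degree g. coeff g i * z^i) = 0"
          using fundamental_theorem_of_algebra[of "coeff g" "degree g"] by auto
        then have "poly g z = 0" by (simp add: poly_altdef)
        then show False using nz x by (simp add: g vector_3)
      qed
      then have "poly g 1 = poly g 0" by (elim degree_eq_zeroE) simp
      moreover have "poly g 0 = poly (P 0 0) x"
      proof -
        have "poly g 0 = (\<Sum>j\<le>N. \<Sum>k\<le>N. if j = 0 \<and> k = 0 then poly (P 0 0) x else 0)"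
          unfolding g_def poly_sum by (intro sum.cong refl) (auto simp: poly_monom)
        also have "\<dots> = (\<Sum>j\<le>N. if j = 0 then poly (P 0 0) x else 0)"
          by (intro sum.cong refl) (simp add: sum.delta)
        finally show ?thesis by (simp add: sum.delta)
      qed
      moreover have "poly g 1 = poly q x" by (simp add: g_def q_def poly_sum poly_monom mult_ac)
      ultimately show ?thesis by simp
    qed
    then have "q = P 0 0" by (rule poly_eq_of_infinite[OF S])
    moreover have "f v = poly q (v$1)" by (simp add: spec[OF P] q_def poly_sum mult_ac)
    ultimately show ?thesis by simp
  qed
  then show ?thesis by (rule that)
qed

text \<open>The point \<open>[0:1:0]\<close> lies in the chart \<open>homog s 1 t\<close> only, so a generator there bounds the field in
  the coordinates \<open>s = 1/y\<close>, \<open>t = z/y\<close>.\<close>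

lemma ray_limits:
  assumes F: "singular_foliation F" and X: "given_by F X" and tr: "transversal_over F B"
    and x: "Some x \<in> B" and p: "\<And>v. X v $ 1 = p (v$1)"
  shows "\<exists>T. infinite T \<and> (\<forall>t\<in>T. (\<exists>l. ((\<lambda>s. s^2 * X (vector [x, inverse s, t * inverse s]) $ 2) \<longlongrightarrow> l) (at 0)) \<and>
    (\<exists>l. ((\<lambda>s. s * (X (vector [x, inverse s, t * inverse s]) $ 3 - t * X (vector [x, inverse s, t * inverse s]) $ 2)) \<longlongrightarrow> l) (at 0)))"
proof -
  let ?L = "axis 2 1 :: complex^3"
  have L: "?L \<noteq> 0" by (simp add: axis_eq_0_iff)
  obtain b j U Y u where gen: "(std_chart b j, U, Y) \<in> F" "u \<in> U" "std_chart b j u = (Some x, abs_cp2 ?L)"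
    by (rule foliation_generator_at[OF F])
  have Y: "open U" "holo_field Y U" using foliation_is_generator[OF F gen(1)] by auto
  define w where "w = u$1"
  have bx: "base_chart b w = base_chart False x" using gen(3) by (simp add: std_chart_def w_def base_chart_def)
  have w: "False = b \<or> x \<noteq> 0" "w = base_trans False b x"
    using bx[symmetric] by (auto simp: base_chart_eq_iff[of False x b w])
  have "std_chart b j u = (base_chart b w, abs_cp2 ?L)" using gen(3) bx by (simp add: base_chart_def)
  then have "?L $ j \<noteq> 0" and u: "u = std_coords w j ?L" using std_chart_eq_iff[OF L] by auto
  then have j: "j = 2" by (auto simp: axis_def split: if_splits)
  have u: "u = vector [w, 0, 0]" using u by (simp add: j vec3_eq_iff vector_3 axis_def)
  define v where "v t s = (vector [w, s, t] :: complex^3)" for t s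
  \<comment> \<open>The slopes whose limit point lies in the domain of the generator. They form an
    open set around 0, hence an infinite one, as the comparison of coefficients requires.\<close>
  define T where "T = {t. v t 0 \<in> U}"
  have cont_t: "isCont (\<lambda>t. v t 0) t" for t
  proof (rule isCont_vec)
    fix k show "isCont (\<lambda>t. v t 0 $ k) t" using exhaust_3[of k] by (elim disjE) (simp_all add: v_def vector_3)
  qed
  have cont_s: "isCont (v t) s" for t s
  proof (rule isCont_vec)
    fix k show "isCont (\<lambda>s. v t s $ k) s" using exhaust_3[of k] by (elim disjE) (simp_all add: v_def vector_3)
  qed
  have "open T"
  proof (rule open_eventuallyI)
    fix t assume "t \<in> T"
    then show "eventually (\<lambda>y. y \<in> T) (nhds t)"
      using eventually_nhds_isCont_open[OF cont_t Y(1), of t] by (simp add: T_def)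
  qed
  moreover have "0 \<in> T" using gen(2) u by (simp add: T_def v_def)
  ultimately have "infinite T" using finite_imp_not_open[of T] by auto
  \<comment> \<open>The compatibility factor is available only for \<open>s \<noteq> 0\<close>. The
    base component identifies it with this quotient, which for slopes in \<open>T\<close> is
    continuous at \<open>s = 0\<close> as well.\<close>
  define h where "h t s = base_dtrans False b x * p x / Y (v t s) $ 1" for t s
  have Y1: "Y (v t s) $ 1 \<noteq> 0" if "v t s \<in> U" for t s
    by (rule transversal_overD[OF tr gen(1) that]) (use x bx in \<open>simp add: v_def vector_3 base_chart_def\<close>)
  have eqs: "s^2 * X (vector [x, inverse s, t * inverse s]) $ 2 = - h t s * Y (v t s) $ 2"
      "s * (X (vector [x, inverse s, t * inverse s]) $ 3 - t * X (vector [x, inverse s, t * inverse s]) $ 2) = h t s * Y (v t s) $ 3"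
    if s: "s \<noteq> 0" "v t s \<in> U" for t s
  proof -
    let ?u = "vector [x, inverse s, t * inverse s] :: complex^3"
    have l: "fibre_lift 1 ?u $ 1 = 1" "fibre_lift 1 ?u $ 2 = inverse s" "fibre_lift 1 ?u $ 3 = t * inverse s"
      by (simp_all add: fibre_lift_def vector_3)
    have d: "dlift 1 (X ?u) $ 1 = 0" "dlift 1 (X ?u) $ 2 = X ?u $ 2" "dlift 1 (X ?u) $ 3 = X ?u $ 3"
      by (simp_all add: dlift_def)
    have "std_chart b 2 (v t s) = std_chart False 1 ?u"
      unfolding std_chart_transition_iff using w s(1) by (simp add: vec3_eq_iff v_def vector_3 l divide_inverse)
    then obtain g where g: "g \<noteq> 0" "base_dtrans False b (?u$1) * X ?u $ 1 = g * Y (v t s) $ 1"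
      "(dlift 1 (X ?u) $ fst_idx 2 * fibre_lift 1 ?u $ 2 - fibre_lift 1 ?u $ fst_idx 2 * dlift 1 (X ?u) $ 2) / (fibre_lift 1 ?u $ 2)^2 = g * Y (v t s) $ 2"
      "(dlift 1 (X ?u) $ snd_idx 2 * fibre_lift 1 ?u $ 2 - fibre_lift 1 ?u $ snd_idx 2 * dlift 1 (X ?u) $ 2) / (fibre_lift 1 ?u $ 2)^2 = g * Y (v t s) $ 3"
      by (rule compatible_transition[OF given_by_compatible[OF X gen(1)[unfolded j]] UNIV_I s(2)])
    have "g = h t s" using g(2) Y1[OF s(2)] by (simp add: h_def p vector_3 field_simps)
    note gk = g(3)[unfolded idx_simps l d] g(4)[unfolded idx_simps l d]
    define Q R where "Q = X ?u $ 2" and "R = X ?u $ 3"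
    have "(0 * inverse s - 1 * Q) / (inverse s)^2 = - (s^2 * Q)"
      "(R * inverse s - t * inverse s * Q) / (inverse s)^2 = s * (R - t * Q)"
      using s(1) by (simp_all add: field_simps power2_eq_square)
    with gk[folded Q_def R_def] have "- (s^2 * Q) = g * Y (v t s) $ 2" "s * (R - t * Q) = g * Y (v t s) $ 3"
      by simp_all
    then have "s^2 * Q = - g * Y (v t s) $ 2" "s * (R - t * Q) = g * Y (v t s) $ 3"
      by (simp_all add: neg_eq_iff_add_eq_0 eq_neg_iff_add_eq_0 add.commute)
    then show "s^2 * X ?u $ 2 = - h t s * Y (v t s) $ 2" "s * (X ?u $ 3 - t * X ?u $ 2) = h t s * Y (v t s) $ 3"
      unfolding \<open>g = h t s\<close> Q_def R_def .
  qed
  have lim: "((\<lambda>s. Y (v t s) $ k) \<longlongrightarrow> Y (v t 0) $ k) (at 0)" if "t \<in> T" for t k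
  proof -
    have "isCont Y (v t 0)" using holo_field_isCont[OF Y(2)] that by (simp add: T_def)
    with cont_s have "isCont (\<lambda>s. Y (v t s)) 0" by (rule isCont_o2)
    then show ?thesis unfolding isCont_def by (rule tendsto_vec_nth)
  qed
  have ev: "eventually (\<lambda>s. s \<noteq> 0 \<and> v t s \<in> U) (at 0)" if "t \<in> T" for t
    using eventually_nhds_isCont_open[OF cont_s Y(1), of t 0] that
    by (auto simp: T_def eventually_at_filter elim: eventually_mono)
  have lims: "((\<lambda>s. - h t s * Y (v t s) $ 2) \<longlongrightarrow> - h t 0 * Y (v t 0) $ 2) (at 0)"
    "((\<lambda>s. h t s * Y (v t s) $ 3) \<longlongrightarrow> h t 0 * Y (v t 0) $ 3) (at 0)" if "t \<in> T" for t
    unfolding h_def by (intro tendsto_intros lim that Y1; use that in \<open>simp add: T_def\<close>)+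
  show ?thesis
  proof (intro exI[of _ T] conjI ballI \<open>infinite T\<close>)
    fix t assume t: "t \<in> T"
    let ?X = "\<lambda>s. X (vector [x, inverse s, t * inverse s])"
    have "eventually (\<lambda>s. - h t s * Y (v t s) $ 2 = s^2 * ?X s $ 2) (at 0)"
      using ev[OF t] by (rule eventually_mono) (elim conjE, simp only: eqs not_False_eq_True)
    from Lim_transform_eventually[OF lims(1)[OF t] this]
    show "\<exists>l. ((\<lambda>s. s^2 * ?X s $ 2) \<longlongrightarrow> l) (at 0)" by (rule exI)
    have "eventually (\<lambda>s. h t s * Y (v t s) $ 3 = s * (?X s $ 3 - t * ?X s $ 2)) (at 0)"
      using ev[OF t] by (rule eventually_mono) (elim conjE, simp only: eqs not_False_eq_True)
    from Lim_transform_eventually[OF lims(2)[OF t] this]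
    show "\<exists>l. ((\<lambda>s. s * (?X s $ 3 - t * ?X s $ 2)) \<longlongrightarrow> l) (at 0)" by (rule exI)
  qed
qed

definition riccati_coeffs ::
  "(complex^3 \<Rightarrow> complex^3) \<Rightarrow> complex poly \<Rightarrow> complex poly \<Rightarrow> complex poly \<Rightarrow> complex poly \<Rightarrow>
    complex poly \<Rightarrow> complex poly \<Rightarrow> complex poly \<Rightarrow> complex poly \<Rightarrow> complex poly \<Rightarrow> bool" where
  "riccati_coeffs X p a b c A B' C D E \<longleftrightarrow> (\<forall>v.
    X v $ 1 = poly p (v$1) \<and>
    X v $ 2 = poly A (v$1) + poly B' (v$1) * v$2 + poly C (v$1) * v$3 + poly D (v$1) * v$2 * v$3 + poly E (v$1) * (v$2)^2 \<and>
    X v $ 3 = poly a (v$1) + poly b (v$1) * v$2 + poly c (v$1) * v$3 + poly E (v$1) * v$2 * v$3 + poly D (v$1) * (v$3)^2)"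

text \<open>The quadratic shape is obtained over each point of \<open>S\<close> separately. Since
  \<open>S\<close> is infinite, the pointwise relations become identities between coefficient
  polynomials, valid over excluded fibres too.\<close>

lemma riccati_form:
  assumes F: "singular_foliation F" and pf: "poly_field X" and X: "given_by F X"
    and fin: "finite (- B)" and tr: "transversal_over F B"
  shows "\<exists>p a b c A B' C D E. riccati_coeffs X p a b c A B' C D E"
proof -
  define S where "S = {x. Some x \<in> B}"
  have S: "infinite S" unfolding S_def by (rule infinite_affine_part[OF fin])
  have pfk: "poly_fun3 (\<lambda>v. X v $ k)" for k using pf by (simp add: poly_field_def)
  obtain p where p: "\<And>v. X v $ 1 = poly p (v$1)"
    by (rule nonvanishing_poly_fun3_first_only[OF pfk[of 1] S])
       (use affine_base_component_nonzero[OF F X tr] in \<open>auto simp: S_def\<close>)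
  obtain N and Q :: "nat \<Rightarrow> nat \<Rightarrow> complex poly" where Q: "\<forall>j k. j > N \<or> k > N \<longrightarrow> Q j k = 0"
    "\<forall>v. X v $ 2 = (\<Sum>j\<le>N. \<Sum>k\<le>N. poly (Q j k) (v$1) * (v$2)^j * (v$3)^k)"
    using poly_fun3_coeffs[OF pfk[of 2]] by blast
  obtain N' and R :: "nat \<Rightarrow> nat \<Rightarrow> complex poly" where R: "\<forall>j k. j > N' \<or> k > N' \<longrightarrow> R j k = 0"
    "\<forall>v. X v $ 3 = (\<Sum>j\<le>N'. \<Sum>k\<le>N'. poly (R j k) (v$1) * (v$2)^j * (v$3)^k)"
    using poly_fun3_coeffs[OF pfk[of 3]] by blast
  have at_x: "(\<forall>j k. j + k > 2 \<longrightarrow> poly (Q j k) x = 0) \<and> (\<forall>j k. j + k > 2 \<longrightarrow> poly (R j k) x = 0) \<and>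
     poly (Q 0 2) x = 0 \<and> poly (R 2 0) x = 0 \<and> poly (R 1 1) x = poly (Q 2 0) x \<and> poly (R 0 2) x = poly (Q 1 1) x"
    if "x \<in> S" for x
  proof -
    have "Some x \<in> B" using that by (simp add: S_def)
    let ?X = "\<lambda>s t. X (vector [x, inverse s, t * inverse s])"
    obtain T where T: "infinite T" "\<forall>t\<in>T. (\<exists>l. ((\<lambda>s. s^2 * ?X s t $ 2) \<longlongrightarrow> l) (at 0)) \<and>
        (\<exists>l. ((\<lambda>s. s * (?X s t $ 3 - t * ?X s t $ 2)) \<longlongrightarrow> l) (at 0))"
      using ray_limits[OF F X tr \<open>Some x \<in> B\<close> p] by blast
    let ?q = "\<lambda>j k. poly (Q j k) x" and ?r = "\<lambda>j k. poly (R j k) x"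
    have q: "X (vector [x, y, t * y]) $ 2 = poly (ray_poly N ?q t) y" for t y
      by (simp add: poly_ray_poly spec[OF Q(2)] vector_3)
    have r: "X (vector [x, y, t * y]) $ 3 = poly (ray_poly N' ?r t) y" for t y
      by (simp add: poly_ray_poly spec[OF R(2)] vector_3)
    have q0: "?q j k = 0" if "j > N \<or> k > N" for j k using Q(1) that by auto
    have r0: "?r j k = 0" if "j > N' \<or> k > N'" for j k using R(1) that by auto
    show ?thesis
      using quadratic_of_ray_limits[where q = ?q and r = ?r, OF q0 r0 T(1) conjunct1[OF bspec[OF T(2)[unfolded q r]]] conjunct2[OF bspec[OF T(2)[unfolded q r]]]]
      by simp
  qed
  have zero: "P = 0" if "\<And>x. x \<in> S \<Longrightarrow> poly P x = 0" for P :: "complex poly"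
    using poly_eq_of_infinite[OF S, of P 0] that by simp
  have Qz: "Q j k = 0" if "j + k > 2" for j k using zero at_x that by blast
  have Rz: "R j k = 0" if "j + k > 2" for j k using zero at_x that by blast
  have "Q 0 2 = 0" "R 2 0 = 0" using zero at_x by blast+
  have "R 1 1 = Q 2 0" "R 0 2 = Q 1 1" using poly_eq_of_infinite[OF S] at_x by blast+
  have two: "X v $ 2 = poly (Q 0 0) (v$1) + poly (Q 1 0) (v$1) * v$2 + poly (Q 0 1) (v$1) * v$3 + poly (Q 1 1) (v$1) * v$2 * v$3 + poly (Q 2 0) (v$1) * (v$2)^2" for v
    unfolding spec[OF Q(2)] using Q(1) Qz \<open>Q 0 2 = 0\<close> by (subst sum_degree_two) (auto simp: algebra_simps)
  have three: "X v $ 3 = poly (R 0 0) (v$1) + poly (R 1 0) (v$1) * v$2 + poly (R 0 1) (v$1) * v$3 + poly (Q 2 0) (v$1) * v$2 * v$3 + poly (Q 1 1) (v$1) * (v$3)^2" for v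
    unfolding spec[OF R(2)] using R(1) Rz \<open>R 2 0 = 0\<close> \<open>R 1 1 = Q 2 0\<close> \<open>R 0 2 = Q 1 1\<close> by (subst sum_degree_two) (auto simp: algebra_simps)
  show ?thesis
    unfolding riccati_coeffs_def
    by (rule exI[of _ p], rule exI[of _ "R 0 0"], rule exI[of _ "R 1 0"], rule exI[of _ "R 0 1"], rule exI[of _ "Q 0 0"],
      rule exI[of _ "Q 1 0"], rule exI[of _ "Q 0 1"], rule exI[of _ "Q 1 1"], rule exI[of _ "Q 2 0"],
      intro allI conjI p two three)
qed

section \<open>Extension of the linear system across infinity\<close>

lemma base_dtrans_cocycle:
  "b = c \<or> x \<noteq> 0 \<Longrightarrow> (c = False \<or> base_trans b c x \<noteq> 0) \<Longrightarrow>
    base_dtrans b c x * base_dtrans c False (base_trans b c x) = base_dtrans b False x"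
  by (cases b; cases c) (auto simp: base_dtrans_def base_trans_def field_simps power2_eq_square)

lemma base_chart_Some_iff: "base_chart b w = Some x \<longleftrightarrow> (b = False \<or> w \<noteq> 0) \<and> x = base_trans b False w"
  using base_chart_eq_iff[of b w False x] by (simp add: base_chart_def)

text \<open>Applied to \<open>(1, y, z)\<close>, the matrix gives the fibre components of the field
  after subtraction of the multiple of \<open>(1, y, z)\<close> that kills the first entry; the
  negative first row supplies the quadratic terms. The 0 in the corner removes the freedom of adding
  multiples of the identity.\<close>

definition riccati_matrix ::
  "complex \<Rightarrow> complex \<Rightarrow> complex \<Rightarrow> complex \<Rightarrow> complex \<Rightarrow> complex \<Rightarrow> complex \<Rightarrow> complex \<Rightarrow> complex^3^3" where
  "riccati_matrix a b c A B C D E = vector [vector [0, - E, - D], vector [A, B, C], vector [a, b, c]]"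

lemma riccati_matrix_vector:
  "(riccati_matrix a b c A B C D E *v L) $ 1 = - E * L$2 - D * L$3"
  "(riccati_matrix a b c A B C D E *v L) $ 2 = A * L$1 + B * L$2 + C * L$3"
  "(riccati_matrix a b c A B C D E *v L) $ 3 = a * L$1 + b * L$2 + c * L$3"
  by (simp_all add: riccati_matrix_def matrix_vector_mult_def sum_3 vector_3)

lemma riccati_matrix_scale:
  "riccati_matrix (k * a) (k * b) (k * c) (k * A) (k * B) (k * C) (k * D) (k * E) *v L = k *s (riccati_matrix a b c A B C D E *v L)"
  by (simp add: vec3_eq_iff riccati_matrix_vector algebra_simps)

locale riccati_field =
  fixes F :: "generator set" and X :: "complex^3 \<Rightarrow> complex^3" and B :: "complex option set"
    and p a b c A B' C D E :: "complex poly"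
  assumes F: "singular_foliation F" and X: "given_by F X"
    and fin: "finite (- B)" and tr: "transversal_over F B"
    and form: "riccati_coeffs X p a b c A B' C D E"
begin

lemmas X_nth = form[unfolded riccati_coeffs_def, rule_format, THEN conjunct1]
  form[unfolded riccati_coeffs_def, rule_format, THEN conjunct2, THEN conjunct1]
  form[unfolded riccati_coeffs_def, rule_format, THEN conjunct2, THEN conjunct2]

lemma p_nonzero: "Some x \<in> B \<Longrightarrow> poly p x \<noteq> 0"
  using affine_base_component_nonzero[OF F X tr, of "vector [x, 0, 0]"] by (simp add: X_nth vector_3)

text \<open>The factor \<open>k\<close> combines the division by \<open>p\<close>, which makes the
  base coordinate the time, with the change of base chart.\<close>

definition M0 :: "complex \<Rightarrow> complex \<Rightarrow> complex^3^3" where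
  "M0 k x = riccati_matrix (k * poly a x) (k * poly b x) (k * poly c x) (k * poly A x) (k * poly B' x) (k * poly C x) (k * poly D x) (k * poly E x)"

lemma M0_scale: "M0 k x *v L = k *s (M0 1 x *v L)"
  using riccati_matrix_scale[of k "poly a x" "poly b x" "poly c x" "poly A x" "poly B' x" "poly C x" "poly D x" "poly E x" L]
  by (simp add: M0_def)

lemma dlift_X:
  "dlift 1 (X u) $ k = (M0 1 (u$1) *v fibre_lift 1 u) $ k - (M0 1 (u$1) *v fibre_lift 1 u) $ 1 * fibre_lift 1 u $ k"
proof -
  have l: "fibre_lift 1 u $ 1 = 1" "fibre_lift 1 u $ 2 = u$2" "fibre_lift 1 u $ 3 = u$3"
    "dlift 1 (X u) $ 1 = 0" "dlift 1 (X u) $ 2 = X u $ 2" "dlift 1 (X u) $ 3 = X u $ 3"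
    by (simp_all add: fibre_lift_def dlift_def)
  show ?thesis
    using exhaust_3[of k]
    by (elim disjE) (simp_all add: M0_def riccati_matrix_vector l X_nth power2_eq_square algebra_simps)
qed

text \<open>In the affine part of a fibre over a finite point of \<open>B\<close> the generator can
  be compared with \<open>X\<close> itself. The Riccati form survives the change of fibre chart
  because it depends on the matrix only through its projective action.\<close>

lemma riccati_at_generic_point:
  assumes gen: "(std_chart d j, U, Y) \<in> F" "v \<in> U" and x: "base_chart d (v$1) = Some x" "Some x \<in> B"
    and aff: "fibre_lift j v $ 1 \<noteq> 0"
  defines "N \<equiv> M0 (base_dtrans d False (v$1) / poly p x) x *v fibre_lift j v"
  shows "Y v $ 2 = Y v $ 1 * (N $ fst_idx j - N $ j * v $ 2)" "Y v $ 3 = Y v $ 1 * (N $ snd_idx j - N $ j * v $ 3)"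
proof -
  have v1: "d = False \<or> v$1 \<noteq> 0" "x = base_trans d False (v$1)" using x(1) by (auto simp: base_chart_Some_iff)
  define u where "u = std_coords x 1 (fibre_lift j v)"
  define l where "l = fibre_lift 1 u"
  have u1: "u$1 = x" by (simp add: u_def)
  have "std_chart False 1 u = std_chart d j v"
    unfolding std_chart_transition_iff using v1 aff by (simp add: u_def)
  then have uv: "std_chart d j v = std_chart False 1 u" ..
  then have l_j: "l $ j \<noteq> 0" and v: "v = std_coords (base_trans False d x) j l" and xd: "False = d \<or> x \<noteq> 0"
    by (auto simp: std_chart_transition_iff l_def u1)
  obtain g where g: "g \<noteq> 0" "base_dtrans False d (u$1) * X u $ 1 = g * Y v $ 1"
    "(dlift 1 (X u) $ fst_idx j * l $ j - l $ fst_idx j * dlift 1 (X u) $ j) / (l $ j)^2 = g * Y v $ 2"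
    "(dlift 1 (X u) $ snd_idx j * l $ j - l $ snd_idx j * dlift 1 (X u) $ j) / (l $ j)^2 = g * Y v $ 3"
    unfolding l_def by (rule compatible_transition[OF given_by_compatible[OF X gen(1)] UNIV_I gen(2) uv])
  define n where "n = M0 1 x *v l"
  have L: "fibre_lift j v = inverse (l $ j) *s l" unfolding v by (rule fibre_lift_std_coords[OF l_j])
  have n_lift: "(M0 1 x *v fibre_lift j v) $ k = n $ k / l $ j" for k
    by (simp add: L n_def vector_scalar_commute divide_inverse mult.commute)
  have p0: "poly p x \<noteq> 0" using p_nonzero x(2) .
  have dd: "base_dtrans d False (v$1) * base_dtrans False d x = 1"
    using base_dtrans_inverse[of False d x] xd by (simp add: v)
  have gY1: "base_dtrans d False (v$1) * (g * Y v $ 1) = poly p x"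
    using dd by (simp add: g(2)[symmetric] u1 X_nth mult.assoc[symmetric])
  have Nk: "g * (Y v $ 1 * N $ k) = n $ k / l $ j" for k
  proof -
    have "N $ k = base_dtrans d False (v$1) / poly p x * (n $ k / l $ j)"
      unfolding N_def M0_scale[of "base_dtrans d False (v$1) / poly p x"] by (simp add: n_lift)
    then have "g * (Y v $ 1 * N $ k) = (base_dtrans d False (v$1) * (g * Y v $ 1)) / poly p x * (n $ k / l $ j)"
      by simp
    then show ?thesis unfolding gY1 using p0 by simp
  qed
  have dl: "dlift 1 (X u) $ k = n $ k - n $ 1 * l $ k" for k
    unfolding dlift_X by (simp add: n_def l_def u1)
  \<comment> \<open>The terms with \<open>n $ 1\<close> cancel: adding a multiple of
    \<open>l\<close> to the tangent vector does not move the projective point.\<close>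
  have quot: "((n $ k - n $ 1 * l $ k) * l $ j - l $ k * (n $ j - n $ 1 * l $ j)) / (l $ j)^2 = n $ k / l $ j - (l $ k / l $ j) * (n $ j / l $ j)" for k
    using l_j by (simp add: field_simps power2_eq_square)
  have v23: "v $ 2 = l $ fst_idx j / l $ j" "v $ 3 = l $ snd_idx j / l $ j" by (subst v, simp)+
  have expand: "g * (Y v $ 1 * (N $ i - N $ j * z)) = g * (Y v $ 1 * N $ i) - z * (g * (Y v $ 1 * N $ j))" for i z
    by (simp add: algebra_simps)
  have "g * Y v $ 2 = g * (Y v $ 1 * (N $ fst_idx j - N $ j * v $ 2))"
    unfolding expand Nk g(3)[symmetric] dl quot v23 ..
  then show "Y v $ 2 = Y v $ 1 * (N $ fst_idx j - N $ j * v $ 2)" using g(1) by simp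
  have "g * Y v $ 3 = g * (Y v $ 1 * (N $ snd_idx j - N $ j * v $ 3))"
    unfolding expand Nk g(4)[symmetric] dl quot v23 ..
  then show "Y v $ 3 = Y v $ 1 * (N $ snd_idx j - N $ j * v $ 3)" using g(1) by simp
qed

lemma matrix_at_generic_point:
  assumes v: "base_chart d (v$1) = Some x" "d = c' \<or> v$1 \<noteq> 0" "w = base_trans d c' (v$1)" "c' = False \<or> w \<noteq> 0"
  shows "base_dtrans d c' (v$1) *s (M0 (base_dtrans c' False w / poly p x) x *v L) = M0 (base_dtrans d False (v$1) / poly p x) x *v L"
proof -
  have "base_dtrans d c' (v$1) * base_dtrans c' False w = base_dtrans d False (v$1)"
    using base_dtrans_cocycle[of d c' "v$1"] v by simp
  then show ?thesis
    by (simp only: M0_scale[of "base_dtrans c' False w / poly p x"] M0_scale[of "base_dtrans d False (v$1) / poly p x"]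
      vector_smult_assoc times_divide_eq_right)
qed

text \<open>At generic points the relation comes from \<open>X\<close>. Both sides are continuous up
  to the fibre over \<open>w0\<close> and the lines at infinity of the fibres, and generic points
  accumulate there.\<close>

lemma riccati_at_of_matrix:
  assumes gen: "(std_chart d j, U, Y) \<in> F" "v \<in> U" and v: "base_chart d (v$1) = base_chart c' w" "w \<in> ball w0 R"
    and B: "\<And>w. w \<in> ball w0 R - {w0} \<Longrightarrow> base_chart c' w \<in> B - {None}"
    and hol: "\<And>i k. (\<lambda>w. M w $ i $ k) holomorphic_on ball w0 R"
    and M: "\<And>w. w \<in> ball w0 R - {w0} \<Longrightarrow>
      M w = M0 (base_dtrans c' False w / poly p (base_trans c' False w)) (base_trans c' False w)"
  shows "riccati_at c' M d j Y v"
proof -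
  have Y: "open U" "holo_field Y U" using foliation_is_generator[OF F gen(1)] by auto
  have d: "d = c' \<or> v$1 \<noteq> 0" "w = base_trans d c' (v$1)" using v(1) by (auto simp: base_chart_eq_iff)
  define N where "N v = M (base_trans d c' (v$1)) *v fibre_lift j v" for v
  define \<Delta> where "\<Delta> i k v = Y v $ i - Y v $ 1 * base_dtrans d c' (v$1) * (N v $ k - N v $ j * v $ i)" for i k v
  have generic: "\<Delta> 2 (fst_idx j) v = 0 \<and> \<Delta> 3 (snd_idx j) v = 0"
    if v: "v \<in> U" "d = c' \<or> v$1 \<noteq> 0" "base_trans d c' (v$1) \<in> ball w0 R - {w0}" "fibre_lift j v $ 1 \<noteq> 0" for v
  proof -
    let ?w = "base_trans d c' (v$1)"
    have bc: "base_chart c' ?w = base_chart d (v$1)" using v(2) by (simp add: base_chart_trans)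
    obtain x where x: "base_chart c' ?w = Some x" "Some x \<in> B" using B[OF v(3)] by auto
    have w: "c' = False \<or> ?w \<noteq> 0" "x = base_trans c' False ?w" using x(1) by (auto simp: base_chart_Some_iff)
    have "base_dtrans d c' (v$1) *s N v = M0 (base_dtrans d False (v$1) / poly p x) x *v fibre_lift j v"
      unfolding N_def M[OF v(3)] w(2)[symmetric]
      by (rule matrix_at_generic_point[OF _ v(2) refl w(1)]) (use x(1) bc in simp)
    then have e: "(M0 (base_dtrans d False (v$1) / poly p x) x *v fibre_lift j v) $ k = base_dtrans d c' (v$1) * N v $ k" for k
      by (metis vector_smult_component)
    have "base_chart d (v$1) = Some x" using x(1) bc by simp
    from riccati_at_generic_point[OF gen(1) v(1) this x(2) v(4)]
    show ?thesis unfolding \<Delta>_def e by (simp add: algebra_simps)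
  qed
  have Mcont: "isCont (\<lambda>w. M w $ i $ k) w" for i k
    using continuous_on_interior[OF holomorphic_on_imp_continuous_on[OF hol[of i k]], of w] v(2) by simp
  have nth: "isCont (\<lambda>v::complex^3. v $ k) v" for k by (intro continuous_intros)
  have bt: "isCont (base_trans d c') (v$1)" "isCont (base_dtrans d c') (v$1)"
  proof -
    show "isCont (base_trans d c') (v$1)" using base_trans_has_derivative[OF d(1)] by (rule DERIV_isCont)
    show "isCont (base_dtrans d c') (v$1)"
      unfolding base_dtrans_def[abs_def] using d(1) by (cases "d = c'") (auto intro!: continuous_intros)
  qed
  have Ncont: "isCont (\<lambda>v. N v $ k) v" for k
  proof -
    have 1: "isCont (\<lambda>v. base_trans d c' (v$1)) v" by (rule isCont_o2[OF nth bt(1)])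
    have m1: "isCont (\<lambda>v. M (base_trans d c' (v$1)) $ k $ i) v" for i
      by (rule isCont_o2[OF 1]) (use Mcont d(2) in simp)
    have m2: "isCont (\<lambda>v. fibre_lift j v $ i) v" for i
      by (rule has_derivative_continuous[OF fibre_lift_nth_has_derivative])
    show ?thesis
      unfolding N_def matrix_vector_mult_def vec_lambda_beta by (intro continuous_sum continuous_mult m1 m2)
  qed
  have Ycont: "isCont (\<lambda>v. Y v $ k) v" for k
    using holo_field_isCont[OF Y(2) gen(2)] by (intro continuous_intros)
  have dcont: "isCont (\<lambda>v. base_dtrans d c' (v$1)) v" by (rule isCont_o2[OF nth bt(2)])
  have \<Delta>cont: "isCont (\<Delta> i k) v" for i k
    unfolding \<Delta>_def by (intro continuous_intros Ycont dcont Ncont nth)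
  \<comment> \<open>One parameter moves the base coordinate and the second coordinate together. For
    \<open>j \<noteq> 1\<close> the latter is the first homogeneous coordinate, so small
    \<open>e\<close> outside two values lead off the line at infinity and off the fibre over
    \<open>w0\<close>.\<close>
  define V where "V e = v + (axis 1 e + axis 2 e)" for e
  have Vn: "V e $ 1 = v$1 + e" "V e $ 2 = v$2 + e" "V e $ 3 = v$3" for e
    by (simp_all add: V_def axis_def)
  have V0: "V 0 = v" by (simp add: vec3_eq_iff Vn)
  have Vcont: "isCont V 0"
  proof (rule isCont_vec)
    fix k show "isCont (\<lambda>e. V e $ k) 0" using exhaust_3[of k] by (elim disjE) (simp_all add: Vn)
  qed
  have ev1: "eventually (\<lambda>e. V e \<in> U) (nhds 0)"
    using eventually_nhds_isCont_open[OF Vcont Y(1)] gen(2) V0 by simp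
  have ev2: "eventually (\<lambda>e. d = c' \<or> V e $ 1 \<noteq> 0) (nhds 0)"
  proof (cases "d = c'")
    case False
    have "isCont (\<lambda>e. V e $ 1) 0" by (simp add: Vn)
    then have "eventually (\<lambda>e. V e $ 1 \<noteq> 0) (nhds 0)"
      using d(1) False by (intro eventually_nonzero_nhds) (auto simp: Vn)
    then show ?thesis by (rule eventually_mono) simp
  qed simp
  have ev3: "eventually (\<lambda>e. base_trans d c' (V e $ 1) \<in> ball w0 R) (nhds 0)"
  proof -
    have "isCont (\<lambda>e. V e $ 1) 0" by (simp add: Vn)
    then have "isCont (\<lambda>e. base_trans d c' (V e $ 1)) 0" by (rule isCont_o2) (use bt(1) in \<open>simp add: Vn\<close>)
    from eventually_nhds_isCont_open[OF this open_ball, of w0 R] show ?thesis using v(2) d(2) by (simp add: Vn)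
  qed
  have ev4: "eventually (\<lambda>e. e \<noteq> - (v$2)) (at 0)" "eventually (\<lambda>e. e \<noteq> base_trans c' d w0 - v$1) (at 0)"
    by (rule eventually_neq_at_within)+
  have "eventually (\<lambda>e. \<Delta> 2 (fst_idx j) (V e) = 0 \<and> \<Delta> 3 (snd_idx j) (V e) = 0) (at 0)"
    using ev4 ev1[THEN filter_leD[OF at_within_le_nhds]] ev2[THEN filter_leD[OF at_within_le_nhds]]
      ev3[THEN filter_leD[OF at_within_le_nhds]]
  proof eventually_elim
    case (elim e)
    have "fibre_lift j (V e) $ 1 \<noteq> 0"
      using elim(1) exhaust_3[of j] by (auto simp: fibre_lift_def Vn add_eq_0_iff2)
    moreover have "base_trans d c' (V e $ 1) \<noteq> w0"
    proof
      assume "base_trans d c' (V e $ 1) = w0"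
      then have "V e $ 1 = base_trans c' d w0" using base_trans_inverse[OF elim(4)] by simp
      then show False using elim(2) by (simp add: Vn algebra_simps)
    qed
    ultimately show ?case using elim by (intro generic) auto
  qed
  then have "\<Delta> 2 (fst_idx j) v = 0" "\<Delta> 3 (snd_idx j) v = 0"
  proof -
    assume ev: "eventually (\<lambda>e. \<Delta> 2 (fst_idx j) (V e) = 0 \<and> \<Delta> 3 (snd_idx j) (V e) = 0) (at 0)"
    have lim: "((\<lambda>e. \<Delta> i k (V e)) \<longlongrightarrow> \<Delta> i k v) (at 0)" for i k
      using isCont_o2[OF Vcont, of "\<Delta> i k"] \<Delta>cont by (simp add: isCont_def V0)
    have "eventually (\<lambda>e. \<Delta> 2 (fst_idx j) (V e) = 0) (at 0)" using ev by (rule eventually_mono) simp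
    from Lim_transform_eventually[OF lim[of 2 "fst_idx j"] this]
    have "((\<lambda>e::complex. 0::complex) \<longlongrightarrow> \<Delta> 2 (fst_idx j) v) (at 0)" .
    then show "\<Delta> 2 (fst_idx j) v = 0" by (simp add: tendsto_const_iff)
    have "eventually (\<lambda>e. \<Delta> 3 (snd_idx j) (V e) = 0) (at 0)" using ev by (rule eventually_mono) simp
    from Lim_transform_eventually[OF lim[of 3 "snd_idx j"] this]
    have "((\<lambda>e::complex. 0::complex) \<longlongrightarrow> \<Delta> 3 (snd_idx j) v) (at 0)" .
    then show "\<Delta> 3 (snd_idx j) v = 0" by (simp add: tendsto_const_iff)
  qed
  then show ?thesis
    by (simp add: \<Delta>_def N_def riccati_at_def Let_def mult.commute[of "v $ _"])
qed

text \<open>The coefficients of the linear system extend across every point of \<open>B\<close>, in particular across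
  infinity, because they are finite differences of the normalised generator in the directions of the fibre.\<close>

lemma riccati_matrix_near:
  assumes q: "q \<in> B"
  shows "\<exists>d w0 R M. q = base_chart d w0 \<and> R > 0 \<and> (\<forall>i k. (\<lambda>w. M w $ i $ k) holomorphic_on ball w0 R) \<and>
    (\<forall>w\<in>ball w0 R - {w0}. base_chart d w \<in> B - {None} \<and>
      M w = M0 (base_dtrans d False w / poly p (base_trans d False w)) (base_trans d False w))"
proof -
  \<comment> \<open>The point \<open>[1:0:0]\<close> lies in the fibre chart \<open>j = 1\<close>
    only, so the generator there uses the fibre coordinates of the affine chart.\<close>
  let ?L = "axis 1 1 :: complex^3"
  have L: "?L \<noteq> 0" by (simp add: axis_eq_0_iff)
  obtain d j U Y u where gen: "(std_chart d j, U, Y) \<in> F" "u \<in> U" "std_chart d j u = (q, abs_cp2 ?L)"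
    by (rule foliation_generator_at[OF F])
  have Y: "open U" "holo_field Y U" using foliation_is_generator[OF F gen(1)] by auto
  define w0 where "w0 = u$1"
  have q0: "q = base_chart d w0" using gen(3) by (simp add: std_chart_def w0_def)
  have "?L $ j \<noteq> 0" and u: "u = std_coords w0 j ?L"
    using std_chart_eq_iff[OF L, of d j u w0] gen(3) unfolding q0 by auto
  then have j: "j = 1" by (auto simp: axis_def split: if_splits)
  have u: "u = vector [w0, 0, 0]" using u by (simp add: j vec3_eq_iff vector_3 axis_def)
  obtain \<delta> where \<delta>: "\<delta> > 0" "ball u \<delta> \<subseteq> U" using Y(1) gen(2) by (auto elim: openE)
  have "finite (- (B - {None}))" using fin by (simp add: Compl_Diff_eq)
  from finite_complement_punctured[OF this, of w0 d]
  obtain e where e: "e > 0" "\<forall>w\<in>ball w0 e - {w0}. base_chart d w \<in> B - {None}" by auto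
  \<comment> \<open>Three displacements of at most a quarter of \<delta> keep \<open>v s t w\<close>
    inside the ball around \<open>u\<close>.\<close>
  define R where "R = min e (\<delta>/4)"
  define \<eta> where "\<eta> = complex_of_real (\<delta>/4)"
  define v where "v s t w = (vector [w, s, t] :: complex^3)" for s t w
  have \<eta>: "\<eta> \<noteq> 0" "norm \<eta> = \<delta>/4" using \<delta>(1) by (simp_all add: \<eta>_def)
  have vU: "v s t w \<in> U" if "norm s \<le> \<delta>/4" "norm t \<le> \<delta>/4" "w \<in> ball w0 R" for s t w
  proof -
    have "norm (v s t w - u) \<le> norm (w - w0) + norm s + norm t"
      using L2_set_le_sum[of UNIV "\<lambda>i. norm ((v s t w - u) $ i)"]
      by (simp add: norm_vec_def sum_3 v_def u vector_3)
    also have "\<dots> < \<delta>" using that \<delta>(1) by (simp add: R_def dist_norm norm_minus_commute)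
    finally show ?thesis using \<delta>(2) by (auto simp: dist_norm norm_minus_commute)
  qed
  have v_nth: "v s t w $ 1 = w" "v s t w $ 2 = s" "v s t w $ 3 = t" for s t w by (simp_all add: v_def vector_3)
  have inB: "base_chart d w \<in> B" if "w \<in> ball w0 R" for w
    using e(2) that q q0 by (cases "w = w0") (auto simp: R_def)
  have Y1: "Y (v s t w) $ 1 \<noteq> 0" if "norm s \<le> \<delta>/4" "norm t \<le> \<delta>/4" "w \<in> ball w0 R" for s t w
    by (rule transversal_overD[OF tr gen(1) vU[OF that]]) (use inB that(3) in \<open>simp add: v_nth\<close>)
  \<comment> \<open>Dividing by the base component removes the arbitrary factor of the generator and
    leaves functions holomorphic at \<open>w0\<close> too.\<close>
  define f where "f k s t w = Y (v s t w) $ k / Y (v s t w) $ 1" for k s t w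
  have hol: "f k s t holomorphic_on ball w0 R" if "norm s \<le> \<delta>/4" "norm t \<le> \<delta>/4" for k s t
    unfolding holomorphic_on_def
  proof
    fix w assume w: "w \<in> ball w0 R"
    have "((\<lambda>w. v s t w $ i) has_field_derivative ?L $ i) (at w)" for i
      using exhaust_3[of i] by (elim disjE) (simp_all add: v_nth axis_def)
    then have "(\<lambda>w. Y (v s t w) $ i) field_differentiable at w" for i
      by (intro holo_fun_compose_curve[of "\<lambda>v. Y v $ i" U "v s t"]) (use Y(2) vU[OF that w] in \<open>auto simp: holo_field_def\<close>)
    then have "f k s t field_differentiable at w"
      unfolding f_def[abs_def] using Y1[OF that w] by (intro field_differentiable_divide)
    then show "f k s t field_differentiable at w within ball w0 R" by (rule field_differentiable_at_within)
  qed
  \<comment> \<open>For \<open>w \<noteq> w0\<close> the functions \<open>f 2\<close> and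
    \<open>f 3\<close> are quadratic in \<open>(s, t)\<close>, so first and second differences with
    step \<eta> return their coefficients exactly. One-sided differences are used where the square
    is absent: \<open>f 3\<close> has no \<open>s^2\<close>, \<open>f 2\<close> no
    \<open>t^2\<close>.\<close>
  define M where "M w = riccati_matrix (f 3 0 0 w) ((f 3 \<eta> 0 w - f 3 0 0 w) / \<eta>) ((f 3 0 \<eta> w - f 3 0 (- \<eta>) w) / (2 * \<eta>))
     (f 2 0 0 w) ((f 2 \<eta> 0 w - f 2 (- \<eta>) 0 w) / (2 * \<eta>)) ((f 2 0 \<eta> w - f 2 0 0 w) / \<eta>)
     ((f 3 0 \<eta> w + f 3 0 (- \<eta>) w - 2 * f 3 0 0 w) / (2 * \<eta>^2))
     ((f 2 \<eta> 0 w + f 2 (- \<eta>) 0 w - 2 * f 2 0 0 w) / (2 * \<eta>^2))" for w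
  have "(\<lambda>w. M w $ i $ k) holomorphic_on ball w0 R" for i k
    using exhaust_3[of i] exhaust_3[of k] \<eta> \<delta>(1)
    by (elim disjE) (auto simp: M_def riccati_matrix_def vector_3 intro!: holomorphic_intros hol)
  moreover have "M w = M0 (base_dtrans d False w / poly p (base_trans d False w)) (base_trans d False w)"
    if w: "w \<in> ball w0 R - {w0}" for w
  proof -
    have "base_chart d w \<in> B - {None}" using bspec[OF e(2), of w] w by (simp add: R_def)
    then obtain x where x: "base_chart d w = Some x" "Some x \<in> B" by (cases "base_chart d w") auto
    have x': "x = base_trans d False w" using x(1) by (simp add: base_chart_Some_iff)
    define k where "k = base_dtrans d False w / poly p x"
    have eqs: "f 2 s t w = k * poly A x + k * poly B' x * s + k * poly C x * t + k * poly D x * s * t + k * poly E x * s^2"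
      "f 3 s t w = k * poly a x + k * poly b x * s + k * poly c x * t + k * poly E x * s * t + k * poly D x * t^2"
      if st: "norm s \<le> \<delta>/4" "norm t \<le> \<delta>/4" for s t
    proof -
      have l: "fibre_lift 1 (v s t w) $ 1 = 1" "fibre_lift 1 (v s t w) $ 2 = s" "fibre_lift 1 (v s t w) $ 3 = t"
        by (simp_all add: fibre_lift_def v_nth)
      have vw: "v s t w \<in> U" "Y (v s t w) $ 1 \<noteq> 0" using vU Y1 st w by auto
      let ?N = "M0 k x *v fibre_lift 1 (v s t w)"
      have "Y (v s t w) $ 2 = Y (v s t w) $ 1 * (?N $ 2 - ?N $ 1 * s)"
        "Y (v s t w) $ 3 = Y (v s t w) $ 1 * (?N $ 3 - ?N $ 1 * t)"
        using riccati_at_generic_point[OF gen(1)[unfolded j] vw(1), unfolded v_nth, OF x] by (simp_all add: l k_def)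
      then have "f 2 s t w = ?N $ 2 - ?N $ 1 * s" "f 3 s t w = ?N $ 3 - ?N $ 1 * t"
        using vw(2) by (simp_all add: f_def)
      then show "f 2 s t w = k * poly A x + k * poly B' x * s + k * poly C x * t + k * poly D x * s * t + k * poly E x * s^2"
        "f 3 s t w = k * poly a x + k * poly b x * s + k * poly c x * t + k * poly E x * s * t + k * poly D x * t^2"
        by (simp_all add: M0_def riccati_matrix_vector l algebra_simps power2_eq_square)
    qed
    show ?thesis
      unfolding M_def x'[symmetric] k_def[symmetric] M0_def
      using \<eta> \<delta>(1) by (simp add: eqs power2_eq_square algebra_simps)
  qed
  moreover have "R > 0" using e(1) \<delta>(1) by (simp add: R_def)
  moreover have "base_chart d w \<in> B - {None}" if "w \<in> ball w0 R - {w0}" for w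
    using e(2) that by (simp add: R_def)
  ultimately show ?thesis
    using q0 by (intro exI[of _ d] exI[of _ w0] exI[of _ R] exI[of _ M] conjI allI ballI)
qed

end

section \<open>Extending transversality across a fibre\<close>

lemma openin_sphere_finite_complement:
  assumes "finite (- B)" shows "openin sphere_top B"
  unfolding openin_sphere_iff
proof
  fix c
  have "finite {w. base_chart c w \<in> - B}"
    using finite_vimageI[OF assms, of "base_chart c"] by (simp add: inj_def vimage_def)
  then have "open (- {w. base_chart c w \<in> - B})" by (intro open_Compl finite_imp_closed)
  moreover have "- {w. base_chart c w \<in> - B} = {w. base_chart c w \<in> B}" by auto
  ultimately show "open {w. base_chart c w \<in> B}" by simp
qed

section \<open>Restriction of a foliation to a union of fibres\<close>

lemma restrict_foliation_iff:
  "(\<phi>, U', Y) \<in> restrict_foliation F M \<longleftrightarrow> (\<exists>U. (\<phi>, U, Y) \<in> F \<and> U' = {v\<in>U. \<phi> v \<in> M})"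
  by (auto simp: restrict_foliation_def)

lemma restrict_foliation_is_generator:
  assumes F: "singular_foliation F" and fin: "finite (- B)" and H: "H \<in> restrict_foliation F (fst -` B)"
  shows "is_generator H"
proof -
  obtain \<phi> U Y where H: "H = (\<phi>, {v\<in>U. \<phi> v \<in> fst -` B}, Y)" "(\<phi>, U, Y) \<in> F"
    using H by (auto simp: restrict_foliation_def)
  let ?U = "{v\<in>U. \<phi> v \<in> fst -` B}"
  have G: "\<phi> \<in> total_charts" "open U" "holo_field Y U" "interior {v\<in>U. Y v = 0} = {}"
    using foliation_is_generator[OF F H(2)] by auto
  then obtain b j where \<phi>: "\<phi> = std_chart b j" by (auto simp: total_charts_eq)
  have "open {w. base_chart b w \<in> B}"
    using openin_sphere_finite_complement[OF fin] by (simp add: openin_sphere_iff)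
  then have "open ((\<lambda>v::complex^3. v$1) -` {w. base_chart b w \<in> B})"
    by (rule open_vimage_vec_nth)
  moreover have "?U = U \<inter> (\<lambda>v. v$1) -` {w. base_chart b w \<in> B}" by (auto simp: \<phi> std_chart_def)
  ultimately have "open ?U" using G(2) by auto
  moreover have "holo_field Y ?U" using G(3) unfolding holo_field_def holo_fun_def by auto
  moreover have "interior {v\<in>?U. Y v = 0} = {}"
    using interior_mono[of "{v\<in>?U. Y v = 0}" "{v\<in>U. Y v = 0}"] G(4) by auto
  ultimately show ?thesis using G(1) H(1) by simp
qed

lemma integral_arcs_restrict_mono:
  assumes "M \<subseteq> M'" shows "integral_arcs (restrict_foliation F M) \<subseteq> integral_arcs (restrict_foliation F M')"
proof
  fix P assume "P \<in> integral_arcs (restrict_foliation F M)"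
  then obtain \<phi> U Y \<gamma> D where P: "P = \<phi> ` \<gamma> ` D" "(\<phi>, U, Y) \<in> F" "open D" "connected D" "\<gamma> ` D \<subseteq> {v\<in>U. \<phi> v \<in> M}"
    "\<forall>t\<in>D. Y (\<gamma> t) \<noteq> 0 \<and> (\<gamma> has_derivative (\<lambda>h. h *s Y (\<gamma> t))) (at t)"
    unfolding integral_arcs_def restrict_foliation_iff by auto
  have "(\<phi>, {v\<in>U. \<phi> v \<in> M'}, Y) \<in> restrict_foliation F M'" using P(2) by (auto simp: restrict_foliation_iff)
  moreover have "\<gamma> ` D \<subseteq> {v\<in>U. \<phi> v \<in> M'}" using P(5) assms by auto
  ultimately show "P \<in> integral_arcs (restrict_foliation F M')"
    unfolding integral_arcs_def using P
    by (intro CollectI exI[of _ \<phi>] exI[of _ "{v\<in>U. \<phi> v \<in> M'}"] exI[of _ Y] exI[of _ \<gamma>] exI[of _ D]) simp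
qed

lemma integral_arcs_restrict_over:
  assumes "P \<in> integral_arcs (restrict_foliation F M)" shows "P \<subseteq> M"
  using assms unfolding integral_arcs_def restrict_foliation_iff by auto

lemma flow_box_subtopology:
  assumes fb: "flow_box A X f V S" and "V \<subseteq> B"
  shows "flow_box A (subtopology X B) f V S"
proof -
  note D = flow_boxD[OF fb]
  have op: "openin (subtopology X B) W \<longleftrightarrow> openin X W" if "W \<subseteq> V" for W
  proof
    assume "openin (subtopology X B) W"
    then obtain W' where "openin X W'" "W = W' \<inter> B" by (auto simp: openin_subtopology)
    then have "W = W' \<inter> V" using that assms(2) by auto
    then show "openin X W" using \<open>openin X W'\<close> D(1) by auto
  next
    assume "openin X W"
    then show "openin (subtopology X B) W" using that assms(2) by (auto simp: openin_subtopology)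
  qed
  have f1: "openin (subtopology X B) V" using D(1) op by simp
  have f2: "connectedin (subtopology X B) V" using D(2) assms(2) by (simp add: connectedin_subtopology)
  have f6: "\<exists>P\<in>A. s x \<in> P \<and> P \<subseteq> s ` W" if "s \<in> S" "openin (subtopology X B) W" "x \<in> W" "W \<subseteq> V" for s x W
    using D(6)[OF that(1) _ that(3,4)] that(2) op[OF that(4)] by simp
  have f7: "\<exists>W. openin (subtopology X B) W \<and> x \<in> W \<and> W \<subseteq> V \<and> s ` W \<subseteq> P"
    if "s \<in> S" "x \<in> V" "P \<in> A" "s x \<in> P" for s x P
  proof -
    from D(7)[OF that] obtain W where W: "openin X W" "x \<in> W" "W \<subseteq> V" "s ` W \<subseteq> P" by auto
    then show ?thesis using op[OF W(3)] by (intro exI[of _ W]) simp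
  qed
  show ?thesis
    unfolding flow_box_def
    by (intro conjI ballI allI impI f1 f2 D(3) D(4) f6 f7; (elim conjE)?; (assumption | rule D(5), assumption+))
qed

text \<open>The matrix near \<open>q\<close> is holomorphic even if \<open>q\<close> is infinity,
  and its fundamental matrix gives a flow box on a smaller disc.\<close>

lemma transversal_flow_box:
  assumes F: "singular_foliation F" and pf: "poly_field X" and X: "given_by F X"
    and fin: "finite (- B)" and tr: "transversal_over F B" and q: "q \<in> B"
  shows "\<exists>V S. q \<in> V \<and> V \<subseteq> B \<and> flow_box (integral_arcs (restrict_foliation F (fst -` B))) sphere_top fst V S"
proof -
  obtain p a b c A B' C D E where form: "riccati_coeffs X p a b c A B' C D E"
    using riccati_form[OF F pf X fin tr] by blast
  then interpret riccati_field F X B p a b c A B' C D E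
    using F X fin tr by unfold_locales
  obtain d w0 R M where near: "q = base_chart d w0" "R > 0" "\<forall>i k. (\<lambda>w. M w $ i $ k) holomorphic_on ball w0 R"
    "\<forall>w\<in>ball w0 R - {w0}. base_chart d w \<in> B - {None} \<and>
      M w = M0 (base_dtrans d False w / poly p (base_trans d False w)) (base_trans d False w)"
    using riccati_matrix_near[OF q] by (elim exE conjE)
  have hol: "(\<lambda>w. M w $ i $ k) holomorphic_on ball w0 R" for i k using near(3) by simp
  have punct: "base_chart d w \<in> B - {None}"
    "M w = M0 (base_dtrans d False w / poly p (base_trans d False w)) (base_trans d False w)"
    if "w \<in> ball w0 R - {w0}" for w
    using bspec[OF near(4) that] by (rule conjunct1, rule conjunct2)
  show ?thesis
  proof (rule fundamental_matrix[OF hol near(2)])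
    fix r and \<Phi> \<Psi> :: "complex \<Rightarrow> complex^3^3"
    assume r: "0 < r" "r \<le> R"
      and fund: "\<And>w i j. w \<in> ball w0 r \<Longrightarrow> ((\<lambda>w. \<Phi> w $ i $ j) has_field_derivative (M w ** \<Phi> w) $ i $ j) (at w)"
      "\<And>w i j. w \<in> ball w0 r \<Longrightarrow> ((\<lambda>w. \<Psi> w $ i $ j) has_field_derivative - (\<Psi> w ** M w) $ i $ j) (at w)"
      "\<And>w. w \<in> ball w0 r \<Longrightarrow> \<Psi> w ** \<Phi> w = mat 1" "\<And>w. w \<in> ball w0 r \<Longrightarrow> \<Phi> w ** \<Psi> w = mat 1"
    let ?G = "restrict_foliation F (fst -` B)"
    have inB: "base_chart d w \<in> B" if "w \<in> ball w0 r" for w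
      using punct(1)[of w] that q near(1) r(2) by (cases "w = w0") auto
    interpret linear_flow ?G d w0 r M \<Phi> \<Psi>
    proof
      fix H assume "H \<in> ?G"
      then show "is_generator H" by (rule restrict_foliation_is_generator[OF F fin])
    next
      fix x :: total assume x: "fst x \<in> base_chart d ` ball w0 r"
      obtain b j U Y u where gen: "(std_chart b j, U, Y) \<in> F" "u \<in> U" "std_chart b j u = x"
        by (rule foliation_generator_at[OF F])
      have "fst x \<in> B" using x inB by auto
      then have "u \<in> {v\<in>U. std_chart b j v \<in> fst -` B}" using gen by simp
      moreover have "(std_chart b j, {v\<in>U. std_chart b j v \<in> fst -` B}, Y) \<in> ?G"
        using gen(1) unfolding restrict_foliation_iff by auto
      ultimately show "\<exists>b j U Y u. (std_chart b j, U, Y) \<in> ?G \<and> u \<in> U \<and> std_chart b j u = x"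
        using gen(3) by (intro exI[of _ b] exI[of _ j] exI[of _ "{v\<in>U. std_chart b j v \<in> fst -` B}"] exI[of _ Y] exI[of _ u]) simp
    next
      fix b j U' Y v
      assume gen': "(std_chart b j, U', Y) \<in> ?G" "v \<in> U'" "base_chart b (v$1) \<in> base_chart d ` ball w0 r"
      then obtain U where gen: "(std_chart b j, U, Y) \<in> F" "v \<in> U" by (auto simp: restrict_foliation_iff)
      obtain w where w: "w \<in> ball w0 r" "base_chart b (v$1) = base_chart d w" using gen'(3) by auto
      have "Y v $ 1 \<noteq> 0" by (rule transversal_overD[OF tr gen]) (use w inB in simp)
      moreover have "riccati_at d M b j Y v"
        by (rule riccati_at_of_matrix[OF gen w(2) _ punct(1) hol punct(2)]) (use w(1) r(2) in auto)
      ultimately show "Y v $ 1 \<noteq> 0 \<and> riccati_at d M b j Y v" ..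
    qed (use r(1) fund in auto)
    obtain S where "flow_box (integral_arcs ?G) sphere_top fst (base_chart d ` ball w0 r) S"
      using flow_box_sheets by auto
    then show ?thesis
      using near(1) r(1) inB by (intro exI[of _ "base_chart d ` ball w0 r"] exI[of _ S]) auto
  qed
qed

text \<open>The starting point of the extension: nonvanishing base components, finitely many
  excluded fibres, and the global part of the covering property, namely that each leaf meets every
  fibre over \<open>B\<close>.\<close>

lemma transverse_off_transversal_over:
  assumes F: "singular_foliation F" and off: "transverse_off F (fst -` (- B))"
  shows "transversal_over F B" "B \<noteq> {}" "finite (- B)"
    "\<And>p. fst p \<in> B \<Longrightarrow> B \<subseteq> fst ` arc_leaf (integral_arcs (restrict_foliation F (fst -` B))) p"
proof -
  obtain B' where B': "fst -` (- B) = (fst -` (- B') :: total set)"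
    and tf: "transverse_to_fibration (restrict_foliation F (- (fst -` (- B)))) B'"
    using off unfolding transverse_off_def by (elim conjE exE) (rule that)
  have "B' = B"
  proof -
    have "x \<in> B \<longleftrightarrow> x \<in> B'" for x
      using B' by (auto simp: set_eq_iff)
    then show ?thesis by auto
  qed
  moreover have "- (fst -` (- B)) = (fst -` B :: total set)" by auto
  ultimately have tf: "transverse_to_fibration (restrict_foliation F (fst -` B)) B" using tf by simp
  show "transversal_over F B"
    unfolding transversal_over_def
  proof (intro allI impI)
    fix b j U Y u assume gen: "(std_chart b j, U, Y) \<in> F" "u \<in> U" "base_chart b (u$1) \<in> B"
    have "(std_chart b j, {v\<in>U. std_chart b j v \<in> fst -` B}, Y) \<in> restrict_foliation F (fst -` B)"
      using gen(1) by (auto simp: restrict_foliation_iff)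
    moreover have "transverse_at_points (restrict_foliation F (fst -` B))"
      using tf by (simp add: transverse_to_fibration_def)
    ultimately have "case (std_chart b j, {v\<in>U. std_chart b j v \<in> fst -` B}, Y) of (\<phi>, U, Y) \<Rightarrow>
        \<forall>v\<in>U. {c *s Y v + w | c w. w$1 = 0} = UNIV"
      unfolding transverse_at_points_def by (rule bspec[rotated])
    then have "\<forall>v\<in>{v\<in>U. std_chart b j v \<in> fst -` B}. {c *s Y v + w | c w. w$1 = 0} = UNIV"
      by (simp only: prod.case)
    moreover have "u \<in> {v\<in>U. std_chart b j v \<in> fst -` B}" using gen(2,3) by (simp add: std_chart_def)
    ultimately have "{c *s Y u + w | c w. w$1 = 0} = UNIV" by (rule bspec)
    \<comment> \<open>A vector pointing off the fibre must receive its first entry from the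
      generator.\<close>
    then obtain c w where "axis 1 1 = c *s Y u + w" "w$1 = 0" by blast
    then have "(axis 1 1 :: complex^3) $ 1 = c * Y u $ 1" by simp
    then show "Y u $ 1 \<noteq> 0" by (auto simp: axis_def)
  qed
  show "B \<noteq> {}" using off by (auto simp: transverse_off_def)
  show "finite (- B)" using off by (intro analytic_subset_fibres_finite) (simp_all add: transverse_off_def)
  show "B \<subseteq> fst ` arc_leaf (integral_arcs (restrict_foliation F (fst -` B))) p" if p: "fst p \<in> B" for p
  proof -
    let ?F = "restrict_foliation F (fst -` B)"
    have "covering_map (leaf_top ?F p) (subtopology sphere_top B) fst"
      using tf p unfolding transverse_to_fibration_def by (simp del: split_paired_All)
    then have "fst ` topspace (leaf_top ?F p) = topspace (subtopology sphere_top B)"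
      unfolding covering_map_def by simp
    moreover have "topspace (leaf_top ?F p) \<subseteq> arc_leaf (integral_arcs ?F) p"
      by (auto simp: leaf_top_def leaf_eq_arc_leaf)
    moreover have "topspace (subtopology sphere_top B) = B" using topspace_sphere by auto
    ultimately show ?thesis by blast
  qed
qed

text \<open>Flow boxes give the local covering structure over the enlarged base. For surjectivity,
  old leaves are contained in new ones, and the sheets of a flow box around \<open>x1\<close>
  connect the fibre over \<open>x1\<close> with fibres over \<open>B\<close>.\<close>

lemma transverse_off_insert:
  assumes F: "singular_foliation F" and pf: "poly_field X" and X: "given_by F X"
    and off: "transverse_off F (fst -` (- B))" and nv: "\<And>q. \<not> vertical_at F (x1, q)"
  shows "transverse_off F (fst -` (- insert x1 B))"
proof -
  note old = transverse_off_transversal_over[OF F off]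
  define B' where "B' = insert x1 B"
  let ?F = "restrict_foliation F (fst -` B')"
  have fin: "finite (- B')" using old(3) by (rule finite_subset[rotated]) (auto simp: B'_def)
  have tr: "transversal_over F B'"
    unfolding transversal_over_def
  proof (intro allI impI)
    fix b j U Y u assume gen: "(std_chart b j, U, Y) \<in> F" "u \<in> U" "base_chart b (u$1) \<in> B'"
    show "Y u $ 1 \<noteq> 0"
    proof (cases "base_chart b (u$1) = x1")
      case True
      then have "std_chart b j u = (x1, abs_cp2 (fibre_lift j u))" by (simp add: std_chart_def)
      then show ?thesis using nv vertical_at_iff[OF F gen(1,2)] by simp
    next
      case False
      then show ?thesis using transversal_overD[OF old(1) gen(1,2)] gen(3) by (simp add: B'_def)
    qed
  qed
  have Y1: "Y v $ 1 \<noteq> 0" if gen: "(\<phi>, U, Y) \<in> ?F" "v \<in> U" for \<phi> U Y v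
  proof -
    obtain U0 where U0: "(\<phi>, U0, Y) \<in> F" "v \<in> U0" "\<phi> v \<in> fst -` B'" using gen by (auto simp: restrict_foliation_iff)
    have "\<phi> \<in> total_charts" using foliation_is_generator[OF F U0(1)] by simp
    then obtain b j where \<phi>: "\<phi> = std_chart b j" by (auto simp: total_charts_eq)
    show ?thesis by (rule transversal_overD[OF tr U0(1)[unfolded \<phi>] U0(2)]) (use U0(3) in \<open>simp add: \<phi> std_chart_def\<close>)
  qed
  have sing: "singular_set ?F = {}"
    unfolding singular_set_def using Y1 by fastforce
  have at_pts: "transverse_at_points ?F"
    unfolding transverse_at_points_def
  proof (intro ballI, clarify)
    fix \<phi> U Y v assume gen: "(\<phi>, U, Y) \<in> ?F" "v \<in> U"
    have "z \<in> {c *s Y v + w | c w. w$1 = 0}" for z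
    proof -
      have "z = (z$1 / Y v $ 1) *s Y v + (z - (z$1 / Y v $ 1) *s Y v)" by simp
      moreover have "(z - (z$1 / Y v $ 1) *s Y v) $ 1 = 0" using Y1[OF gen] by simp
      ultimately show ?thesis by blast
    qed
    then show "{c *s Y v + w | c w. w$1 = 0} = UNIV" by auto
  qed
  have "covering_map (leaf_top ?F p) (subtopology sphere_top B') fst" if p: "fst p \<in> B'" for p
  proof -
    let ?A = "integral_arcs ?F" and ?Aold = "integral_arcs (restrict_foliation F (fst -` B))"
    have topB: "topspace (subtopology sphere_top B') = B'" using topspace_sphere by auto
    have boxes: "\<exists>V S. q \<in> V \<and> V \<subseteq> B' \<and> flow_box ?A sphere_top fst V S" if "q \<in> B'" for q
      by (rule transversal_flow_box[OF F pf X fin tr that])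
    have sub: "?Aold \<subseteq> ?A" by (rule integral_arcs_restrict_mono) (auto simp: B'_def)
    have old_leaf: "B \<subseteq> fst ` arc_leaf ?A q" if "fst q \<in> B" for q
      by (rule subset_trans[OF old(4)[OF that] image_mono[OF arc_leaf_mono[OF sub]]])
    obtain V S where V: "x1 \<in> V" "flow_box ?A sphere_top fst V S" using boxes[of x1] by (auto simp: B'_def)
    note VD = flow_boxD[OF V(2)]
    \<comment> \<open>Excluded points are isolated, so the flow box around \<open>x1\<close> reaches
      into \<open>B\<close>.\<close>
    obtain b1 where b1: "b1 \<in> V" "b1 \<in> B"
    proof -
      obtain d w1 where w1: "x1 = base_chart d w1" by (rule base_chart_cases)
      have "open {w. base_chart d w \<in> V}" "w1 \<in> {w. base_chart d w \<in> V}"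
        using VD(1) V(1) w1 by (simp_all add: openin_sphere_iff)
      then obtain e where e: "e > 0" "ball w1 e \<subseteq> {w. base_chart d w \<in> V}" by (auto elim: openE)
      obtain e' where e': "e' > 0" "\<forall>w\<in>ball w1 e' - {w1}. base_chart d w \<in> B"
        using finite_complement_punctured[OF old(3)] by blast
      define w where "w = w1 + of_real (min e e' / 2)"
      have "w \<in> ball w1 e" "w \<in> ball w1 e' - {w1}" using e(1) e'(1) by (auto simp: w_def dist_norm)
      then show ?thesis using e(2) e'(2) by (intro that[of "base_chart d w"]) auto
    qed
    have surj: "B' \<subseteq> fst ` arc_leaf ?A p"
    proof (cases "fst p \<in> B")
      case True
      have "b1 \<in> fst ` arc_leaf ?A p" using old_leaf[OF True] b1(2) by auto
      then obtain q where q: "q \<in> arc_leaf ?A p" "fst q = b1" by auto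
      then obtain s where s: "s \<in> S" "s b1 = q" using VD(4)[of q] b1(1) by auto
      have "s ` V \<subseteq> arc_leaf ?A p"
        by (rule flow_box_sheet_subset_leaf[OF V(2) s(1) b1(1)]) (simp add: s(2) q(1))
      then have "s x1 \<in> arc_leaf ?A p" using V(1) by auto
      then have "x1 \<in> fst ` arc_leaf ?A p" using VD(3)[OF s(1) V(1)] by (metis imageI)
      then show ?thesis using old_leaf[OF True] by (simp add: B'_def)
    next
      case False
      then have p1: "fst p = x1" using p by (simp add: B'_def)
      then obtain s where s: "s \<in> S" "s x1 = p" using VD(4)[of p] V(1) by auto
      have "s ` V \<subseteq> arc_leaf ?A p"
        by (rule flow_box_sheet_subset_leaf[OF V(2) s(1) V(1)]) (simp add: s(2) arc_leaf_refl)
      then have sb: "s b1 \<in> arc_leaf ?A p" using b1(1) by auto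
      have "fst (s b1) \<in> B" using VD(3)[OF s(1) b1(1)] b1(2) by simp
      from old_leaf[OF this] arc_leaf_trans[OF sb] have "B \<subseteq> fst ` arc_leaf ?A p" by auto
      moreover have "x1 \<in> fst ` arc_leaf ?A p" using p1 arc_leaf_refl[of p ?A] by (metis imageI)
      ultimately show ?thesis by (simp add: B'_def)
    qed
    have over: "fst ` \<Union>?A \<subseteq> B'"
      using integral_arcs_restrict_over[of _ F "fst -` B'"] by auto
    have sub_boxes: "\<exists>V S. q \<in> V \<and> flow_box ?A (subtopology sphere_top B') fst V S" if q: "q \<in> B'" for q
    proof -
      obtain V S where "q \<in> V" "V \<subseteq> B'" "flow_box ?A sphere_top fst V S" using boxes[OF q] by auto
      then show ?thesis using flow_box_subtopology[of ?A sphere_top fst V S B'] by (intro exI[of _ V] exI[of _ S]) simp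
    qed
    show ?thesis
      unfolding leaf_top_def leaf_eq_arc_leaf
      by (rule covering_map_of_flow_boxes[where X = "subtopology sphere_top B'", unfolded topB, OF sub_boxes over p surj])
  qed
  with sing at_pts have tf: "transverse_to_fibration ?F B'"
    unfolding transverse_to_fibration_def by simp
  have comp: "- (fst -` (- B')) = (fst -` B' :: total set)" by auto
  have ne: "fst -` (- B') \<noteq> (UNIV :: total set)"
  proof
    assume "fst -` (- B') = (UNIV :: total set)"
    then have "(x1, undefined) \<in> (fst -` (- B') :: total set)" by simp
    then show False by (simp add: B'_def)
  qed
  show ?thesis
    unfolding transverse_off_def B'_def[symmetric] comp
    using analytic_subset_finite[OF fin] ne tf by (intro conjI exI[of _ B']) simp_all
qed

text \<open>The least number of excluded fibres gives minimality under inclusion, because the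
  complements are finite. The same choice forces a vertical point on every excluded fibre, since
  otherwise the fibre could be added to \<open>B\<close>.\<close>

lemma riccati_foliation_of_transverse:
  assumes F: "singular_foliation F" and pf: "poly_field X" and X: "given_by F X"
    and almost: "transverse_to_almost_every_fibre F"
  shows "riccati_foliation F"
proof -
  let ?good = "\<lambda>B. transverse_off F (fst -` (- B))"
  obtain B0 where "?good B0"
    using almost unfolding transverse_to_almost_every_fibre_def transverse_off_def by blast
  then obtain B where B: "?good B" and least: "\<And>B'. ?good B' \<Longrightarrow> card (- B) \<le> card (- B')"
    using ex_has_least_nat[of ?good B0 "\<lambda>B. card (- B)"] by blast
  note Bfacts = transverse_off_transversal_over[OF F B]
  have "exceptional_set F (fst -` (- B))"
    unfolding exceptional_set_def
  proof (intro conjI allI impI B)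
    fix \<Lambda>' assume \<Lambda>': "transverse_off F \<Lambda>' \<and> \<Lambda>' \<subseteq> fst -` (- B)"
    then obtain B' where B': "\<Lambda>' = fst -` (- B')" unfolding transverse_off_def by auto
    have "- B' \<subseteq> - B"
    proof (rule subsetI)
      fix x assume "x \<in> - B'"
      \<comment> \<open>\<open>undefined\<close> is an arbitrary point of the fibre; one point of
        each fibre decides which fibres belong to the union.\<close>
      then have "(x, undefined) \<in> \<Lambda>'" by (simp add: B')
      then show "x \<in> - B" using \<Lambda>' by auto
    qed
    moreover have "card (- B) \<le> card (- B')" using least \<Lambda>' B' by simp
    ultimately have "- B' = - B" using Bfacts(3) by (intro card_seteq)
    then show "\<Lambda>' = fst -` (- B)" by (simp add: B')
  qed
  moreover have "invariant_set F (fst -` (- B))"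
    unfolding invariant_set_def
  proof
    fix q assume "q \<in> fst -` (- B) - singular_set F"
    then have x1: "fst q \<notin> B" by simp
    have "\<exists>q0. vertical_at F (fst q, q0)"
    proof (rule ccontr)
      assume "\<nexists>q0. vertical_at F (fst q, q0)"
      then have "?good (insert (fst q) B)" by (intro transverse_off_insert[OF F pf X B]) auto
      then have "card (- B) \<le> card (- insert (fst q) B)" by (rule least)
      moreover have "card (- insert (fst q) B) < card (- B)"
        using Bfacts(3) x1 by (intro psubset_card_mono) auto
      ultimately show False by simp
    qed
    then have "vertical_at F (fst q, q')" for q'
      using vertical_fibre_dichotomy[OF F Bfacts(3,1)] by blast
    then have "leaf F q \<subseteq> fst -` {fst q}" by (rule vertical_fibre_invariant[OF F _ refl])
    then show "leaf F q \<subseteq> fst -` (- B)" using x1 by auto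
  qed
  ultimately show ?thesis using almost unfolding riccati_foliation_def by blast
qed

theorem theorem3:
  fixes F :: "generator set" and X :: "complex^3 \<Rightarrow> complex^3"
  assumes "singular_foliation F"
    and "poly_field X" and "given_by F X"
    and "transverse_to_almost_every_fibre F"
  shows "riccati_foliation F \<and>
    (\<exists>p a b c A B C D E :: complex poly. \<forall>x y z :: complex.
       X (vector [x, y, z]) = vector
         [poly p x,
          poly A x + poly B x * y + poly C x * z + poly D x * y * z + poly E x * y^2,
          poly a x + poly b x * y + poly c x * z + poly E x * y * z + poly D x * z^2])"
proof
  show "riccati_foliation F" by (rule riccati_foliation_of_transverse[OF assms])
  obtain B where B: "transverse_off F (fst -` (- B))"
    using assms(4) unfolding transverse_to_almost_every_fibre_def transverse_off_def by blast
  note Bfacts = transverse_off_transversal_over[OF assms(1) B]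
  obtain p a b c A B' C D E where form: "riccati_coeffs X p a b c A B' C D E"
    using riccati_form[OF assms(1-3) Bfacts(3,1)] by blast
  show "\<exists>p a b c A B C D E :: complex poly. \<forall>x y z :: complex.
       X (vector [x, y, z]) = vector
         [poly p x,
          poly A x + poly B x * y + poly C x * z + poly D x * y * z + poly E x * y^2,
          poly a x + poly b x * y + poly c x * z + poly E x * y * z + poly D x * z^2]"
    by (rule exI[of _ p], rule exI[of _ a], rule exI[of _ b], rule exI[of _ c], rule exI[of _ A],
      rule exI[of _ B'], rule exI[of _ C], rule exI[of _ D], rule exI[of _ E])
      (use form in \<open>simp add: riccati_coeffs_def vec3_eq_iff vector_3\<close>)
qed

end
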